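(* Let $(G,m,u,\iota)$ be a group object in a Cartesian tangent category $\mathbb X$ for which the pullback $T(G)_u$ of $p_G:T(G)\to G$ along $u:1\to G$ exists. Then the set $\mathbb X(1,T(G)_u)$, with the addition, zero, negation and bracket transported from left-invariant vector fields on $G$ along the bijection $\xi\mapsto\langle !,u\xi\rangle$, is a Lie algebra over the ring of integers $\mathbb Z$.
   Context: Composition is written in diagrammatic order: $fg$ means first $f$, then $g$. Tangent category $(\mathbb X,T,p,0,+,\ell,c)$: a category $\mathbb X$ with a functor $T:\mathbb X\to\mathbb X$ and a natural transformation $p:T\to 1$ such that the pullback powers $T_n(M)$ of $p_M$ ($n$-fold fibre products of $T(M)$ over $M$) exist for all objects $M$ and are preserved by $T$; natural transformations $+:T_2\to T$, $0:1\to T$ making each $p_M$ an additive bundle (a commutative monoid over $M$: $+p=\pi_0p=\pi_1p$, $0p=1$, $+$ associative, commutative, with unit $0$; no negatives are assumed); a natural transformation $\ell:T\to T^2$ such that $(\ell_M,0_M):(p_M,+_M,0_M)\to(T(p_M),T(+_M),T(0_M))$ is an additive bundle morphism (commutes with projections, additions and zeros); a natural transformation $c:T^2\to T^2$ with $c^2=1$, $\ell c=\ell$ such that $(c_M,1):(T(p_M),T(+_M),T(0_M))\to(p_{TM},+_{TM},0_{TM})$ is an additive bundle morphism; such that $\ell T(\ell)=\ell\,\ell_T$, $T(c)\,c_T\,T(c)=c_T\,T(c)\,c_T$, $\ell_T\,T(c)\,c_T=c\,T(\ell)$, and $\langle\pi_0\ell,\pi_1 0_T\rangle T(+):T_2M\to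 T^2M$ is the equalizer of $T(p)$ and $T(p)p0:T^2M\to TM$. Cartesian tangent category: a tangent category with all finite products (terminal object $1$) such that the product functor, with the natural isomorphism $T(A)\times T(B)\cong T(A\times B)$, is a strong morphism of tangent categories (the canonical comparison maps are isomorphisms compatible with $p,0,+,\ell,c$). These identifications are suppressed. A vector field on $G$ is $\xi:G\to T(G)$ with $\xi p=1_G$; it is left-invariant if $(0\times\xi)T(m)=m\xi:G\times G\to T(G)$. The map $\xi\mapsto\langle !,u\xi\rangle$ is a bijection from the left-invariant vector fields to $\mathbb X(1,T(G)_u)$, where $\langle !,h\rangle$ denotes the map into the pullback $T(G)_u$ induced by $h$ with $hp=!u$. The additive bundles $p_G:T(G)\to G$ and $p_{T(G)}:T^2(G)\to T(G)$ have (unique) negations, both written $-$ (a negation on an additive bundle $q:X\to A$ is $-:X\to X$ with $-q=q$ and $\langle 1,-\rangle+=q0$). The abelian group operations on vector fields are: sum $\langle\xi,\zeta\rangle+$, zero $0_G$, negative $\xi-$. The bracket of vector fields is $$[w_1,w_2]=\{\langle w_1T(w_2),\,w_2T(w_1)c-\rangle+_{T(G)}\},$$ where for $f:A\to T^2(G)$ with $fT(p)=fpp0$, $\{f\}:A\to T(G)$ is the unique map with $f=\langle\{f\}\ell,fp0\rangle T(+)$. Left-invariant vector fields are closed under these operations. A Lie algebra over $\mathbb Z$ is a $\mathbb Z$-module with a $\mathbb Z$-bilinear, antisymmetric bracket satisfying the Jacobi identity. *)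

theory Defs
  imports "HOL-Algebra.IntRing" "HOL-Algebra.Module"
begin

text \<open>Composition is in diagrammatic order throughout: \<open>f \<Zcomp> g\<close> means first \<open>f\<close>, then \<open>g\<close>.\<close>

section \<open>Categories and limits\<close>

record ('o, 'a) cat =
  Obj :: "'o set"
  Arr :: "'a set"
  Dom :: "'a \<Rightarrow> 'o"
  Cod :: "'a \<Rightarrow> 'o"
  Id :: "'o \<Rightarrow> 'a"
  Comp :: "'a \<Rightarrow> 'a \<Rightarrow> 'a"  (infixl "\<Zcomp>\<index>" 70)

definition Hom :: "('o, 'a, 'm) cat_scheme \<Rightarrow> 'o \<Rightarrow> 'o \<Rightarrow> 'a set"
  where "Hom C A B = {f \<in> Arr C. Dom C f = A \<and> Cod C f = B}"

locale category =
  fixes C :: "('o, 'a, 'm) cat_scheme" (structure)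
  assumes Dom_Obj: "f \<in> Arr C \<Longrightarrow> Dom C f \<in> Obj C"
    and Cod_Obj: "f \<in> Arr C \<Longrightarrow> Cod C f \<in> Obj C"
    and Id_Hom: "A \<in> Obj C \<Longrightarrow> Id C A \<in> Hom C A A"
    and Comp_Hom: "\<lbrakk>f \<in> Hom C A B; g \<in> Hom C B D\<rbrakk> \<Longrightarrow> f \<Zcomp> g \<in> Hom C A D"
    and Id_left: "f \<in> Hom C A B \<Longrightarrow> Id C A \<Zcomp> f = f"
    and Id_right: "f \<in> Hom C A B \<Longrightarrow> f \<Zcomp> Id C B = f"
    and Comp_assoc: "\<lbrakk>f \<in> Hom C A B; g \<in> Hom C B D; h \<in> Hom C D E\<rbrakk>
      \<Longrightarrow> (f \<Zcomp> g) \<Zcomp> h = f \<Zcomp> (g \<Zcomp> h)"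

definition is_inverse :: "('o, 'a, 'm) cat_scheme \<Rightarrow> 'a \<Rightarrow> 'a \<Rightarrow> bool"
  where "is_inverse C f g \<longleftrightarrow> f \<in> Arr C \<and> g \<in> Hom C (Cod C f) (Dom C f)
    \<and> f \<Zcomp>\<^bsub>C\<^esub> g = Id C (Dom C f) \<and> g \<Zcomp>\<^bsub>C\<^esub> f = Id C (Cod C f)"

definition inverse_arr :: "('o, 'a, 'm) cat_scheme \<Rightarrow> 'a \<Rightarrow> 'a"
  where "inverse_arr C f = (THE g. is_inverse C f g)"

definition is_terminal :: "('o, 'a, 'm) cat_scheme \<Rightarrow> 'o \<Rightarrow> bool"
  where "is_terminal C Z \<longleftrightarrow> Z \<in> Obj C \<and> (\<forall>A \<in> Obj C. \<exists>!f. f \<in> Hom C A Z)"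

definition is_product :: "('o, 'a, 'm) cat_scheme \<Rightarrow> 'a \<Rightarrow> 'a \<Rightarrow> bool"
  where "is_product C a b \<longleftrightarrow> a \<in> Arr C \<and> b \<in> Arr C \<and> Dom C a = Dom C b
    \<and> (\<forall>Y h k. h \<in> Hom C Y (Cod C a) \<and> k \<in> Hom C Y (Cod C b)
        \<longrightarrow> (\<exists>!t. t \<in> Hom C Y (Dom C a) \<and> t \<Zcomp>\<^bsub>C\<^esub> a = h \<and> t \<Zcomp>\<^bsub>C\<^esub> b = k))"

text \<open>\<open>a\<close> and \<open>b\<close> are the projections of a pullback of \<open>f\<close> and \<open>g\<close>.\<close>

definition is_pullback :: "('o, 'a, 'm) cat_scheme \<Rightarrow> 'a \<Rightarrow> 'a \<Rightarrow> 'a \<Rightarrow> 'a \<Rightarrow> bool"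
  where "is_pullback C f g a b \<longleftrightarrow> f \<in> Arr C \<and> g \<in> Arr C \<and> a \<in> Arr C \<and> b \<in> Arr C
    \<and> Cod C f = Cod C g \<and> Dom C a = Dom C b \<and> Cod C a = Dom C f \<and> Cod C b = Dom C g
    \<and> a \<Zcomp>\<^bsub>C\<^esub> f = b \<Zcomp>\<^bsub>C\<^esub> g
    \<and> (\<forall>Y h k. h \<in> Hom C Y (Dom C f) \<and> k \<in> Hom C Y (Dom C g) \<and> h \<Zcomp>\<^bsub>C\<^esub> f = k \<Zcomp>\<^bsub>C\<^esub> g
        \<longrightarrow> (\<exists>!t. t \<in> Hom C Y (Dom C a) \<and> t \<Zcomp>\<^bsub>C\<^esub> a = h \<and> t \<Zcomp>\<^bsub>C\<^esub> b = k))"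

text \<open>The \<open>n\<close>-fold fibre product of \<open>f\<close> with itself over its codomain, with projections
  \<open>\<pi> i\<close> for \<open>i < n\<close>. The structure map \<open>q\<close> to the base is part of the cone, so that
  \<open>n = 0\<close> is covered (giving the base).\<close>

definition is_fibre_power ::
    "('o, 'a, 'm) cat_scheme \<Rightarrow> nat \<Rightarrow> 'a \<Rightarrow> 'a \<Rightarrow> (nat \<Rightarrow> 'a) \<Rightarrow> bool"
  where "is_fibre_power C n f q \<pi> \<longleftrightarrow> f \<in> Arr C \<and> q \<in> Arr C \<and> Cod C q = Cod C f
    \<and> (\<forall>i<n. \<pi> i \<in> Hom C (Dom C q) (Dom C f) \<and> \<pi> i \<Zcomp>\<^bsub>C\<^esub> f = q)
    \<and> (\<forall>Y x g. x \<in> Hom C Y (Cod C f) \<and> (\<forall>i<n. g i \<in> Hom C Y (Dom C f) \<and> g i \<Zcomp>\<^bsub>C\<^esub> f = x)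
        \<longrightarrow> (\<exists>!t. t \<in> Hom C Y (Dom C q) \<and> t \<Zcomp>\<^bsub>C\<^esub> q = x \<and> (\<forall>i<n. t \<Zcomp>\<^bsub>C\<^esub> \<pi> i = g i)))"

definition is_equalizer :: "('o, 'a, 'm) cat_scheme \<Rightarrow> 'a \<Rightarrow> 'a \<Rightarrow> 'a \<Rightarrow> bool"
  where "is_equalizer C e f g \<longleftrightarrow> e \<in> Arr C \<and> f \<in> Arr C \<and> g \<in> Arr C
    \<and> Dom C f = Cod C e \<and> Dom C g = Cod C e \<and> Cod C f = Cod C g
    \<and> e \<Zcomp>\<^bsub>C\<^esub> f = e \<Zcomp>\<^bsub>C\<^esub> g
    \<and> (\<forall>Y h. h \<in> Hom C Y (Cod C e) \<and> h \<Zcomp>\<^bsub>C\<^esub> f = h \<Zcomp>\<^bsub>C\<^esub> g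
        \<longrightarrow> (\<exists>!t. t \<in> Hom C Y (Dom C e) \<and> t \<Zcomp>\<^bsub>C\<^esub> e = h))"

text \<open>The map \<open>\<langle>h, k\<rangle>\<close> into a product or pullback with projections \<open>a\<close> and \<open>b\<close>.\<close>

definition pair :: "('o, 'a, 'm) cat_scheme \<Rightarrow> 'a \<Rightarrow> 'a \<Rightarrow> 'a \<Rightarrow> 'a \<Rightarrow> 'a"
  where "pair C a b h k =
    (THE t. t \<in> Hom C (Dom C h) (Dom C a) \<and> t \<Zcomp>\<^bsub>C\<^esub> a = h \<and> t \<Zcomp>\<^bsub>C\<^esub> b = k)"

text \<open>A natural transformation \<open>\<tau> : F \<rightarrow> F'\<close> between endofunctors, each given by its object
  map and its arrow map.\<close>

definition is_natural :: "('o, 'a, 'm) cat_scheme \<Rightarrow> ('o \<Rightarrow> 'o) \<Rightarrow> ('a \<Rightarrow> 'a) \<Rightarrow>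
    ('o \<Rightarrow> 'o) \<Rightarrow> ('a \<Rightarrow> 'a) \<Rightarrow> ('o \<Rightarrow> 'a) \<Rightarrow> bool"
  where "is_natural C Fo Fa Fo' Fa' \<tau> \<longleftrightarrow>
      (\<forall>M \<in> Obj C. \<tau> M \<in> Hom C (Fo M) (Fo' M))
    \<and> (\<forall>f \<in> Arr C. Fa f \<Zcomp>\<^bsub>C\<^esub> \<tau> (Cod C f) = \<tau> (Dom C f) \<Zcomp>\<^bsub>C\<^esub> Fa' f)"


section \<open>Additive bundles\<close>

text \<open>The data of an additive bundle \<open>q : X \<rightarrow> A\<close>, including a choice of the fibre square
  \<open>X\<^sub>2\<close> (through its two projections) on which the addition is defined.\<close>

record 'a add_bundle =
  bproj :: 'a
  bpi0 :: 'a
  bpi1 :: 'a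
  bplus :: 'a
  bzero :: 'a

definition bsum :: "('o, 'a, 'm) cat_scheme \<Rightarrow> ('a, 'n) add_bundle_scheme \<Rightarrow> 'a \<Rightarrow> 'a \<Rightarrow> 'a"
  where "bsum C E f g = pair C (bpi0 E) (bpi1 E) f g \<Zcomp>\<^bsub>C\<^esub> bplus E"

text \<open>Associativity is stated on generalised elements \<open>f, g, h : Y \<rightarrow> X\<close> over a common map to
  \<open>A\<close>; the usual diagram is the case of the three projections from \<open>X\<^sub>3\<close>.\<close>

definition additive_bundle :: "('o, 'a, 'm) cat_scheme \<Rightarrow> ('a, 'n) add_bundle_scheme \<Rightarrow> bool"
  where "additive_bundle C E \<longleftrightarrow>
    (let q = bproj E; X = Dom C q; A = Cod C q in
      is_pullback C q q (bpi0 E) (bpi1 E)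
    \<and> bplus E \<in> Hom C (Dom C (bpi0 E)) X
    \<and> bzero E \<in> Hom C A X
    \<and> bplus E \<Zcomp>\<^bsub>C\<^esub> q = bpi0 E \<Zcomp>\<^bsub>C\<^esub> q
    \<and> bzero E \<Zcomp>\<^bsub>C\<^esub> q = Id C A
    \<and> (\<forall>Y f g h. f \<in> Hom C Y X \<and> g \<in> Hom C Y X \<and> h \<in> Hom C Y X
        \<and> f \<Zcomp>\<^bsub>C\<^esub> q = g \<Zcomp>\<^bsub>C\<^esub> q \<and> g \<Zcomp>\<^bsub>C\<^esub> q = h \<Zcomp>\<^bsub>C\<^esub> q
        \<longrightarrow> bsum C E (bsum C E f g) h = bsum C E f (bsum C E g h))
    \<and> bsum C E (bpi1 E) (bpi0 E) = bplus E
    \<and> bsum C E (Id C X) (q \<Zcomp>\<^bsub>C\<^esub> bzero E) = Id C X)"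

text \<open>The map \<open>(f, g)\<close> from \<open>E\<close> to \<open>F\<close>, with \<open>f\<close> on total objects and \<open>g\<close> on bases.\<close>

definition additive_bundle_morphism :: "('o, 'a, 'm) cat_scheme \<Rightarrow>
    ('a, 'n) add_bundle_scheme \<Rightarrow> ('a, 'n) add_bundle_scheme \<Rightarrow> 'a \<Rightarrow> 'a \<Rightarrow> bool"
  where "additive_bundle_morphism C E F f g \<longleftrightarrow>
      f \<in> Hom C (Dom C (bproj E)) (Dom C (bproj F))
    \<and> g \<in> Hom C (Cod C (bproj E)) (Cod C (bproj F))
    \<and> f \<Zcomp>\<^bsub>C\<^esub> bproj F = bproj E \<Zcomp>\<^bsub>C\<^esub> g
    \<and> bplus E \<Zcomp>\<^bsub>C\<^esub> f = bsum C F (bpi0 E \<Zcomp>\<^bsub>C\<^esub> f) (bpi1 E \<Zcomp>\<^bsub>C\<^esub> f)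
    \<and> bzero E \<Zcomp>\<^bsub>C\<^esub> f = g \<Zcomp>\<^bsub>C\<^esub> bzero F"

definition is_negation :: "('o, 'a, 'm) cat_scheme \<Rightarrow> ('a, 'n) add_bundle_scheme \<Rightarrow> 'a \<Rightarrow> bool"
  where "is_negation C E n \<longleftrightarrow>
    (let q = bproj E; X = Dom C q in
      n \<in> Hom C X X \<and> n \<Zcomp>\<^bsub>C\<^esub> q = q
    \<and> bsum C E (Id C X) n = q \<Zcomp>\<^bsub>C\<^esub> bzero E)"


section \<open>Tangent categories\<close>

text \<open>\<open>T2 M\<close> with projections \<open>pi0 M\<close>, \<open>pi1 M\<close> is the chosen fibre square of \<open>proj M\<close>;
  \<open>vlift\<close> is the vertical lift \<open>\<ell>\<close> and \<open>flip\<close> the canonical flip \<open>c\<close>.\<close>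

record ('o, 'a) tangent_cat = "('o, 'a) cat" +
  Tob :: "'o \<Rightarrow> 'o"
  Tar :: "'a \<Rightarrow> 'a"
  proj :: "'o \<Rightarrow> 'a"
  T2 :: "'o \<Rightarrow> 'o"
  pi0 :: "'o \<Rightarrow> 'a"
  pi1 :: "'o \<Rightarrow> 'a"
  tzero :: "'o \<Rightarrow> 'a"
  tplus :: "'o \<Rightarrow> 'a"
  vlift :: "'o \<Rightarrow> 'a"
  flip :: "'o \<Rightarrow> 'a"

definition T2_ar :: "('o, 'a, 'm) tangent_cat_scheme \<Rightarrow> 'a \<Rightarrow> 'a"
  where "T2_ar X f = pair X (pi0 X (Cod X f)) (pi1 X (Cod X f))
    (pi0 X (Dom X f) \<Zcomp>\<^bsub>X\<^esub> Tar X f) (pi1 X (Dom X f) \<Zcomp>\<^bsub>X\<^esub> Tar X f)"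

text \<open>The bundles \<open>(p, +, 0)\<close> and \<open>(T(p), T(+), T(0))\<close> at \<open>M\<close>.\<close>

definition tangent_bundle :: "('o, 'a, 'm) tangent_cat_scheme \<Rightarrow> 'o \<Rightarrow> 'a add_bundle"
  where "tangent_bundle X M = \<lparr>bproj = proj X M, bpi0 = pi0 X M, bpi1 = pi1 X M,
    bplus = tplus X M, bzero = tzero X M\<rparr>"

definition T_bundle :: "('o, 'a, 'm) tangent_cat_scheme \<Rightarrow> 'o \<Rightarrow> 'a add_bundle"
  where "T_bundle X M = \<lparr>bproj = Tar X (proj X M), bpi0 = Tar X (pi0 X M),
    bpi1 = Tar X (pi1 X M), bplus = Tar X (tplus X M), bzero = Tar X (tzero X M)\<rparr>"

locale tangent_category = category X for X :: "('o, 'a, 'm) tangent_cat_scheme" (structure) +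
  assumes Tob_Obj: "M \<in> Obj X \<Longrightarrow> Tob X M \<in> Obj X"
    and Tar_Hom: "f \<in> Hom X A B \<Longrightarrow> Tar X f \<in> Hom X (Tob X A) (Tob X B)"
    and Tar_Id: "A \<in> Obj X \<Longrightarrow> Tar X (Id X A) = Id X (Tob X A)"
    and Tar_Comp: "\<lbrakk>f \<in> Hom X A B; g \<in> Hom X B D\<rbrakk> \<Longrightarrow> Tar X (f \<Zcomp> g) = Tar X f \<Zcomp> Tar X g"
    and proj_natural: "is_natural X (Tob X) (Tar X) id id (proj X)"
    and powers_exist: "M \<in> Obj X \<Longrightarrow> \<exists>q \<pi>. is_fibre_power X n (proj X M) q \<pi>"
    and powers_preserved: "\<lbrakk>M \<in> Obj X; is_fibre_power X n (proj X M) q \<pi>\<rbrakk>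
      \<Longrightarrow> is_fibre_power X n (Tar X (proj X M)) (Tar X q) (\<lambda>i. Tar X (\<pi> i))"
    and T2_Dom: "M \<in> Obj X \<Longrightarrow> Dom X (pi0 X M) = T2 X M"
    and T2_pullback: "M \<in> Obj X \<Longrightarrow> is_pullback X (proj X M) (proj X M) (pi0 X M) (pi1 X M)"
    and tzero_natural: "is_natural X id id (Tob X) (Tar X) (tzero X)"
    and tplus_natural: "is_natural X (T2 X) (T2_ar X) (Tob X) (Tar X) (tplus X)"
    and tangent_bundle_additive: "M \<in> Obj X \<Longrightarrow> additive_bundle X (tangent_bundle X M)"
    and vlift_natural:
      "is_natural X (Tob X) (Tar X) (Tob X \<circ> Tob X) (Tar X \<circ> Tar X) (vlift X)"
    and vlift_additive: "M \<in> Obj X \<Longrightarrow>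
      additive_bundle_morphism X (tangent_bundle X M) (T_bundle X M) (vlift X M) (tzero X M)"
    and flip_natural:
      "is_natural X (Tob X \<circ> Tob X) (Tar X \<circ> Tar X) (Tob X \<circ> Tob X) (Tar X \<circ> Tar X) (flip X)"
    and flip_flip: "M \<in> Obj X \<Longrightarrow> flip X M \<Zcomp> flip X M = Id X (Tob X (Tob X M))"
    and vlift_flip: "M \<in> Obj X \<Longrightarrow> vlift X M \<Zcomp> flip X M = vlift X M"
    and flip_additive: "M \<in> Obj X \<Longrightarrow>
      additive_bundle_morphism X (T_bundle X M) (tangent_bundle X (Tob X M))
        (flip X M) (Id X (Tob X M))"
    and vlift_vlift: "M \<in> Obj X \<Longrightarrow>
      vlift X M \<Zcomp> Tar X (vlift X M) = vlift X M \<Zcomp> vlift X (Tob X M)"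
    and flip_braid: "M \<in> Obj X \<Longrightarrow>
      Tar X (flip X M) \<Zcomp> flip X (Tob X M) \<Zcomp> Tar X (flip X M)
        = flip X (Tob X M) \<Zcomp> Tar X (flip X M) \<Zcomp> flip X (Tob X M)"
    and vlift_flip_flip: "M \<in> Obj X \<Longrightarrow>
      vlift X (Tob X M) \<Zcomp> Tar X (flip X M) \<Zcomp> flip X (Tob X M) = flip X M \<Zcomp> Tar X (vlift X M)"
    and vlift_universal: "M \<in> Obj X \<Longrightarrow>
      is_equalizer X
        (bsum X (T_bundle X M) (pi0 X M \<Zcomp> vlift X M) (pi1 X M \<Zcomp> tzero X (Tob X M)))
        (Tar X (proj X M))
        (Tar X (proj X M) \<Zcomp> proj X M \<Zcomp> tzero X M)"

text \<open>A meaningful arrow only if \<open>p\<close> at \<open>M\<close> admits a negation, which is then unique.\<close>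

definition neg :: "('o, 'a, 'm) tangent_cat_scheme \<Rightarrow> 'o \<Rightarrow> 'a"
  where "neg X M = (THE n. is_negation X (tangent_bundle X M) n)"

text \<open>\<open>{f}\<close> for \<open>f : A \<rightarrow> T\<^sup>2(M)\<close>. The first condition on \<open>h\<close> says that the pairing
  \<open>\<langle>h\<ell>, fp0\<rangle>\<close> in the second one exists.\<close>

definition brace :: "('o, 'a, 'm) tangent_cat_scheme \<Rightarrow> 'o \<Rightarrow> 'a \<Rightarrow> 'a"
  where "brace X M f = (THE h. h \<in> Hom X (Dom X f) (Tob X M)
    \<and> h \<Zcomp>\<^bsub>X\<^esub> proj X M = f \<Zcomp>\<^bsub>X\<^esub> proj X (Tob X M) \<Zcomp>\<^bsub>X\<^esub> proj X M
    \<and> f = bsum X (T_bundle X M) (h \<Zcomp>\<^bsub>X\<^esub> vlift X M)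
            (f \<Zcomp>\<^bsub>X\<^esub> proj X (Tob X M) \<Zcomp>\<^bsub>X\<^esub> tzero X (Tob X M)))"

definition vector_fields :: "('o, 'a, 'm) tangent_cat_scheme \<Rightarrow> 'o \<Rightarrow> 'a set"
  where "vector_fields X M = {\<xi> \<in> Hom X M (Tob X M). \<xi> \<Zcomp>\<^bsub>X\<^esub> proj X M = Id X M}"

definition vf_bracket :: "('o, 'a, 'm) tangent_cat_scheme \<Rightarrow> 'o \<Rightarrow> 'a \<Rightarrow> 'a \<Rightarrow> 'a"
  where "vf_bracket X M w1 w2 = brace X M
    (bsum X (tangent_bundle X (Tob X M))
      (w1 \<Zcomp>\<^bsub>X\<^esub> Tar X w2)
      (w2 \<Zcomp>\<^bsub>X\<^esub> Tar X w1 \<Zcomp>\<^bsub>X\<^esub> flip X M \<Zcomp>\<^bsub>X\<^esub> neg X (Tob X M)))"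


section \<open>Cartesian tangent categories and group objects\<close>

record ('o, 'a) cartesian_tangent_cat = "('o, 'a) tangent_cat" +
  One :: 'o
  Prod :: "'o \<Rightarrow> 'o \<Rightarrow> 'o"
  pr0 :: "'o \<Rightarrow> 'o \<Rightarrow> 'a"
  pr1 :: "'o \<Rightarrow> 'o \<Rightarrow> 'a"

definition bang :: "('o, 'a, 'm) cartesian_tangent_cat_scheme \<Rightarrow> 'o \<Rightarrow> 'a"
  where "bang X A = (THE f. f \<in> Hom X A (One X))"

definition prod_pair :: "('o, 'a, 'm) cartesian_tangent_cat_scheme \<Rightarrow> 'a \<Rightarrow> 'a \<Rightarrow> 'a"
  where "prod_pair X f g =
    pair X (pr0 X (Cod X f) (Cod X g)) (pr1 X (Cod X f) (Cod X g)) f g"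

definition prod_map :: "('o, 'a, 'm) cartesian_tangent_cat_scheme \<Rightarrow> 'a \<Rightarrow> 'a \<Rightarrow> 'a"
  where "prod_map X f g = prod_pair X
    (pr0 X (Dom X f) (Dom X g) \<Zcomp>\<^bsub>X\<^esub> f) (pr1 X (Dom X f) (Dom X g) \<Zcomp>\<^bsub>X\<^esub> g)"

text \<open>The canonical comparison maps \<open>T(A \<times> B) \<rightarrow> T(A) \<times> T(B)\<close> and
  \<open>T\<^sub>2(A \<times> B) \<rightarrow> T\<^sub>2(A) \<times> T\<^sub>2(B)\<close>.\<close>

definition T_comparison :: "('o, 'a, 'm) cartesian_tangent_cat_scheme \<Rightarrow> 'o \<Rightarrow> 'o \<Rightarrow> 'a"
  where "T_comparison X A B = prod_pair X (Tar X (pr0 X A B)) (Tar X (pr1 X A B))"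

definition T2_comparison :: "('o, 'a, 'm) cartesian_tangent_cat_scheme \<Rightarrow> 'o \<Rightarrow> 'o \<Rightarrow> 'a"
  where "T2_comparison X A B = prod_pair X (T2_ar X (pr0 X A B)) (T2_ar X (pr1 X A B))"

locale cartesian_tangent_category = tangent_category X
  for X :: "('o, 'a, 'm) cartesian_tangent_cat_scheme" (structure) +
  assumes One_terminal: "is_terminal X (One X)"
    and pr0_Hom: "\<lbrakk>A \<in> Obj X; B \<in> Obj X\<rbrakk> \<Longrightarrow> pr0 X A B \<in> Hom X (Prod X A B) A"
    and pr1_Hom: "\<lbrakk>A \<in> Obj X; B \<in> Obj X\<rbrakk> \<Longrightarrow> pr1 X A B \<in> Hom X (Prod X A B) B"
    and Prod_product: "\<lbrakk>A \<in> Obj X; B \<in> Obj X\<rbrakk> \<Longrightarrow> is_product X (pr0 X A B) (pr1 X A B)"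
    and T_One_terminal: "is_terminal X (Tob X (One X))"
    and T_comparison_iso: "\<lbrakk>A \<in> Obj X; B \<in> Obj X\<rbrakk> \<Longrightarrow> \<exists>g. is_inverse X (T_comparison X A B) g"
    and T_comparison_proj: "\<lbrakk>A \<in> Obj X; B \<in> Obj X\<rbrakk> \<Longrightarrow>
      T_comparison X A B \<Zcomp> prod_map X (proj X A) (proj X B) = proj X (Prod X A B)"
    and T_comparison_tzero: "\<lbrakk>A \<in> Obj X; B \<in> Obj X\<rbrakk> \<Longrightarrow>
      tzero X (Prod X A B) \<Zcomp> T_comparison X A B = prod_map X (tzero X A) (tzero X B)"
    and T_comparison_tplus: "\<lbrakk>A \<in> Obj X; B \<in> Obj X\<rbrakk> \<Longrightarrow>
      tplus X (Prod X A B) \<Zcomp> T_comparison X A B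
        = T2_comparison X A B \<Zcomp> prod_map X (tplus X A) (tplus X B)"
    and T_comparison_vlift: "\<lbrakk>A \<in> Obj X; B \<in> Obj X\<rbrakk> \<Longrightarrow>
      vlift X (Prod X A B) \<Zcomp> Tar X (T_comparison X A B) \<Zcomp> T_comparison X (Tob X A) (Tob X B)
        = T_comparison X A B \<Zcomp> prod_map X (vlift X A) (vlift X B)"
    and T_comparison_flip: "\<lbrakk>A \<in> Obj X; B \<in> Obj X\<rbrakk> \<Longrightarrow>
      flip X (Prod X A B) \<Zcomp> Tar X (T_comparison X A B) \<Zcomp> T_comparison X (Tob X A) (Tob X B)
        = Tar X (T_comparison X A B) \<Zcomp> T_comparison X (Tob X A) (Tob X B)
            \<Zcomp> prod_map X (flip X A) (flip X B)"

definition group_object ::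
    "('o, 'a, 'm) cartesian_tangent_cat_scheme \<Rightarrow> 'o \<Rightarrow> 'a \<Rightarrow> 'a \<Rightarrow> 'a \<Rightarrow> bool"
  where "group_object X G m u i \<longleftrightarrow>
      G \<in> Obj X \<and> m \<in> Hom X (Prod X G G) G \<and> u \<in> Hom X (One X) G \<and> i \<in> Hom X G G
    \<and> (let a = pr0 X (Prod X G G) G \<Zcomp>\<^bsub>X\<^esub> pr0 X G G;
           b = pr0 X (Prod X G G) G \<Zcomp>\<^bsub>X\<^esub> pr1 X G G;
           d = pr1 X (Prod X G G) G
       in prod_pair X (prod_pair X a b \<Zcomp>\<^bsub>X\<^esub> m) d \<Zcomp>\<^bsub>X\<^esub> m
            = prod_pair X a (prod_pair X b d \<Zcomp>\<^bsub>X\<^esub> m) \<Zcomp>\<^bsub>X\<^esub> m)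
    \<and> prod_pair X (bang X G \<Zcomp>\<^bsub>X\<^esub> u) (Id X G) \<Zcomp>\<^bsub>X\<^esub> m = Id X G
    \<and> prod_pair X (Id X G) (bang X G \<Zcomp>\<^bsub>X\<^esub> u) \<Zcomp>\<^bsub>X\<^esub> m = Id X G
    \<and> prod_pair X i (Id X G) \<Zcomp>\<^bsub>X\<^esub> m = bang X G \<Zcomp>\<^bsub>X\<^esub> u
    \<and> prod_pair X (Id X G) i \<Zcomp>\<^bsub>X\<^esub> m = bang X G \<Zcomp>\<^bsub>X\<^esub> u"

text \<open>\<open>(0 \<times> \<xi>)T(m) = m\<xi>\<close>, with the identification \<open>T(G) \<times> T(G) \<cong> T(G \<times> G)\<close> made
  explicit.\<close>

definition left_invariant_vfs ::
    "('o, 'a, 'm) cartesian_tangent_cat_scheme \<Rightarrow> 'o \<Rightarrow> 'a \<Rightarrow> 'a set"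
  where "left_invariant_vfs X G m = {\<xi> \<in> vector_fields X G.
    prod_map X (tzero X G) \<xi> \<Zcomp>\<^bsub>X\<^esub> inverse_arr X (T_comparison X G G) \<Zcomp>\<^bsub>X\<^esub> Tar X m
      = m \<Zcomp>\<^bsub>X\<^esub> \<xi>}"


section \<open>Lie algebras\<close>

record ('r, 'b) lie_alg = "('r, 'b) module" +
  lie :: "'b \<Rightarrow> 'b \<Rightarrow> 'b"

locale lie_algebra = module R L
  for R :: "('r, 'k) ring_scheme" and L :: "('r, 'b, 'n) lie_alg_scheme" (structure) +
  assumes lie_closed: "\<lbrakk>x \<in> carrier L; y \<in> carrier L\<rbrakk> \<Longrightarrow> lie L x y \<in> carrier L"
    and lie_add_left: "\<lbrakk>x \<in> carrier L; y \<in> carrier L; z \<in> carrier L\<rbrakk> \<Longrightarrow>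
      lie L (x \<oplus> y) z = lie L x z \<oplus> lie L y z"
    and lie_add_right: "\<lbrakk>x \<in> carrier L; y \<in> carrier L; z \<in> carrier L\<rbrakk> \<Longrightarrow>
      lie L x (y \<oplus> z) = lie L x y \<oplus> lie L x z"
    and lie_smult_left: "\<lbrakk>r \<in> carrier R; x \<in> carrier L; y \<in> carrier L\<rbrakk> \<Longrightarrow>
      lie L (r \<odot> x) y = r \<odot> lie L x y"
    and lie_smult_right: "\<lbrakk>r \<in> carrier R; x \<in> carrier L; y \<in> carrier L\<rbrakk> \<Longrightarrow>
      lie L x (r \<odot> y) = r \<odot> lie L x y"
    and lie_antisym: "\<lbrakk>x \<in> carrier L; y \<in> carrier L\<rbrakk> \<Longrightarrow> lie L x y = \<ominus> lie L y x"
    and lie_jacobi: "\<lbrakk>x \<in> carrier L; y \<in> carrier L; z \<in> carrier L\<rbrakk> \<Longrightarrow>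
      lie L x (lie L y z) \<oplus> lie L y (lie L z x) \<oplus> lie L z (lie L x y) = \<zero>"

text \<open>Integer multiples for a given addition, zero and negation. Since the given negation is used
  for negative multiples, the module laws force it to be the additive inverse.\<close>

definition int_multiple :: "('b \<Rightarrow> 'b \<Rightarrow> 'b) \<Rightarrow> 'b \<Rightarrow> ('b \<Rightarrow> 'b) \<Rightarrow> int \<Rightarrow> 'b \<Rightarrow> 'b"
  where "int_multiple pl z ng k x =
    (if 0 \<le> k then (pl x ^^ nat k) z else ng ((pl x ^^ nat (- k)) z))"

text \<open>In the following, \<open>e : T(G)\<^sub>u \<rightarrow> 1\<close> and \<open>j : T(G)\<^sub>u \<rightarrow> T(G)\<close> are the projections of
  the pullback \<open>T(G)\<^sub>u\<close> of \<open>p\<close> along \<open>u\<close>.\<close>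

definition at_unit :: "('o, 'a, 'm) cartesian_tangent_cat_scheme \<Rightarrow> 'a \<Rightarrow> 'a \<Rightarrow> 'a \<Rightarrow> 'a \<Rightarrow> 'a"
  where "at_unit X u e j \<xi> = pair X e j (bang X (One X)) (u \<Zcomp>\<^bsub>X\<^esub> \<xi>)"

definition extend_vf :: "('o, 'a, 'm) cartesian_tangent_cat_scheme \<Rightarrow>
    'o \<Rightarrow> 'a \<Rightarrow> 'a \<Rightarrow> 'a \<Rightarrow> 'a \<Rightarrow> 'a \<Rightarrow> 'a"
  where "extend_vf X G m u e j = the_inv_into (left_invariant_vfs X G m) (at_unit X u e j)"

definition group_lie_plus :: "('o, 'a, 'm) cartesian_tangent_cat_scheme \<Rightarrow>
    'o \<Rightarrow> 'a \<Rightarrow> 'a \<Rightarrow> 'a \<Rightarrow> 'a \<Rightarrow> 'a \<Rightarrow> 'a \<Rightarrow> 'a"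
  where "group_lie_plus X G m u e j x y = at_unit X u e j
    (bsum X (tangent_bundle X G) (extend_vf X G m u e j x) (extend_vf X G m u e j y))"

definition group_lie_zero :: "('o, 'a, 'm) cartesian_tangent_cat_scheme \<Rightarrow>
    'o \<Rightarrow> 'a \<Rightarrow> 'a \<Rightarrow> 'a \<Rightarrow> 'a"
  where "group_lie_zero X G u e j = at_unit X u e j (tzero X G)"

definition group_lie_neg :: "('o, 'a, 'm) cartesian_tangent_cat_scheme \<Rightarrow>
    'o \<Rightarrow> 'a \<Rightarrow> 'a \<Rightarrow> 'a \<Rightarrow> 'a \<Rightarrow> 'a \<Rightarrow> 'a"
  where "group_lie_neg X G m u e j x = at_unit X u e j
    (extend_vf X G m u e j x \<Zcomp>\<^bsub>X\<^esub> neg X G)"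

definition group_lie_bracket :: "('o, 'a, 'm) cartesian_tangent_cat_scheme \<Rightarrow>
    'o \<Rightarrow> 'a \<Rightarrow> 'a \<Rightarrow> 'a \<Rightarrow> 'a \<Rightarrow> 'a \<Rightarrow> 'a \<Rightarrow> 'a"
  where "group_lie_bracket X G m u e j x y = at_unit X u e j
    (vf_bracket X G (extend_vf X G m u e j x) (extend_vf X G m u e j y))"

text \<open>The fields \<open>mult\<close> and \<open>one\<close> are inherited from the library's record of modules and play no
  role there.\<close>

definition group_lie_algebra :: "('o, 'a, 'm) cartesian_tangent_cat_scheme \<Rightarrow>
    'o \<Rightarrow> 'a \<Rightarrow> 'a \<Rightarrow> 'a \<Rightarrow> 'a \<Rightarrow> (int, 'a) lie_alg"
  where "group_lie_algebra X G m u e j = \<lparr>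
    carrier = Hom X (One X) (Dom X j),
    mult = undefined,
    one = undefined,
    zero = group_lie_zero X G u e j,
    add = group_lie_plus X G m u e j,
    smult = int_multiple (group_lie_plus X G m u e j) (group_lie_zero X G u e j)
      (group_lie_neg X G m u e j),
    lie = group_lie_bracket X G m u e j\<rparr>"

end

theory Submission
  imports Defs
begin

text \<open>
  The functor preserves products, so \<open>T\<^sup>n(G)\<close> is again a group object and
  the maps \<open>Y \<rightarrow> T\<^sup>n(G)\<close> form a group. Post-composition with \<open>p\<close>, \<open>0\<close>, \<open>\<ell>\<close>, \<open>c\<close> and their images
  under \<open>T\<close> gives homomorphisms between these groups (\<open>natural_hom\<close>). The fibrewise addition is
  also natural, hence interchanges with the multiplication, and an Eckmann-Hilton argument
  expresses it by the multiplication: \<open>x + y = x e\<inverse> y\<close>, where \<open>e\<close> is the zero over the common base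
  point (\<open>sum_formula\<close>). Consequently the kernel of \<open>p\<close> is an abelian group on which addition is
  multiplication, and the negation \<open>- v = e v\<inverse> e\<close> exists.

  Left-invariant vector fields are the translates \<open>0 \<cdot> x\<close> of the tangent vectors \<open>x : 1 \<rightarrow> T(G)\<close> over
  the unit (\<open>left_invariant_eq_translate\<close>). For such vectors let \<open>\<epsilon>\<^sub>1 x = x T(0)\<close> and \<open>\<epsilon>\<^sub>2 x = x 0\<close>
  be the two ways of regarding \<open>x\<close> as a point of \<open>T\<^sup>2(G)\<close>. Evaluating the definition of the bracket
  at the unit shows that \<open>[x, y] \<ell>\<close> is the group commutator of \<open>\<epsilon>\<^sub>1 x\<close> and \<open>\<epsilon>\<^sub>2 y\<close>
  (\<open>unit_bracket_commutator\<close>). This is the classical description of the Lie algebra of a group over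
  the dual numbers, and the rest is group theory. Since \<open>\<ell>\<close> is monic, antisymmetry follows from
  \<open>\<ell> c = \<ell>\<close> and the fact that \<open>c\<close> exchanges \<open>\<epsilon>\<^sub>1\<close> and \<open>\<epsilon>\<^sub>2\<close>; additivity holds because a commutator
  \<open>w \<ell>\<close> commutes with every \<open>\<epsilon>\<^sub>1 x\<close>.

  For the Jacobi identity the three vectors are placed in the three infinitesimal directions of
  \<open>T\<^sup>3(G)\<close>, giving elements \<open>a\<close>, \<open>b\<close>, \<open>c\<close>. Their pairwise commutators commute with each other, and the
  iterated commutators are the images of the iterated brackets under one monic map
  \<open>\<ell> T(\<ell>) = \<ell> \<ell>\<^sub>T\<close> (\<open>iterated_bracket\<close>). Reordering \<open>abc\<close> into \<open>cba\<close> in two ways then yields the identity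
  (\<open>commutator_jacobi\<close>), a form of the Hall-Witt identity.
\<close>

section \<open>Commutators in a group\<close>

definition group_commutator :: "('a, 'b) monoid_scheme \<Rightarrow> 'a \<Rightarrow> 'a \<Rightarrow> 'a"
  where "group_commutator G a b = a \<otimes>\<^bsub>G\<^esub> b \<otimes>\<^bsub>G\<^esub> inv\<^bsub>G\<^esub> a \<otimes>\<^bsub>G\<^esub> inv\<^bsub>G\<^esub> b"

context group
begin

lemma inv_cancel:
  assumes "x \<in> carrier G" "y \<in> carrier G"
  shows "inv x \<otimes> (x \<otimes> y) = y" "x \<otimes> (inv x \<otimes> y) = y"
  using assms by (simp_all add: m_assoc[symmetric])

lemma commutator_closed [simp]:
  "\<lbrakk>a \<in> carrier G; b \<in> carrier G\<rbrakk> \<Longrightarrow> group_commutator G a b \<in> carrier G"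
  by (simp add: group_commutator_def)

lemma inv_commutator:
  "\<lbrakk>a \<in> carrier G; b \<in> carrier G\<rbrakk> \<Longrightarrow> inv (group_commutator G a b) = group_commutator G b a"
  by (simp add: group_commutator_def inv_mult_group m_assoc)

text \<open>Read from left to right, this moves \<open>a\<close> past \<open>b\<close> at the price of a commutator on the left.\<close>
lemma commutator_swap:
  assumes "a \<in> carrier G" "b \<in> carrier G" "z \<in> carrier G"
  shows "a \<otimes> (b \<otimes> z) = group_commutator G a b \<otimes> (b \<otimes> (a \<otimes> z))"
  using assms by (simp add: group_commutator_def m_assoc inv_cancel)

lemma commutator_mult_left:
  assumes c: "a \<in> carrier G" "a' \<in> carrier G" "b \<in> carrier G"
    and comm: "a \<otimes> group_commutator G a' b = group_commutator G a' b \<otimes> a"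
  shows "group_commutator G (a \<otimes> a') b = group_commutator G a' b \<otimes> group_commutator G a b"
proof -
  have "group_commutator G (a \<otimes> a') b = (a \<otimes> group_commutator G a' b) \<otimes> (b \<otimes> inv a \<otimes> inv b)"
    using c by (simp add: group_commutator_def m_assoc inv_mult_group inv_cancel)
  also have "\<dots> = group_commutator G a' b \<otimes> group_commutator G a b"
    unfolding comm using c by (simp add: group_commutator_def m_assoc)
  finally show ?thesis .
qed

text \<open>Both sides come from comparing two ways of reordering \<open>a b c\<close> into \<open>c b a\<close>: transposing \<open>a b\<close> first
leads to the factor \<open>[b,Q] P Q R\<close> on the left, transposing \<open>b c\<close> first leads to
\<open>[a,R] [c,P] R Q P\<close>. Only those commutation relations are assumed that are needed to cancel \<open>P Q R\<close>.\<close>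
lemma commutator_jacobi:
  assumes c: "a \<in> carrier G" "b \<in> carrier G" "c \<in> carrier G"
    and P: "P = group_commutator G a b" and Q: "Q = group_commutator G a c"
    and R: "R = group_commutator G b c"
    and comm: "P \<otimes> Q = Q \<otimes> P" "P \<otimes> R = R \<otimes> P" "Q \<otimes> R = R \<otimes> Q"
    and bQ: "group_commutator G b Q \<otimes> P = P \<otimes> group_commutator G b Q"
    and cP: "group_commutator G c P \<otimes> Q = Q \<otimes> group_commutator G c P"
      "group_commutator G c P \<otimes> R = R \<otimes> group_commutator G c P"
  shows "group_commutator G a R \<otimes> group_commutator G c P = group_commutator G b Q"
proof -
  define D1 D2 D3 where "D1 = group_commutator G a R" and "D2 = group_commutator G b Q"
    and "D3 = group_commutator G c P"
  have cl: "P \<in> carrier G" "Q \<in> carrier G" "R \<in> carrier G" using c by (simp_all add: P Q R)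
  have cD: "D1 \<in> carrier G" "D2 \<in> carrier G" "D3 \<in> carrier G"
    using c cl by (simp_all add: D1_def D2_def D3_def)
  define w where "w = c \<otimes> (b \<otimes> a)"
  have w: "w \<in> carrier G" using c by (simp add: w_def)
  have sw1: "x \<otimes> y = group_commutator G x y \<otimes> (y \<otimes> x)" if "x \<in> carrier G" "y \<in> carrier G" for x y
    using commutator_swap[of x y \<one>] that by simp

  \<comment> \<open>Transpose \<open>a\<close> and \<open>b\<close> first.\<close>
  have "a \<otimes> (b \<otimes> c) = P \<otimes> (b \<otimes> (a \<otimes> c))" using commutator_swap[of a b c] c P by simp
  also have "a \<otimes> c = Q \<otimes> (c \<otimes> a)" using sw1[of a c] c Q by simp
  also have "b \<otimes> (Q \<otimes> (c \<otimes> a)) = D2 \<otimes> (Q \<otimes> (b \<otimes> (c \<otimes> a)))"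
    using commutator_swap[of b Q "c \<otimes> a"] c cl by (simp add: D2_def)
  also have "b \<otimes> (c \<otimes> a) = R \<otimes> w" using commutator_swap[of b c a] c R by (simp add: w_def)
  also have "P \<otimes> (D2 \<otimes> (Q \<otimes> (R \<otimes> w))) = (P \<otimes> D2) \<otimes> (Q \<otimes> (R \<otimes> w))"
    using cl cD w by (simp add: m_assoc)
  also have "P \<otimes> D2 = D2 \<otimes> P" using bQ by (simp add: D2_def)
  finally have L: "a \<otimes> (b \<otimes> c) = D2 \<otimes> P \<otimes> (Q \<otimes> (R \<otimes> w))" .

  \<comment> \<open>Transpose \<open>b\<close> and \<open>c\<close> first.\<close>
  have "a \<otimes> (b \<otimes> c) = a \<otimes> (R \<otimes> (c \<otimes> b))" using sw1[of b c] c R by simp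
  also have "\<dots> = D1 \<otimes> (R \<otimes> (a \<otimes> (c \<otimes> b)))"
    using commutator_swap[of a R "c \<otimes> b"] c cl by (simp add: D1_def)
  also have "a \<otimes> (c \<otimes> b) = Q \<otimes> (c \<otimes> (a \<otimes> b))" using commutator_swap[of a c b] c Q by simp
  also have "a \<otimes> b = P \<otimes> (b \<otimes> a)" using sw1[of a b] c P by simp
  also have "c \<otimes> (P \<otimes> (b \<otimes> a)) = D3 \<otimes> (P \<otimes> w)"
    using commutator_swap[of c P "b \<otimes> a"] c cl by (simp add: D3_def w_def)
  also have "D1 \<otimes> (R \<otimes> (Q \<otimes> (D3 \<otimes> (P \<otimes> w)))) = D1 \<otimes> (R \<otimes> (Q \<otimes> D3) \<otimes> (P \<otimes> w))"
    using cl cD w by (simp add: m_assoc)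
  also have "R \<otimes> (Q \<otimes> D3) = (R \<otimes> D3) \<otimes> Q" using cP(1) cl cD by (simp add: D3_def m_assoc)
  also have "R \<otimes> D3 = D3 \<otimes> R" using cP(2) by (simp add: D3_def)
  also have "D1 \<otimes> (D3 \<otimes> R \<otimes> Q \<otimes> (P \<otimes> w)) = D1 \<otimes> D3 \<otimes> (R \<otimes> Q \<otimes> P \<otimes> w)"
    using cl cD w by (simp add: m_assoc)
  also have "R \<otimes> Q \<otimes> P = P \<otimes> Q \<otimes> R"
    using comm cl by (metis m_assoc)
  finally have "D1 \<otimes> D3 \<otimes> (P \<otimes> Q \<otimes> R \<otimes> w) = D2 \<otimes> (P \<otimes> Q \<otimes> R \<otimes> w)"
    using L cl cD w by (simp add: m_assoc)
  then show ?thesis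
    using cl cD w by (simp add: D1_def D2_def D3_def)
qed

end

lemma hom_commutator:
  assumes "group G" "group H" "\<phi> \<in> hom G H" "a \<in> carrier G" "b \<in> carrier G"
  shows "\<phi> (group_commutator G a b) = group_commutator H (\<phi> a) (\<phi> b)"
proof -
  interpret group_hom G H \<phi> using assms by (simp add: group_hom_def group_hom_axioms_def)
  show ?thesis using assms(4,5) by (simp add: group_commutator_def)
qed

section \<open>Pairings in a category\<close>

context category
begin

text \<open>Membership in a hom-set is always split into typing equations, which conditional rewriting
propagates through composites.\<close>
lemma Hom_iff [simp]: "f \<in> Hom C A B \<longleftrightarrow> f \<in> Arr C \<and> Dom C f = A \<and> Cod C f = B"
  by (auto simp: Hom_def)

declare Dom_Obj [simp] Cod_Obj [simp]

lemma Id_typing [simp]: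
  assumes "A \<in> Obj C"
  shows "Id C A \<in> Arr C" "Dom C (Id C A) = A" "Cod C (Id C A) = A"
  using Id_Hom[OF assms] by auto

lemma Comp_typing [simp]:
  assumes "f \<in> Arr C" "g \<in> Arr C" "Cod C f = Dom C g"
  shows "f \<Zcomp> g \<in> Arr C" "Dom C (f \<Zcomp> g) = Dom C f" "Cod C (f \<Zcomp> g) = Cod C g"
  using Comp_Hom[of f "Dom C f" "Cod C f" g "Cod C g"] assms by auto

lemma Comp_Id_left [simp]: "\<lbrakk>f \<in> Arr C; Dom C f = A\<rbrakk> \<Longrightarrow> Id C A \<Zcomp> f = f"
  using Id_left[of f A "Cod C f"] by simp

lemma Comp_Id_right [simp]: "\<lbrakk>f \<in> Arr C; Cod C f = A\<rbrakk> \<Longrightarrow> f \<Zcomp> Id C A = f"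
  using Id_right[of f "Dom C f" A] by simp

lemma Comp_assoc_right [simp]:
  "\<lbrakk>f \<in> Arr C; g \<in> Arr C; h \<in> Arr C; Cod C f = Dom C g; Cod C g = Dom C h\<rbrakk>
    \<Longrightarrow> (f \<Zcomp> g) \<Zcomp> h = f \<Zcomp> (g \<Zcomp> h)"
  using Comp_assoc[of f "Dom C f" "Cod C f" g "Cod C g" h "Cod C h"] by simp

text \<open>Rewriting with an equation between composites inside a longer right-nested composite.\<close>

lemma Comp_eq_extend:
  assumes "f \<Zcomp> g = f' \<Zcomp> g'" "f \<in> Arr C" "g \<in> Arr C" "Cod C f = Dom C g"
    "f' \<in> Arr C" "g' \<in> Arr C" "Cod C f' = Dom C g'" "h \<in> Arr C" "Cod C g = Dom C h"
  shows "f \<Zcomp> (g \<Zcomp> h) = f' \<Zcomp> (g' \<Zcomp> h)"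
proof -
  have "Cod C g' = Cod C g"
    using Comp_typing(3)[of f g] Comp_typing(3)[of f' g'] assms by simp
  then show ?thesis
    using Comp_assoc_right[of f g h] Comp_assoc_right[of f' g' h] assms by simp
qed

lemma pair_product:
  assumes "is_product C a b" "h \<in> Hom C Y (Cod C a)" "k \<in> Hom C Y (Cod C b)"
  shows "pair C a b h k \<in> Hom C Y (Dom C a)"
    "pair C a b h k \<Zcomp> a = h" "pair C a b h k \<Zcomp> b = k"
proof -
  have "\<exists>!t. t \<in> Hom C Y (Dom C a) \<and> t \<Zcomp> a = h \<and> t \<Zcomp> b = k"
    using assms unfolding is_product_def by blast
  from theI'[OF this]
  have "pair C a b h k \<in> Hom C Y (Dom C a) \<and> pair C a b h k \<Zcomp> a = h
      \<and> pair C a b h k \<Zcomp> b = k"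
    unfolding pair_def using assms(2) by simp
  then show "pair C a b h k \<in> Hom C Y (Dom C a)"
    "pair C a b h k \<Zcomp> a = h" "pair C a b h k \<Zcomp> b = k" by auto
qed

lemma product_typing:
  assumes "is_product C a b"
  shows "a \<in> Arr C" "b \<in> Arr C" "Dom C b = Dom C a"
  using assms unfolding is_product_def by auto

lemma product_ext:
  assumes "is_product C a b" "s \<in> Hom C Y (Dom C a)" "t \<in> Hom C Y (Dom C a)"
    "s \<Zcomp> a = t \<Zcomp> a" "s \<Zcomp> b = t \<Zcomp> b"
  shows "s = t"
proof -
  have "s \<Zcomp> a \<in> Hom C Y (Cod C a) \<and> s \<Zcomp> b \<in> Hom C Y (Cod C b)"
    using assms product_typing[OF assms(1)] by simp
  then have "\<exists>!r. r \<in> Hom C Y (Dom C a) \<and> r \<Zcomp> a = s \<Zcomp> a \<and> r \<Zcomp> b = s \<Zcomp> b"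
    using assms(1) unfolding is_product_def by blast
  then show ?thesis using assms by metis
qed

lemma pair_product_eqI:
  assumes "is_product C a b" "t \<in> Hom C Y (Dom C a)" "t \<Zcomp> a = h" "t \<Zcomp> b = k"
  shows "pair C a b h k = t"
proof -
  have "h \<in> Hom C Y (Cod C a)" "k \<in> Hom C Y (Cod C b)"
    using assms product_typing[OF assms(1)] by auto
  note p = pair_product[OF assms(1) this]
  show ?thesis using product_ext[OF assms(1) p(1) assms(2)] p assms by simp
qed

lemma pair_product_precomp:
  assumes "is_product C a b" "h \<in> Hom C Y (Cod C a)" "k \<in> Hom C Y (Cod C b)" "t \<in> Hom C Z Y"
  shows "t \<Zcomp> pair C a b h k = pair C a b (t \<Zcomp> h) (t \<Zcomp> k)"
proof -
  note p = pair_product[OF assms(1,2,3)]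
  show ?thesis
    by (rule pair_product_eqI[symmetric, OF assms(1), of _ Z])
      (use p assms(2-) product_typing[OF assms(1)] in simp_all)
qed

lemma pair_pullback:
  assumes "is_pullback C f g a b" "h \<in> Hom C Y (Dom C f)" "k \<in> Hom C Y (Dom C g)"
    "h \<Zcomp> f = k \<Zcomp> g"
  shows "pair C a b h k \<in> Hom C Y (Dom C a)"
    "pair C a b h k \<Zcomp> a = h" "pair C a b h k \<Zcomp> b = k"
proof -
  have "\<exists>!t. t \<in> Hom C Y (Dom C a) \<and> t \<Zcomp> a = h \<and> t \<Zcomp> b = k"
    using assms unfolding is_pullback_def by blast
  from theI'[OF this]
  have "pair C a b h k \<in> Hom C Y (Dom C a) \<and> pair C a b h k \<Zcomp> a = h
      \<and> pair C a b h k \<Zcomp> b = k"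
    unfolding pair_def using assms(2) by simp
  then show "pair C a b h k \<in> Hom C Y (Dom C a)"
    "pair C a b h k \<Zcomp> a = h" "pair C a b h k \<Zcomp> b = k" by auto
qed

lemma pullback_typing:
  assumes "is_pullback C f g a b"
  shows "f \<in> Arr C" "g \<in> Arr C" "a \<in> Arr C" "b \<in> Arr C" "Cod C g = Cod C f"
    "Dom C b = Dom C a" "Cod C a = Dom C f" "Cod C b = Dom C g" "a \<Zcomp> f = b \<Zcomp> g"
  using assms unfolding is_pullback_def by auto

lemma pullback_ext:
  assumes "is_pullback C f g a b" "s \<in> Hom C Y (Dom C a)" "t \<in> Hom C Y (Dom C a)"
    "s \<Zcomp> a = t \<Zcomp> a" "s \<Zcomp> b = t \<Zcomp> b"
  shows "s = t"
proof -
  note ty = pullback_typing[OF assms(1)]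
  have "(s \<Zcomp> a) \<Zcomp> f = (s \<Zcomp> b) \<Zcomp> g" using assms(2) ty by simp
  moreover have "s \<Zcomp> a \<in> Hom C Y (Dom C f)" "s \<Zcomp> b \<in> Hom C Y (Dom C g)"
    using assms(2) ty by auto
  ultimately have "\<exists>!r. r \<in> Hom C Y (Dom C a) \<and> r \<Zcomp> a = s \<Zcomp> a \<and> r \<Zcomp> b = s \<Zcomp> b"
    using assms(1) unfolding is_pullback_def by blast
  then show ?thesis using assms by metis
qed

lemma pair_pullback_eqI:
  assumes "is_pullback C f g a b" "t \<in> Hom C Y (Dom C a)" "t \<Zcomp> a = h" "t \<Zcomp> b = k"
  shows "pair C a b h k = t"
proof -
  note ty = pullback_typing[OF assms(1)]
  have "h \<in> Hom C Y (Dom C f)" "k \<in> Hom C Y (Dom C g)"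
    using assms ty by auto
  moreover have "h \<Zcomp> f = k \<Zcomp> g" using assms(2) ty
    by (simp add: assms(3,4)[symmetric])
  ultimately have p: "pair C a b h k \<in> Hom C Y (Dom C a)"
    "pair C a b h k \<Zcomp> a = h" "pair C a b h k \<Zcomp> b = k"
    using pair_pullback[OF assms(1)] by blast+
  show ?thesis using pullback_ext[OF assms(1) p(1) assms(2)] p assms by simp
qed

lemma pair_pullback_precomp:
  assumes "is_pullback C f g a b" "h \<in> Hom C Y (Dom C f)" "k \<in> Hom C Y (Dom C g)"
    "h \<Zcomp> f = k \<Zcomp> g" "t \<in> Hom C Z Y"
  shows "t \<Zcomp> pair C a b h k = pair C a b (t \<Zcomp> h) (t \<Zcomp> k)"
proof -
  note p = pair_pullback[OF assms(1,2,3,4)]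
  show ?thesis
    by (rule pair_pullback_eqI[symmetric, OF assms(1), of _ Z])
      (use p assms(2,3,5) pullback_typing(1-8)[OF assms(1)] in simp_all)
qed

text \<open>Tangent functors are required to preserve fibre powers, where the structure map to the base is part
of the cone. For two factors this map is determined by a projection, which gives pullback squares.\<close>
lemma pullback_iff_fibre_power:
  fixes \<pi> :: "nat \<Rightarrow> 'a"
  shows "is_pullback C f f (\<pi> 0) (\<pi> 1) \<longleftrightarrow> f \<in> Arr C \<and> \<pi> 0 \<in> Hom C (Dom C (\<pi> 0)) (Dom C f)
    \<and> is_fibre_power C 2 f (\<pi> 0 \<Zcomp> f) \<pi>"
    (is "?L \<longleftrightarrow> ?f \<and> ?p \<and> ?R")
proof (cases "?f \<and> ?p")
  case True
  then have ty: "f \<in> Arr C" "\<pi> 0 \<in> Arr C" "Cod C (\<pi> 0) = Dom C f" by auto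
  have p0: "\<pi> 0 \<in> Hom C (Dom C (\<pi> 0)) (Dom C f)" using True by blast
  have two: "(\<forall>i<2. P i) \<longleftrightarrow> P 0 \<and> P 1" for P :: "nat \<Rightarrow> bool"
    by (auto simp: less_2_cases_iff)
  have eq: "t \<in> Hom C Y (Dom C (\<pi> 0)) \<and> t \<Zcomp> (\<pi> 0 \<Zcomp> f) = x \<and> t \<Zcomp> \<pi> 0 = h \<and> t \<Zcomp> \<pi> 1 = k
      \<longleftrightarrow> t \<in> Hom C Y (Dom C (\<pi> 0)) \<and> t \<Zcomp> \<pi> 0 = h \<and> t \<Zcomp> \<pi> 1 = k"
    if "h \<Zcomp> f = x" for t Y x h k
  proof -
    have "t \<Zcomp> (\<pi> 0 \<Zcomp> f) = (t \<Zcomp> \<pi> 0) \<Zcomp> f" if "t \<in> Hom C Y (Dom C (\<pi> 0))"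
      using that ty by simp
    then show ?thesis using \<open>h \<Zcomp> f = x\<close> by metis
  qed
  have "?R \<longleftrightarrow> \<pi> 1 \<in> Hom C (Dom C (\<pi> 0)) (Dom C f) \<and> \<pi> 1 \<Zcomp> f = \<pi> 0 \<Zcomp> f
    \<and> (\<forall>Y x g. x \<in> Hom C Y (Cod C f) \<and> (g 0 \<in> Hom C Y (Dom C f) \<and> g 0 \<Zcomp> f = x)
        \<and> g 1 \<in> Hom C Y (Dom C f) \<and> g 1 \<Zcomp> f = x
        \<longrightarrow> (\<exists>!t. t \<in> Hom C Y (Dom C (\<pi> 0)) \<and> t \<Zcomp> (\<pi> 0 \<Zcomp> f) = x
              \<and> t \<Zcomp> \<pi> 0 = g 0 \<and> t \<Zcomp> \<pi> 1 = g (1 :: nat)))"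
    unfolding is_fibre_power_def two
    using ty p0 Comp_typing[OF ty(2,1,3)] by (simp del: Hom_iff Comp_typing)
  also have "\<dots> \<longleftrightarrow> \<pi> 1 \<in> Hom C (Dom C (\<pi> 0)) (Dom C f) \<and> \<pi> 1 \<Zcomp> f = \<pi> 0 \<Zcomp> f
    \<and> (\<forall>Y h k. h \<in> Hom C Y (Dom C f) \<and> k \<in> Hom C Y (Dom C f) \<and> h \<Zcomp> f = k \<Zcomp> f
        \<longrightarrow> (\<exists>!t. t \<in> Hom C Y (Dom C (\<pi> 0)) \<and> t \<Zcomp> \<pi> 0 = h \<and> t \<Zcomp> \<pi> 1 = k))"
    (is "?A \<and> ?B \<and> ?F \<longleftrightarrow> ?A \<and> ?B \<and> ?K")
  proof -
    have 1: ?K if F: ?F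
    proof (intro allI impI)
      fix Y h k
      assume hk: "h \<in> Hom C Y (Dom C f) \<and> k \<in> Hom C Y (Dom C f) \<and> h \<Zcomp> f = k \<Zcomp> f"
      let ?g = "\<lambda>n::nat. if n = 0 then h else k"
      have g: "?g 0 = h" "?g 1 = k" by simp_all
      have "h \<Zcomp> f \<in> Hom C Y (Cod C f)" using hk ty by simp
      with F[rule_format, of "h \<Zcomp> f" Y ?g, unfolded g]
      show "\<exists>!t. t \<in> Hom C Y (Dom C (\<pi> 0)) \<and> t \<Zcomp> \<pi> 0 = h \<and> t \<Zcomp> \<pi> 1 = k"
        using hk eq[of h "h \<Zcomp> f" _ Y k] by metis
    qed
    have 2: ?F if K: ?K
    proof (intro allI impI)
      fix Y x and g :: "nat \<Rightarrow> 'a"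
      assume a: "x \<in> Hom C Y (Cod C f) \<and> (g 0 \<in> Hom C Y (Dom C f) \<and> g 0 \<Zcomp> f = x)
        \<and> g 1 \<in> Hom C Y (Dom C f) \<and> g 1 \<Zcomp> f = x"
      with K[rule_format, of "g 0" Y "g 1"]
      show "\<exists>!t. t \<in> Hom C Y (Dom C (\<pi> 0)) \<and> t \<Zcomp> (\<pi> 0 \<Zcomp> f) = x
              \<and> t \<Zcomp> \<pi> 0 = g 0 \<and> t \<Zcomp> \<pi> 1 = g 1"
        using eq[of "g 0" x _ Y "g 1"] by metis
    qed
    have "?F \<longleftrightarrow> ?K" by (rule iffI) (rule 1 2, assumption)+
    then show ?thesis by (simp only:)
  qed
  also have "\<dots> \<longleftrightarrow> ?L"
  proof -
    have A: "?A \<longleftrightarrow> \<pi> 1 \<in> Arr C \<and> Dom C (\<pi> 0) = Dom C (\<pi> 1) \<and> Cod C (\<pi> 1) = Dom C f"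
      by (auto simp: Hom_def)
    show ?thesis unfolding is_pullback_def A eq_commute[of "\<pi> 1 \<Zcomp> f"]
      by (rule iffI; elim conjE; intro conjI; (assumption | rule ty refl))
  qed
  finally show ?thesis using True by (simp only: simp_thms)
next
  case False
  then have "\<not> ?L" by (metis Hom_iff pullback_typing(1,3,7))
  with False show ?thesis by blast
qed

lemma natural_Hom: "\<lbrakk>is_natural C Fo Fa Fo' Fa' \<tau>; M \<in> Obj C\<rbrakk> \<Longrightarrow> \<tau> M \<in> Hom C (Fo M) (Fo' M)"
  unfolding is_natural_def by blast

lemma natural_eq:
  "\<lbrakk>is_natural C Fo Fa Fo' Fa' \<tau>; f \<in> Arr C\<rbrakk> \<Longrightarrow> Fa f \<Zcomp> \<tau> (Cod C f) = \<tau> (Dom C f) \<Zcomp> Fa' f"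
  unfolding is_natural_def by blast

lemma terminal_eq:
  assumes "is_terminal C Z" "s \<in> Hom C A Z" "t \<in> Hom C A Z"
  shows "s = t"
proof -
  have "A \<in> Obj C" using assms(2) Dom_Obj by auto
  then show ?thesis using assms unfolding is_terminal_def by blast
qed

lemma terminal_ex: "\<lbrakk>is_terminal C Z; A \<in> Obj C\<rbrakk> \<Longrightarrow> \<exists>t. t \<in> Hom C A Z"
  unfolding is_terminal_def by blast

lemma equalizer_typing:
  assumes "is_equalizer C e f g"
  shows "e \<in> Arr C" "f \<in> Arr C" "g \<in> Arr C" "Dom C f = Cod C e" "Dom C g = Cod C e"
    "e \<Zcomp> f = e \<Zcomp> g"
  using assms unfolding is_equalizer_def by blast+

lemma equalizer_ex1:
  assumes "is_equalizer C e f g" "h \<in> Hom C Y (Cod C e)" "h \<Zcomp> f = h \<Zcomp> g"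
  shows "\<exists>!t. t \<in> Hom C Y (Dom C e) \<and> t \<Zcomp> e = h"
  using assms unfolding is_equalizer_def by blast

lemma equalizer_mono:
  assumes E: "is_equalizer C e f g" and s: "s \<in> Hom C Y (Dom C e)" and t: "t \<in> Hom C Y (Dom C e)"
    and st: "s \<Zcomp> e = t \<Zcomp> e"
  shows "s = t"
proof -
  note ty = equalizer_typing[OF E]
  have "(s \<Zcomp> e) \<Zcomp> f = (s \<Zcomp> e) \<Zcomp> g" using ty s by simp
  moreover have "s \<Zcomp> e \<in> Hom C Y (Cod C e)" using ty s by simp
  ultimately have "\<exists>!r. r \<in> Hom C Y (Dom C e) \<and> r \<Zcomp> e = s \<Zcomp> e"
    using equalizer_ex1[OF E] by blast
  then show ?thesis using s t st by metis
qed

lemma inverse_arr_eqI: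
  assumes "is_inverse C f g"
  shows "inverse_arr C f = g"
  unfolding inverse_arr_def
proof (rule the_equality)
  fix h assume "is_inverse C f h"
  then have h: "f \<in> Arr C" "h \<in> Hom C (Cod C f) (Dom C f)" "h \<Zcomp> f = Id C (Cod C f)"
    unfolding is_inverse_def by blast+
  have g: "g \<in> Hom C (Cod C f) (Dom C f)" "f \<Zcomp> g = Id C (Dom C f)"
    using assms unfolding is_inverse_def by blast+
  have "h \<Zcomp> (f \<Zcomp> g) = (h \<Zcomp> f) \<Zcomp> g" using g(1) h(1,2) by simp
  then show "h = g" using g h by simp
qed fact

end


section \<open>Tangent categories in terms of generalised elements\<close>

text \<open>The additive bundle structure is used through sums of generalised elements \<open>x, y : Y \<rightarrow> T(M)\<close> over
the same point of \<open>M\<close>.\<close>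
definition tangent_sum :: "('o, 'a, 'm) tangent_cat_scheme \<Rightarrow> 'o \<Rightarrow> 'a \<Rightarrow> 'a \<Rightarrow> 'a"
  where "tangent_sum X M x y = bsum X (tangent_bundle X M) x y"

context tangent_category
begin

lemma Tar_typing [simp]:
  assumes "f \<in> Arr X"
  shows "Tar X f \<in> Arr X" "Dom X (Tar X f) = Tob X (Dom X f)" "Cod X (Tar X f) = Tob X (Cod X f)"
  using Tar_Hom[of f "Dom X f" "Cod X f"] assms by auto

declare Tob_Obj [simp] Tar_Id [simp]

lemma Tar_Comp_arr:
  "\<lbrakk>f \<in> Arr X; g \<in> Arr X; Cod X f = Dom X g\<rbrakk> \<Longrightarrow> Tar X (f \<Zcomp> g) = Tar X f \<Zcomp> Tar X g"
  using Tar_Comp[of f "Dom X f" "Cod X f" g "Cod X g"] by simp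

lemma proj_typing [simp]:
  assumes "M \<in> Obj X"
  shows "proj X M \<in> Arr X" "Dom X (proj X M) = Tob X M" "Cod X (proj X M) = M"
  using natural_Hom[OF proj_natural assms] assms by simp_all

lemma proj_nat: "f \<in> Arr X \<Longrightarrow> Tar X f \<Zcomp> proj X (Cod X f) = proj X (Dom X f) \<Zcomp> f"
  using natural_eq[OF proj_natural] by simp

lemma tzero_typing [simp]:
  assumes "M \<in> Obj X"
  shows "tzero X M \<in> Arr X" "Dom X (tzero X M) = M" "Cod X (tzero X M) = Tob X M"
  using natural_Hom[OF tzero_natural assms] assms by simp_all

lemma tzero_nat: "f \<in> Arr X \<Longrightarrow> f \<Zcomp> tzero X (Cod X f) = tzero X (Dom X f) \<Zcomp> Tar X f"
  using natural_eq[OF tzero_natural] by simp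

lemma vlift_typing [simp]:
  assumes "M \<in> Obj X"
  shows "vlift X M \<in> Arr X" "Dom X (vlift X M) = Tob X M" "Cod X (vlift X M) = Tob X (Tob X M)"
  using natural_Hom[OF vlift_natural assms] assms by simp_all

lemma flip_typing [simp]:
  assumes "M \<in> Obj X"
  shows "flip X M \<in> Arr X" "Dom X (flip X M) = Tob X (Tob X M)"
    "Cod X (flip X M) = Tob X (Tob X M)"
  using natural_Hom[OF flip_natural assms] assms by simp_all

lemma pi_typing [simp]:
  assumes "M \<in> Obj X"
  shows "pi0 X M \<in> Arr X" "Dom X (pi0 X M) = T2 X M" "Cod X (pi0 X M) = Tob X M"
    "pi1 X M \<in> Arr X" "Dom X (pi1 X M) = T2 X M" "Cod X (pi1 X M) = Tob X M"
  using pullback_typing(1-8)[OF T2_pullback[OF assms]] T2_Dom[OF assms] assms by simp_all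

lemma tplus_typing [simp]:
  assumes "M \<in> Obj X"
  shows "tplus X M \<in> Arr X" "Dom X (tplus X M) = T2 X M" "Cod X (tplus X M) = Tob X M"
  using natural_Hom[OF tplus_natural assms] assms by simp_all

lemma tzero_proj [simp]: "M \<in> Obj X \<Longrightarrow> tzero X M \<Zcomp> proj X M = Id X M"
  using tangent_bundle_additive[of M]
  unfolding additive_bundle_def tangent_bundle_def by (simp add: Let_def)

lemma vlift_T_proj [simp]: "M \<in> Obj X \<Longrightarrow> vlift X M \<Zcomp> Tar X (proj X M) = proj X M \<Zcomp> tzero X M"
  using vlift_additive[of M]
  unfolding additive_bundle_morphism_def tangent_bundle_def T_bundle_def by simp

lemma tzero_vlift: "M \<in> Obj X \<Longrightarrow> tzero X M \<Zcomp> vlift X M = tzero X M \<Zcomp> Tar X (tzero X M)"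
  using vlift_additive[of M]
  unfolding additive_bundle_morphism_def tangent_bundle_def T_bundle_def by simp

lemma flip_proj: "M \<in> Obj X \<Longrightarrow> flip X M \<Zcomp> proj X (Tob X M) = Tar X (proj X M)"
  using flip_additive[of M]
  unfolding additive_bundle_morphism_def tangent_bundle_def T_bundle_def by simp

lemma T_tzero_flip: "M \<in> Obj X \<Longrightarrow> Tar X (tzero X M) \<Zcomp> flip X M = tzero X (Tob X M)"
  using flip_additive[of M]
  unfolding additive_bundle_morphism_def tangent_bundle_def T_bundle_def by simp

lemma flip_T_proj: "M \<in> Obj X \<Longrightarrow> flip X M \<Zcomp> Tar X (proj X M) = proj X (Tob X M)"
proof -
  assume M: "M \<in> Obj X"
  have "flip X M \<Zcomp> Tar X (proj X M) = (flip X M \<Zcomp> flip X M) \<Zcomp> proj X (Tob X M)"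
    using M by (simp add: flip_proj)
  then show ?thesis using M by (simp only: flip_flip) simp
qed

lemma tzero_flip: "M \<in> Obj X \<Longrightarrow> tzero X (Tob X M) \<Zcomp> flip X M = Tar X (tzero X M)"
proof -
  assume M: "M \<in> Obj X"
  have "tzero X (Tob X M) \<Zcomp> flip X M = Tar X (tzero X M) \<Zcomp> (flip X M \<Zcomp> flip X M)"
    using M by (simp add: T_tzero_flip[symmetric])
  then show ?thesis using M by (simp add: flip_flip)
qed

lemma vlift_proj: "M \<in> Obj X \<Longrightarrow> vlift X M \<Zcomp> proj X (Tob X M) = proj X M \<Zcomp> tzero X M"
proof -
  assume M: "M \<in> Obj X"
  have "vlift X M \<Zcomp> proj X (Tob X M) = vlift X M \<Zcomp> (flip X M \<Zcomp> Tar X (proj X M))"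
    using M by (simp add: flip_T_proj)
  also have "\<dots> = (vlift X M \<Zcomp> flip X M) \<Zcomp> Tar X (proj X M)" using M by simp
  also have "\<dots> = proj X M \<Zcomp> tzero X M" using M by (simp add: vlift_flip)
  finally show ?thesis .
qed


context
  fixes M Y x y
  assumes M [simp]: "M \<in> Obj X" and x: "x \<in> Hom X Y (Tob X M)" and y: "y \<in> Hom X Y (Tob X M)"
    and xy: "x \<Zcomp> proj X M = y \<Zcomp> proj X M"
begin

lemmas sum_pair = pair_pullback[OF T2_pullback[OF M], simplified, OF x[simplified] y[simplified] xy]

lemma tangent_sum_eq: "tangent_sum X M x y = pair X (pi0 X M) (pi1 X M) x y \<Zcomp> tplus X M"
  by (simp add: tangent_sum_def bsum_def tangent_bundle_def)

lemma tangent_sum_Hom: "tangent_sum X M x y \<in> Hom X Y (Tob X M)"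
  using sum_pair by (simp add: tangent_sum_eq)

lemma tangent_sum_proj: "tangent_sum X M x y \<Zcomp> proj X M = x \<Zcomp> proj X M"
proof -
  have "tplus X M \<Zcomp> proj X M = pi0 X M \<Zcomp> proj X M"
    using tangent_bundle_additive[OF M]
    unfolding additive_bundle_def tangent_bundle_def by (simp add: Let_def)
  then show ?thesis using sum_pair
    by (simp add: tangent_sum_eq) (metis Comp_assoc_right M pi_typing(1-3) proj_typing(1,2))
qed

lemma tangent_sum_precomp:
  assumes "t \<in> Hom X Z Y"
  shows "t \<Zcomp> tangent_sum X M x y = tangent_sum X M (t \<Zcomp> x) (t \<Zcomp> y)"
proof -
  have "t \<Zcomp> pair X (pi0 X M) (pi1 X M) x y = pair X (pi0 X M) (pi1 X M) (t \<Zcomp> x) (t \<Zcomp> y)"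
    by (rule pair_pullback_precomp[OF T2_pullback[OF M]]) (use x y xy assms in auto)
  then show ?thesis
    using sum_pair x y assms by (simp add: tangent_sum_def bsum_def tangent_bundle_def flip: Comp_assoc_right)
qed

lemma tangent_sum_comm: "tangent_sum X M x y = tangent_sum X M y x"
proof -
  have c: "pair X (pi0 X M) (pi1 X M) (pi1 X M) (pi0 X M) \<Zcomp> tplus X M = tplus X M"
    using tangent_bundle_additive[OF M]
    unfolding additive_bundle_def tangent_bundle_def bsum_def by (simp add: Let_def)
  have q: "pi1 X M \<Zcomp> proj X M = pi0 X M \<Zcomp> proj X M"
    using pullback_typing(9)[OF T2_pullback[OF M]] by simp
  define s where "s = pair X (pi0 X M) (pi1 X M) x y"
  have s: "s \<in> Hom X Y (T2 X M)" "s \<Zcomp> pi0 X M = x" "s \<Zcomp> pi1 X M = y"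
    using sum_pair unfolding s_def by auto
  define w where "w = pair X (pi0 X M) (pi1 X M) (pi1 X M) (pi0 X M)"
  have w: "w \<in> Hom X (T2 X M) (T2 X M)" "w \<Zcomp> pi0 X M = pi1 X M" "w \<Zcomp> pi1 X M = pi0 X M"
    using pair_pullback[OF T2_pullback[OF M], of "pi1 X M" "T2 X M" "pi0 X M"] q
    unfolding w_def by auto
  have "pair X (pi0 X M) (pi1 X M) y x = s \<Zcomp> w"
    by (rule pair_pullback_eqI[OF T2_pullback[OF M], of _ Y]) (use s w in auto)
  then have "tangent_sum X M y x = (s \<Zcomp> w) \<Zcomp> tplus X M"
    by (simp add: tangent_sum_def bsum_def tangent_bundle_def)
  also have "\<dots> = s \<Zcomp> tplus X M" using s w c by (simp add: w_def)
  finally show ?thesis by (simp add: tangent_sum_eq s_def)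
qed

lemma tangent_sum_T:
  assumes f: "f \<in> Hom X M N"
  shows "tangent_sum X M x y \<Zcomp> Tar X f = tangent_sum X N (x \<Zcomp> Tar X f) (y \<Zcomp> Tar X f)"
proof -
  have N [simp]: "N \<in> Obj X" using f Cod_Obj by auto
  have q: "pi1 X M \<Zcomp> proj X M = pi0 X M \<Zcomp> proj X M"
    using pullback_typing(9)[OF T2_pullback[OF M]] by simp
  have pf: "Tar X f \<Zcomp> proj X N = proj X M \<Zcomp> f" using proj_nat[of f] f by simp
  have e: "(pi0 X M \<Zcomp> Tar X f) \<Zcomp> proj X N = (pi1 X M \<Zcomp> Tar X f) \<Zcomp> proj X N"
    using f pf Comp_eq_extend[OF q, of f] by simp
  note t2 = pair_pullback[OF T2_pullback[OF N], of "pi0 X M \<Zcomp> Tar X f" "T2 X M" "pi1 X M \<Zcomp> Tar X f"]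
  have t2': "T2_ar X f \<in> Hom X (T2 X M) (T2 X N)" "T2_ar X f \<Zcomp> pi0 X N = pi0 X M \<Zcomp> Tar X f"
    "T2_ar X f \<Zcomp> pi1 X N = pi1 X M \<Zcomp> Tar X f"
    using t2 e f by (auto simp: T2_ar_def)
  define s where "s = pair X (pi0 X M) (pi1 X M) x y"
  have s: "s \<in> Hom X Y (T2 X M)" "s \<Zcomp> pi0 X M = x" "s \<Zcomp> pi1 X M = y"
    using sum_pair unfolding s_def by auto
  have "pair X (pi0 X N) (pi1 X N) (x \<Zcomp> Tar X f) (y \<Zcomp> Tar X f) = s \<Zcomp> T2_ar X f"
    by (rule pair_pullback_eqI[OF T2_pullback[OF N], of _ Y])
      (use s t2' f in \<open>auto simp flip: s(2,3)\<close>)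
  moreover have "T2_ar X f \<Zcomp> tplus X N = tplus X M \<Zcomp> Tar X f"
    using natural_eq[OF tplus_natural, of f] f by simp
  ultimately show ?thesis
    using s t2' f by (simp add: tangent_sum_eq s_def[symmetric]) (simp add: tangent_sum_def bsum_def tangent_bundle_def)
qed

end

lemma tangent_sum_zero_right:
  assumes M [simp]: "M \<in> Obj X" and x: "x \<in> Hom X Y (Tob X M)"
  shows "tangent_sum X M x (x \<Zcomp> proj X M \<Zcomp> tzero X M) = x"
proof -
  have "tangent_sum X M (Id X (Tob X M)) (proj X M \<Zcomp> tzero X M) = Id X (Tob X M)"
    using tangent_bundle_additive[OF M]
    unfolding additive_bundle_def tangent_bundle_def bsum_def tangent_sum_def by (simp add: Let_def)
  then show ?thesis
    using tangent_sum_precomp[OF M, of "Id X (Tob X M)" "Tob X M" "proj X M \<Zcomp> tzero X M" x Y] x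
    by simp
qed

text \<open>The functor preserves the fibre square of \<open>p\<close>, so the bundle \<open>T(p)\<close> also has sums.
  The flip is an isomorphism from this bundle to the tangent bundle of \<open>T(M)\<close>.\<close>

lemma T_pullback:
  assumes M [simp]: "M \<in> Obj X"
  shows "is_pullback X (Tar X (proj X M)) (Tar X (proj X M)) (Tar X (pi0 X M)) (Tar X (pi1 X M))"
proof -
  define \<pi> where "\<pi> n = (if n = 0 then pi0 X M else pi1 X M)" for n :: nat
  have \<pi>: "\<pi> 0 = pi0 X M" "\<pi> 1 = pi1 X M" by (simp_all add: \<pi>_def)
  have "is_pullback X (proj X M) (proj X M) (\<pi> 0) (\<pi> 1)"
    unfolding \<pi> by (rule T2_pullback[OF M])
  then have "is_fibre_power X 2 (proj X M) (\<pi> 0 \<Zcomp> proj X M) \<pi>"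
    unfolding pullback_iff_fibre_power by blast
  from powers_preserved[OF M this]
  have "is_fibre_power X 2 (Tar X (proj X M)) (Tar X (\<pi> 0) \<Zcomp> Tar X (proj X M)) (\<lambda>n. Tar X (\<pi> n))"
    by (simp add: \<pi> Tar_Comp_arr)
  then show ?thesis
    using pullback_iff_fibre_power[of "Tar X (proj X M)" "\<lambda>n. Tar X (\<pi> n)"] by (simp add: \<pi>_def)
qed

lemma T_bundle_sum:
  assumes M [simp]: "M \<in> Obj X" and x: "x \<in> Hom X Y (Tob X (Tob X M))"
    and y: "y \<in> Hom X Y (Tob X (Tob X M))"
    and xy: "x \<Zcomp> Tar X (proj X M) = y \<Zcomp> Tar X (proj X M)"
  shows "bsum X (T_bundle X M) x y \<in> Hom X Y (Tob X (Tob X M))"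
    "bsum X (T_bundle X M) x y \<Zcomp> flip X M = tangent_sum X (Tob X M) (x \<Zcomp> flip X M) (y \<Zcomp> flip X M)"
proof -
  define s where "s = pair X (Tar X (pi0 X M)) (Tar X (pi1 X M)) x y"
  have s: "s \<in> Hom X Y (Tob X (T2 X M))" "s \<Zcomp> Tar X (pi0 X M) = x" "s \<Zcomp> Tar X (pi1 X M) = y"
    using pair_pullback[OF T_pullback[OF M], of x Y y] x y xy unfolding s_def by auto
  have b: "bsum X (T_bundle X M) x y = s \<Zcomp> Tar X (tplus X M)"
    by (simp add: bsum_def T_bundle_def s_def)
  then show "bsum X (T_bundle X M) x y \<in> Hom X Y (Tob X (Tob X M))" using s by simp
  have c: "Tar X (tplus X M) \<Zcomp> flip X M
      = tangent_sum X (Tob X M) (Tar X (pi0 X M) \<Zcomp> flip X M) (Tar X (pi1 X M) \<Zcomp> flip X M)"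
    using flip_additive[OF M]
    unfolding additive_bundle_morphism_def by (simp add: T_bundle_def tangent_sum_def)
  have e: "(Tar X (pi0 X M) \<Zcomp> flip X M) \<Zcomp> proj X (Tob X M) = (Tar X (pi1 X M) \<Zcomp> flip X M) \<Zcomp> proj X (Tob X M)"
    using pullback_typing(9)[OF T_pullback[OF M]] by (simp add: flip_proj)
  have "s \<Zcomp> tangent_sum X (Tob X M) (Tar X (pi0 X M) \<Zcomp> flip X M) (Tar X (pi1 X M) \<Zcomp> flip X M)
     = tangent_sum X (Tob X M) (s \<Zcomp> (Tar X (pi0 X M) \<Zcomp> flip X M)) (s \<Zcomp> (Tar X (pi1 X M) \<Zcomp> flip X M))"
    by (rule tangent_sum_precomp) (use s e in auto)
  also have "\<dots> = tangent_sum X (Tob X M) (x \<Zcomp> flip X M) (y \<Zcomp> flip X M)"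
    using s by (simp flip: s(2,3))
  finally show "bsum X (T_bundle X M) x y \<Zcomp> flip X M = tangent_sum X (Tob X M) (x \<Zcomp> flip X M) (y \<Zcomp> flip X M)"
    using s c by (simp add: b)
qed

text \<open>The canonical map \<open>T\<^sub>2(M) \<rightarrow> T\<^sup>2(M)\<close> of the universal property, evaluated at a generalised element.\<close>
lemma vlift_image:
  assumes M [simp]: "M \<in> Obj X" and h: "h \<in> Hom X Y (Tob X M)" and k: "k \<in> Hom X Y (Tob X M)"
    and hk: "h \<Zcomp> proj X M = k \<Zcomp> proj X M"
  shows "pair X (pi0 X M) (pi1 X M) h k
      \<Zcomp> bsum X (T_bundle X M) (pi0 X M \<Zcomp> vlift X M) (pi1 X M \<Zcomp> tzero X (Tob X M))
    = bsum X (T_bundle X M) (h \<Zcomp> vlift X M) (k \<Zcomp> tzero X (Tob X M))"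
    (is "?t \<Zcomp> ?e = _")
proof -
  have t: "?t \<in> Hom X Y (T2 X M)" "?t \<Zcomp> pi0 X M = h" "?t \<Zcomp> pi1 X M = k"
    using pair_pullback[OF T2_pullback[OF M], of h Y k] h k hk by simp_all
  have q: "pi0 X M \<Zcomp> proj X M = pi1 X M \<Zcomp> proj X M"
    using pullback_typing(9)[OF T2_pullback[OF M]] .
  have zp: "tzero X (Tob X M) \<Zcomp> Tar X (proj X M) = proj X M \<Zcomp> tzero X M"
    using tzero_nat[of "proj X M"] by simp
  let ?s = "pair X (Tar X (pi0 X M)) (Tar X (pi1 X M))"
  have e: "(pi0 X M \<Zcomp> vlift X M) \<Zcomp> Tar X (proj X M) = (pi1 X M \<Zcomp> tzero X (Tob X M)) \<Zcomp> Tar X (proj X M)"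
    using Comp_eq_extend[OF q, of "tzero X M"] by (simp add: zp)
  have s: "?s (pi0 X M \<Zcomp> vlift X M) (pi1 X M \<Zcomp> tzero X (Tob X M)) \<in> Hom X (T2 X M) (Tob X (T2 X M))"
    using pair_pullback(1)[OF T_pullback[OF M], of "pi0 X M \<Zcomp> vlift X M" "T2 X M"] e by simp
  have "?t \<Zcomp> ?s (pi0 X M \<Zcomp> vlift X M) (pi1 X M \<Zcomp> tzero X (Tob X M))
      = ?s (?t \<Zcomp> (pi0 X M \<Zcomp> vlift X M)) (?t \<Zcomp> (pi1 X M \<Zcomp> tzero X (Tob X M)))"
    by (rule pair_pullback_precomp[OF T_pullback[OF M], of _ "T2 X M"]) (use t e in simp_all)
  also have "?t \<Zcomp> (pi0 X M \<Zcomp> vlift X M) = (?t \<Zcomp> pi0 X M) \<Zcomp> vlift X M" using t(1) by simp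
  also have "?t \<Zcomp> (pi1 X M \<Zcomp> tzero X (Tob X M)) = (?t \<Zcomp> pi1 X M) \<Zcomp> tzero X (Tob X M)" using t(1) by simp
  finally have st: "?t \<Zcomp> ?s (pi0 X M \<Zcomp> vlift X M) (pi1 X M \<Zcomp> tzero X (Tob X M))
    = ?s (h \<Zcomp> vlift X M) (k \<Zcomp> tzero X (Tob X M))" using t by simp
  have "?t \<Zcomp> ?e = (?t \<Zcomp> ?s (pi0 X M \<Zcomp> vlift X M) (pi1 X M \<Zcomp> tzero X (Tob X M))) \<Zcomp> Tar X (tplus X M)"
    using t(1) s by (simp add: bsum_def T_bundle_def)
  then show ?thesis by (simp add: st) (simp add: bsum_def T_bundle_def)
qed

text \<open>Two elements with the same lift have the same base point, since \<open>\<ell> p p = p\<close>, so they can both be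
paired with the zero over it; the equalizer map, which is monic, sends both pairs to the same element.\<close>
lemma vlift_mono:
  assumes M [simp]: "M \<in> Obj X" and h: "h \<in> Hom X Y (Tob X M)" and k: "k \<in> Hom X Y (Tob X M)"
    and hk: "h \<Zcomp> vlift X M = k \<Zcomp> vlift X M"
  shows "h = k"
proof -
  let ?e = "bsum X (T_bundle X M) (pi0 X M \<Zcomp> vlift X M) (pi1 X M \<Zcomp> tzero X (Tob X M))"
  note E = vlift_universal[OF M]
  have De: "Dom X ?e = T2 X M" "?e \<in> Arr X"
    using equalizer_typing[OF E] T_bundle_sum(1)[OF M, of "pi0 X M \<Zcomp> vlift X M" "T2 X M" "pi1 X M \<Zcomp> tzero X (Tob X M)"]
      tzero_nat[of "proj X M"] Comp_eq_extend[OF pullback_typing(9)[OF T2_pullback[OF M]], of "tzero X M"]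
    by simp_all
  have p: "h \<Zcomp> proj X M = k \<Zcomp> proj X M"
  proof -
    have "vlift X M \<Zcomp> (proj X (Tob X M) \<Zcomp> proj X M) = proj X M"
      using Comp_eq_extend[OF vlift_proj[OF M], of "proj X M"] by simp
    then have "(g \<Zcomp> vlift X M) \<Zcomp> (proj X (Tob X M) \<Zcomp> proj X M) = g \<Zcomp> proj X M"
      if "g \<in> Hom X Y (Tob X M)" for g using that by simp
    then show ?thesis using h k hk by metis
  qed
  define z where "z = h \<Zcomp> proj X M \<Zcomp> tzero X M"
  have z: "z \<in> Hom X Y (Tob X M)" "h \<Zcomp> proj X M = z \<Zcomp> proj X M"
    using h by (simp_all add: z_def)
  let ?s = "pair X (pi0 X M) (pi1 X M) h z" and ?t = "pair X (pi0 X M) (pi1 X M) k z"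
  have s: "?s \<in> Hom X Y (T2 X M)" "?s \<Zcomp> pi0 X M = h"
    using pair_pullback[OF T2_pullback[OF M], of h Y z] h z by simp_all
  have t: "?t \<in> Hom X Y (T2 X M)" "?t \<Zcomp> pi0 X M = k"
    using pair_pullback[OF T2_pullback[OF M], of k Y z] k z p by simp_all
  have "?s = ?t"
    by (rule equalizer_mono[OF E, of _ Y])
      (use s(1) t(1) De vlift_image[OF M h z(1) z(2)] vlift_image[OF M k z(1)] p z hk in simp_all)
  then show ?thesis using s t by metis
qed

text \<open>The defining condition of \<open>{f}\<close> mentions \<open>f p\<close> where the equalizer provides some \<open>k\<close>. Flipping the
sum on \<open>T(p)\<close> into a sum on \<open>p\<^sub>T\<close> and applying \<open>T(p)\<close> shows \<open>k = f p\<close>, so the two agree.\<close>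
lemma brace_props:
  assumes M [simp]: "M \<in> Obj X" and f: "f \<in> Hom X Y (Tob X (Tob X M))"
    and eq: "f \<Zcomp> Tar X (proj X M) = f \<Zcomp> (Tar X (proj X M) \<Zcomp> proj X M \<Zcomp> tzero X M)"
  shows "brace X M f \<in> Hom X Y (Tob X M)"
    "brace X M f \<Zcomp> proj X M = f \<Zcomp> proj X (Tob X M) \<Zcomp> proj X M"
    "f = bsum X (T_bundle X M) (brace X M f \<Zcomp> vlift X M) (f \<Zcomp> proj X (Tob X M) \<Zcomp> tzero X (Tob X M))"
proof -
  let ?e = "bsum X (T_bundle X M) (pi0 X M \<Zcomp> vlift X M) (pi1 X M \<Zcomp> tzero X (Tob X M))"
  note E = vlift_universal[OF M]
  have q: "pi0 X M \<Zcomp> proj X M = pi1 X M \<Zcomp> proj X M"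
    using pullback_typing(9)[OF T2_pullback[OF M]] .
  have zp: "tzero X (Tob X M) \<Zcomp> Tar X (proj X M) = proj X M \<Zcomp> tzero X M"
    using tzero_nat[of "proj X M"] by simp
  have e: "(pi0 X M \<Zcomp> vlift X M) \<Zcomp> Tar X (proj X M) = (pi1 X M \<Zcomp> tzero X (Tob X M)) \<Zcomp> Tar X (proj X M)"
    using Comp_eq_extend[OF q, of "tzero X M"] by (simp add: zp)
  have De: "?e \<in> Hom X (T2 X M) (Tob X (Tob X M))"
    using T_bundle_sum(1)[OF M, of "pi0 X M \<Zcomp> vlift X M" "T2 X M" "pi1 X M \<Zcomp> tzero X (Tob X M)"] e
    by simp
  obtain t where t: "t \<in> Hom X Y (T2 X M)" "t \<Zcomp> ?e = f"
    using equalizer_ex1[OF E, of f Y] De f eq by (auto simp del: Comp_assoc_right)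
  define h k where "h = t \<Zcomp> pi0 X M" and "k = t \<Zcomp> pi1 X M"
  have h: "h \<in> Hom X Y (Tob X M)" and k: "k \<in> Hom X Y (Tob X M)" using t by (simp_all add: h_def k_def)
  have hk: "h \<Zcomp> proj X M = k \<Zcomp> proj X M" using t q by (simp add: h_def k_def)
  have tp: "t = pair X (pi0 X M) (pi1 X M) h k"
    by (rule pair_pullback_eqI[OF T2_pullback[OF M], of _ Y, symmetric]) (use t in \<open>simp_all add: h_def k_def\<close>)
  have fs: "f = bsum X (T_bundle X M) (h \<Zcomp> vlift X M) (k \<Zcomp> tzero X (Tob X M))"
    using vlift_image[OF M h k hk] t(2) by (simp add: tp)
  have hkT: "(h \<Zcomp> vlift X M) \<Zcomp> Tar X (proj X M) = (k \<Zcomp> tzero X (Tob X M)) \<Zcomp> Tar X (proj X M)"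
    using h k Comp_eq_extend[OF hk, of "tzero X M"] by (simp add: zp)
  have fp: "f \<Zcomp> proj X (Tob X M) = k"
  proof -
    have "f \<Zcomp> flip X M = tangent_sum X (Tob X M) ((h \<Zcomp> vlift X M) \<Zcomp> flip X M) ((k \<Zcomp> tzero X (Tob X M)) \<Zcomp> flip X M)"
      using T_bundle_sum(2)[OF M, of "h \<Zcomp> vlift X M" Y "k \<Zcomp> tzero X (Tob X M)"] h k hkT fs by simp
    also have "(h \<Zcomp> vlift X M) \<Zcomp> flip X M = h \<Zcomp> vlift X M" using h by (simp add: vlift_flip)
    also have "(k \<Zcomp> tzero X (Tob X M)) \<Zcomp> flip X M = k \<Zcomp> Tar X (tzero X M)" using k by (simp add: tzero_flip)
    finally have fc: "f \<Zcomp> flip X M = tangent_sum X (Tob X M) (h \<Zcomp> vlift X M) (k \<Zcomp> Tar X (tzero X M))" .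
    have zT: "Tar X (tzero X M) \<Zcomp> Tar X (proj X M) = Id X (Tob X M)" by (simp add: Tar_Comp_arr[symmetric])
    have zp': "Tar X (tzero X M) \<Zcomp> proj X (Tob X M) = proj X M \<Zcomp> tzero X M"
      using proj_nat[of "tzero X M"] by simp
    have pp: "(h \<Zcomp> vlift X M) \<Zcomp> proj X (Tob X M) = (k \<Zcomp> Tar X (tzero X M)) \<Zcomp> proj X (Tob X M)"
      using h k Comp_eq_extend[OF hk, of "tzero X M"] by (simp add: vlift_proj zp')
    have "f \<Zcomp> proj X (Tob X M) = (f \<Zcomp> flip X M) \<Zcomp> Tar X (proj X M)" using f by (simp add: flip_T_proj)
    also have "\<dots> = tangent_sum X M ((h \<Zcomp> vlift X M) \<Zcomp> Tar X (proj X M)) ((k \<Zcomp> Tar X (tzero X M)) \<Zcomp> Tar X (proj X M))"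
      unfolding fc by (rule tangent_sum_T) (use h k pp in simp_all)
    also have "(k \<Zcomp> Tar X (tzero X M)) \<Zcomp> Tar X (proj X M) = k" using k zT by simp
    also have "(h \<Zcomp> vlift X M) \<Zcomp> Tar X (proj X M) = k \<Zcomp> proj X M \<Zcomp> tzero X M"
      using h k Comp_eq_extend[OF hk, of "tzero X M"] by simp
    also have "tangent_sum X M (k \<Zcomp> proj X M \<Zcomp> tzero X M) k = tangent_sum X M k (k \<Zcomp> proj X M \<Zcomp> tzero X M)"
      by (rule tangent_sum_comm) (use k in simp_all)
    also have "\<dots> = k" by (rule tangent_sum_zero_right) (use k in simp_all)
    finally show ?thesis .
  qed
  have "brace X M f = h"
    unfolding brace_def
  proof (rule the_equality)
    show "h \<in> Hom X (Dom X f) (Tob X M) \<and> h \<Zcomp> proj X M = f \<Zcomp> proj X (Tob X M) \<Zcomp> proj X M \<and>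
      f = bsum X (T_bundle X M) (h \<Zcomp> vlift X M) (f \<Zcomp> proj X (Tob X M) \<Zcomp> tzero X (Tob X M))"
      unfolding fp using f h hk fs by (intro conjI) simp_all
  next
    fix h'
    assume "h' \<in> Hom X (Dom X f) (Tob X M) \<and> h' \<Zcomp> proj X M = f \<Zcomp> proj X (Tob X M) \<Zcomp> proj X M \<and>
      f = bsum X (T_bundle X M) (h' \<Zcomp> vlift X M) (f \<Zcomp> proj X (Tob X M) \<Zcomp> tzero X (Tob X M))"
    then have h': "h' \<in> Hom X Y (Tob X M)" "h' \<Zcomp> proj X M = k \<Zcomp> proj X M"
      and f': "f = bsum X (T_bundle X M) (h' \<Zcomp> vlift X M) (k \<Zcomp> tzero X (Tob X M))"
      using f unfolding fp by (simp_all only: Hom_iff)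
    let ?s = "pair X (pi0 X M) (pi1 X M) h' k"
    have s: "?s \<in> Hom X Y (T2 X M)" "?s \<Zcomp> pi0 X M = h'"
      using pair_pullback[OF T2_pullback[OF M], of h' Y k] h' k by simp_all
    have "?s = t"
      by (rule equalizer_mono[OF E, of _ Y])
        (use s(1) t De vlift_image[OF M h'(1) k h'(2)] f' in simp_all)
    then show "h' = h" using s by (simp add: h_def)
  qed
  then show "brace X M f \<in> Hom X Y (Tob X M)"
    "brace X M f \<Zcomp> proj X M = f \<Zcomp> proj X (Tob X M) \<Zcomp> proj X M"
    "f = bsum X (T_bundle X M) (brace X M f \<Zcomp> vlift X M) (f \<Zcomp> proj X (Tob X M) \<Zcomp> tzero X (Tob X M))"
    unfolding fp using h hk fs by (simp_all only:)
qed

end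

section \<open>The functor preserves finite products\<close>

context cartesian_tangent_category
begin

lemma Prod_Obj [simp]: "\<lbrakk>A \<in> Obj X; B \<in> Obj X\<rbrakk> \<Longrightarrow> Prod X A B \<in> Obj X"
  using pr0_Hom[of A B] Dom_Obj[of "pr0 X A B"] by simp

lemma pr_typing [simp]:
  assumes "A \<in> Obj X" "B \<in> Obj X"
  shows "pr0 X A B \<in> Arr X" "Dom X (pr0 X A B) = Prod X A B" "Cod X (pr0 X A B) = A"
    "pr1 X A B \<in> Arr X" "Dom X (pr1 X A B) = Prod X A B" "Cod X (pr1 X A B) = B"
  using pr0_Hom[OF assms] pr1_Hom[OF assms] by auto

lemma prod_pair_Hom:
  assumes "h \<in> Hom X Y A" "k \<in> Hom X Y B"
  shows "prod_pair X h k \<in> Hom X Y (Prod X A B)"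
    "prod_pair X h k \<Zcomp> pr0 X A B = h" "prod_pair X h k \<Zcomp> pr1 X A B = k"
proof -
  have "A \<in> Obj X" "B \<in> Obj X" using assms Cod_Obj by auto
  then show "prod_pair X h k \<in> Hom X Y (Prod X A B)"
    "prod_pair X h k \<Zcomp> pr0 X A B = h" "prod_pair X h k \<Zcomp> pr1 X A B = k"
    using pair_product[OF Prod_product, of A B h Y k] assms by (simp_all add: prod_pair_def)
qed

lemma T_comparison_typing:
  assumes [simp]: "A \<in> Obj X" "B \<in> Obj X"
  shows "T_comparison X A B \<in> Hom X (Tob X (Prod X A B)) (Prod X (Tob X A) (Tob X B))"
    "T_comparison X A B \<Zcomp> pr0 X (Tob X A) (Tob X B) = Tar X (pr0 X A B)"
    "T_comparison X A B \<Zcomp> pr1 X (Tob X A) (Tob X B) = Tar X (pr1 X A B)"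
  using prod_pair_Hom[of "Tar X (pr0 X A B)" "Tob X (Prod X A B)" "Tob X A" "Tar X (pr1 X A B)" "Tob X B"]
  by (simp_all add: T_comparison_def)

text \<open>The comparison map is an isomorphism, so the image of a product cone is again one.\<close>
lemma T_pr_product:
  assumes [simp]: "A \<in> Obj X" "B \<in> Obj X"
  shows "is_product X (Tar X (pr0 X A B)) (Tar X (pr1 X A B))"
proof -
  let ?c = "T_comparison X A B"
  note c = T_comparison_typing[OF assms]
  obtain g where g: "is_inverse X ?c g" using T_comparison_iso[OF assms] by blast
  then have g': "g \<in> Hom X (Prod X (Tob X A) (Tob X B)) (Tob X (Prod X A B))"
    "?c \<Zcomp> g = Id X (Tob X (Prod X A B))" "g \<Zcomp> ?c = Id X (Prod X (Tob X A) (Tob X B))"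
    using c unfolding is_inverse_def by auto
  have gp: "g \<Zcomp> Tar X (pr0 X A B) = pr0 X (Tob X A) (Tob X B)"
    "g \<Zcomp> Tar X (pr1 X A B) = pr1 X (Tob X A) (Tob X B)"
    using Comp_assoc_right[of g ?c "pr0 X (Tob X A) (Tob X B)"]
      Comp_assoc_right[of g ?c "pr1 X (Tob X A) (Tob X B)"] c g' by simp_all
  show ?thesis
    unfolding is_product_def
  proof (intro conjI allI impI)
    fix Y h k
    assume hk: "h \<in> Hom X Y (Cod X (Tar X (pr0 X A B))) \<and> k \<in> Hom X Y (Cod X (Tar X (pr1 X A B)))"
    let ?p = "prod_pair X h k"
    have p: "?p \<in> Hom X Y (Prod X (Tob X A) (Tob X B))"
      "?p \<Zcomp> pr0 X (Tob X A) (Tob X B) = h" "?p \<Zcomp> pr1 X (Tob X A) (Tob X B) = k"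
      using prod_pair_Hom[of h Y "Tob X A" k "Tob X B"] hk by auto
    show "\<exists>!t. t \<in> Hom X Y (Dom X (Tar X (pr0 X A B))) \<and> t \<Zcomp> Tar X (pr0 X A B) = h
      \<and> t \<Zcomp> Tar X (pr1 X A B) = k"
    proof (rule ex1I[of _ "?p \<Zcomp> g"])
      show "?p \<Zcomp> g \<in> Hom X Y (Dom X (Tar X (pr0 X A B))) \<and> (?p \<Zcomp> g) \<Zcomp> Tar X (pr0 X A B) = h
        \<and> (?p \<Zcomp> g) \<Zcomp> Tar X (pr1 X A B) = k"
        using p g' gp by simp
    next
      fix t assume t: "t \<in> Hom X Y (Dom X (Tar X (pr0 X A B))) \<and> t \<Zcomp> Tar X (pr0 X A B) = h
        \<and> t \<Zcomp> Tar X (pr1 X A B) = k"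
      have "t \<Zcomp> ?c = ?p"
        by (rule product_ext[OF Prod_product[of "Tob X A" "Tob X B"], of _ Y]) (use t c p in simp_all)
      then have "(t \<Zcomp> ?c) \<Zcomp> g = ?p \<Zcomp> g" by simp
      then show "t = ?p \<Zcomp> g" using t c g' by simp
    qed
  qed auto
qed

lemma inverse_T_comparison:
  assumes h: "h \<in> Hom X Y (Tob X A)" and k: "k \<in> Hom X Y (Tob X B)"
    and [simp]: "A \<in> Obj X" "B \<in> Obj X"
  shows "prod_pair X h k \<Zcomp> inverse_arr X (T_comparison X A B)
    = pair X (Tar X (pr0 X A B)) (Tar X (pr1 X A B)) h k"
proof -
  let ?c = "T_comparison X A B" and ?q = "pair X (Tar X (pr0 X A B)) (Tar X (pr1 X A B)) h k"
  note c = T_comparison_typing[of A B, simplified]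
  obtain g where g: "is_inverse X ?c g" using T_comparison_iso[OF assms(3,4)] by blast
  then have g': "g \<in> Hom X (Prod X (Tob X A) (Tob X B)) (Tob X (Prod X A B))"
    "?c \<Zcomp> g = Id X (Tob X (Prod X A B))"
    using c unfolding is_inverse_def by auto
  have q: "?q \<in> Hom X Y (Tob X (Prod X A B))" "?q \<Zcomp> Tar X (pr0 X A B) = h" "?q \<Zcomp> Tar X (pr1 X A B) = k"
    using pair_product[OF T_pr_product[of A B], of h Y k] h k by simp_all
  note p = prod_pair_Hom[OF h k]
  have "?q \<Zcomp> ?c = prod_pair X h k"
    by (rule product_ext[OF Prod_product[of "Tob X A" "Tob X B"], of _ Y]) (use q c p in simp_all)
  then have "prod_pair X h k \<Zcomp> g = (?q \<Zcomp> ?c) \<Zcomp> g" by simp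
  also have "\<dots> = ?q" using q c g' by simp
  finally show ?thesis by (simp add: inverse_arr_eqI[OF g])
qed

text \<open>Preservation of the chosen products extends to all product cones. This allows iteration: the image
of a chosen product cone need not be a chosen one.\<close>
lemma T_product:
  assumes P: "is_product X a b"
  shows "is_product X (Tar X a) (Tar X b)"
proof -
  note ty [simp] = product_typing[OF P]
  define A B where AB: "A = Cod X a" "B = Cod X b"
  have [simp]: "A \<in> Obj X" "B \<in> Obj X" "Cod X a = A" "Cod X b = B" by (auto simp: AB)
  define s where "s = pair X (pr0 X A B) (pr1 X A B) a b"
  define r where "r = pair X a b (pr0 X A B) (pr1 X A B)"
  have s: "s \<in> Hom X (Dom X a) (Prod X A B)" "s \<Zcomp> pr0 X A B = a" "s \<Zcomp> pr1 X A B = b"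
    using pair_product[OF Prod_product[of A B], of a "Dom X a" b] by (simp_all add: s_def)
  have r: "r \<in> Hom X (Prod X A B) (Dom X a)" "r \<Zcomp> a = pr0 X A B" "r \<Zcomp> b = pr1 X A B"
    using pair_product[OF P, of "pr0 X A B" "Prod X A B" "pr1 X A B"] by (simp_all add: r_def)
  have sr: "s \<Zcomp> r = Id X (Dom X a)"
    by (rule product_ext[OF P, of _ "Dom X a"]) (use s r in simp_all)
  have Ts: "Tar X s \<Zcomp> Tar X (pr0 X A B) = Tar X a" "Tar X s \<Zcomp> Tar X (pr1 X A B) = Tar X b"
    using s by (simp_all add: Tar_Comp_arr[symmetric])
  have Tr: "Tar X r \<Zcomp> Tar X a = Tar X (pr0 X A B)" "Tar X r \<Zcomp> Tar X b = Tar X (pr1 X A B)"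
    using r by (simp_all add: Tar_Comp_arr[symmetric])
  have Tsr: "Tar X s \<Zcomp> Tar X r = Id X (Tob X (Dom X a))"
    using s r sr by (simp add: Tar_Comp_arr[symmetric])
  note TP = T_pr_product[of A B, simplified]
  show ?thesis
    unfolding is_product_def
  proof (intro conjI allI impI)
    fix Y h k
    assume hk: "h \<in> Hom X Y (Cod X (Tar X a)) \<and> k \<in> Hom X Y (Cod X (Tar X b))"
    let ?p = "pair X (Tar X (pr0 X A B)) (Tar X (pr1 X A B)) h k"
    have p: "?p \<in> Hom X Y (Tob X (Prod X A B))" "?p \<Zcomp> Tar X (pr0 X A B) = h" "?p \<Zcomp> Tar X (pr1 X A B) = k"
      using pair_product[OF TP, of h Y k] hk by simp_all
    show "\<exists>!t. t \<in> Hom X Y (Dom X (Tar X a)) \<and> t \<Zcomp> Tar X a = h \<and> t \<Zcomp> Tar X b = k"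
    proof (rule ex1I[of _ "?p \<Zcomp> Tar X r"])
      show "?p \<Zcomp> Tar X r \<in> Hom X Y (Dom X (Tar X a)) \<and> (?p \<Zcomp> Tar X r) \<Zcomp> Tar X a = h
        \<and> (?p \<Zcomp> Tar X r) \<Zcomp> Tar X b = k"
        using p r Tr by simp
    next
      fix t assume t: "t \<in> Hom X Y (Dom X (Tar X a)) \<and> t \<Zcomp> Tar X a = h \<and> t \<Zcomp> Tar X b = k"
      have "t \<Zcomp> Tar X s = ?p"
        by (rule product_ext[OF TP, of _ Y]) (use t s Ts p in simp_all)
      then have "(t \<Zcomp> Tar X s) \<Zcomp> Tar X r = ?p \<Zcomp> Tar X r" by simp
      then show "t = ?p \<Zcomp> Tar X r" using t s r Tsr by simp
    qed
  qed auto
qed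

lemma T_terminal:
  assumes Z: "is_terminal X Z"
  shows "is_terminal X (Tob X Z)"
proof -
  have Z' [simp]: "Z \<in> Obj X" "One X \<in> Obj X" using Z One_terminal unfolding is_terminal_def by auto
  obtain s where s: "s \<in> Hom X Z (One X)" using terminal_ex[OF One_terminal Z'(1)] by blast
  obtain r where r: "r \<in> Hom X (One X) Z" using terminal_ex[OF Z Z'(2)] by blast
  have "s \<Zcomp> r = Id X Z" by (rule terminal_eq[OF Z, of _ Z]) (use r s in auto)
  then have Tsr: "Tar X s \<Zcomp> Tar X r = Id X (Tob X Z)"
    using r s by (simp add: Tar_Comp_arr[symmetric])
  show ?thesis
    unfolding is_terminal_def
  proof (intro conjI ballI)
    fix A assume A: "A \<in> Obj X"
    obtain t where t: "t \<in> Hom X A (Tob X (One X))" using terminal_ex[OF T_One_terminal A] by blast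
    show "\<exists>!f. f \<in> Hom X A (Tob X Z)"
    proof (rule ex1I[of _ "t \<Zcomp> Tar X r"])
      show "t \<Zcomp> Tar X r \<in> Hom X A (Tob X Z)" using t r by simp
    next
      fix f assume f: "f \<in> Hom X A (Tob X Z)"
      have "f \<Zcomp> Tar X s = t" by (rule terminal_eq[OF T_One_terminal, of _ A]) (use f t s in auto)
      then have "(f \<Zcomp> Tar X s) \<Zcomp> Tar X r = t \<Zcomp> Tar X r" by simp
      then show "f = t \<Zcomp> Tar X r" using f r s Tsr by simp
    qed
  qed simp
qed


abbreviation Ton :: "nat \<Rightarrow> 'o \<Rightarrow> 'o" where "Ton n \<equiv> Tob X ^^ n"
abbreviation Tan :: "nat \<Rightarrow> 'a \<Rightarrow> 'a" where "Tan n \<equiv> Tar X ^^ n"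

lemma Ton_Obj [simp]: "A \<in> Obj X \<Longrightarrow> Ton n A \<in> Obj X"
  by (induction n) simp_all

lemma Tan_typing [simp]:
  assumes "f \<in> Arr X"
  shows "Tan n f \<in> Arr X" "Dom X (Tan n f) = Ton n (Dom X f)" "Cod X (Tan n f) = Ton n (Cod X f)"
  using assms by (induction n) auto

lemma Tan_Comp:
  "\<lbrakk>f \<in> Arr X; g \<in> Arr X; Cod X f = Dom X g\<rbrakk> \<Longrightarrow> Tan n (f \<Zcomp> g) = Tan n f \<Zcomp> Tan n g"
  by (induction n) (simp_all add: Tar_Comp_arr)

lemma Tan_Id [simp]: "A \<in> Obj X \<Longrightarrow> Tan n (Id X A) = Id X (Ton n A)"
  by (induction n) simp_all

lemma Tan_product: "is_product X a b \<Longrightarrow> is_product X (Tan n a) (Tan n b)"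
  by (induction n) (simp_all add: T_product)

lemma Ton_terminal: "is_terminal X (Ton n (One X))"
  by (induction n) (simp_all add: One_terminal T_terminal)

end


section \<open>The groups of maps into the iterated tangent objects\<close>

locale tangent_group = cartesian_tangent_category X
  for X :: "('o, 'a, 'm) cartesian_tangent_cat_scheme" (structure) +
  fixes G :: 'o and m u i :: 'a
  assumes grp: "group_object X G m u i"
begin

text \<open>The group law of \<open>T\<^sup>n(G)\<close> is \<open>T\<^sup>n(m)\<close>. It lives on \<open>T\<^sup>n(G \<times> G)\<close>, which is a product of two copies of
\<open>T\<^sup>n(G)\<close>, so that no comparison isomorphisms intervene.\<close>
definition mul :: "nat \<Rightarrow> 'a \<Rightarrow> 'a \<Rightarrow> 'a"
  where "mul n f g = pair X (Tan n (pr0 X G G)) (Tan n (pr1 X G G)) f g \<Zcomp> Tan n m"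

definition Gam :: "nat \<Rightarrow> 'o \<Rightarrow> 'a monoid"
  where "Gam n Y = \<lparr>carrier = Hom X Y (Ton n G), mult = mul n,
    one = (THE t. t \<in> Hom X Y (Ton n (One X))) \<Zcomp> Tan n u\<rparr>"

lemma G_Obj [simp]: "G \<in> Obj X"
  and One_Obj [simp]: "One X \<in> Obj X"
  using grp One_terminal unfolding group_object_def is_terminal_def by auto

lemma group_typing [simp]:
  "m \<in> Arr X" "Dom X m = Prod X G G" "Cod X m = G"
  "u \<in> Arr X" "Dom X u = One X" "Cod X u = G"
  "i \<in> Arr X" "Dom X i = G" "Cod X i = G"
  using grp unfolding group_object_def by auto

lemma bang_Hom:
  assumes "A \<in> Obj X"
  shows "bang X A \<in> Hom X A (One X)"
proof -
  have "\<exists>!f. f \<in> Hom X A (One X)" using One_terminal assms unfolding is_terminal_def by blast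
  from theI'[OF this] show ?thesis unfolding bang_def .
qed

lemma bang_typing [simp]:
  assumes "A \<in> Obj X"
  shows "bang X A \<in> Arr X" "Dom X (bang X A) = A" "Cod X (bang X A) = One X"
  using bang_Hom[OF assms] by auto

lemma Gam_carrier [simp]: "f \<in> carrier (Gam n Y) \<longleftrightarrow> f \<in> Hom X Y (Ton n G)"
  by (simp add: Gam_def)

lemma Gam_mult: "f \<otimes>\<^bsub>Gam n Y\<^esub> g = mul n f g"
  by (simp add: Gam_def)

lemma Gam_one:
  assumes "t \<in> Hom X Y (Ton n (One X))"
  shows "\<one>\<^bsub>Gam n Y\<^esub> = t \<Zcomp> Tan n u"
proof -
  have "(THE t. t \<in> Hom X Y (Ton n (One X))) = t"
    by (rule the_equality) (use assms terminal_eq[OF Ton_terminal] in blast)+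
  then show ?thesis by (simp add: Gam_def)
qed

lemmas G_product = Tan_product[OF Prod_product[OF G_Obj G_Obj]]

context
  fixes n Y f g
  assumes f: "f \<in> Hom X Y (Ton n G)" and g: "g \<in> Hom X Y (Ton n G)"
begin

lemma mul_pair:
  shows "pair X (Tan n (pr0 X G G)) (Tan n (pr1 X G G)) f g \<in> Hom X Y (Ton n (Prod X G G))"
    "pair X (Tan n (pr0 X G G)) (Tan n (pr1 X G G)) f g \<Zcomp> Tan n (pr0 X G G) = f"
    "pair X (Tan n (pr0 X G G)) (Tan n (pr1 X G G)) f g \<Zcomp> Tan n (pr1 X G G) = g"
  using pair_product[OF G_product, of f Y n g] f g by simp_all

lemma mul_Hom: "mul n f g \<in> Hom X Y (Ton n G)"
  using mul_pair by (simp add: mul_def)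

lemma mul_precomp:
  assumes "t \<in> Hom X Z Y"
  shows "t \<Zcomp> mul n f g = mul n (t \<Zcomp> f) (t \<Zcomp> g)"
  using pair_product_precomp[OF G_product, of f Y n g t Z] mul_pair f g assms
  by (simp add: mul_def flip: Comp_assoc_right)

lemma Tar_mul: "Tar X (mul n f g) = mul (Suc n) (Tar X f) (Tar X g)"
proof -
  let ?s = "pair X (Tan n (pr0 X G G)) (Tan n (pr1 X G G)) f g"
  have "pair X (Tan (Suc n) (pr0 X G G)) (Tan (Suc n) (pr1 X G G)) (Tar X f) (Tar X g) = Tar X ?s"
    by (rule pair_product_eqI[OF G_product, of _ "Tob X Y"])
      (use mul_pair in \<open>simp_all add: Tar_Comp_arr[symmetric]\<close>)
  then show ?thesis using mul_pair by (simp add: mul_def Tar_Comp_arr)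
qed

end

lemma Tan_mul:
  assumes "f \<in> Hom X Y G" "g \<in> Hom X Y G"
  shows "Tan n (mul 0 f g) = mul n (Tan n f) (Tan n g)"
proof (induction n)
  case (Suc n)
  then show ?case using Tar_mul[of "Tan n f" "Ton n Y" n "Tan n g"] assms by simp
qed simp

lemma prod_pair_m: "\<lbrakk>f \<in> Hom X Y G; g \<in> Hom X Y G\<rbrakk> \<Longrightarrow> prod_pair X f g \<Zcomp> m = mul 0 f g"
  by (simp add: mul_def prod_pair_def)

text \<open>Associativity is an equation between maps out of \<open>(G \<times> G) \<times> G\<close>; the functor carries it to an
equation for the universal triple of elements of \<open>T\<^sup>n(G)\<close>.\<close>
lemma mul_assoc:
  assumes f: "f \<in> Hom X Y (Ton n G)" and g: "g \<in> Hom X Y (Ton n G)" and h: "h \<in> Hom X Y (Ton n G)"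
  shows "mul n (mul n f g) h = mul n f (mul n g h)"
proof -
  let ?P = "Prod X G G" let ?Q = "Prod X ?P G"
  define q0 where "q0 = pr0 X ?P G"
  define d where "d = pr1 X ?P G"
  define a where "a = q0 \<Zcomp> pr0 X G G"
  define b where "b = q0 \<Zcomp> pr1 X G G"
  have q0: "q0 \<in> Hom X ?Q ?P" by (simp add: q0_def)
  have abd: "a \<in> Hom X ?Q G" "b \<in> Hom X ?Q G" "d \<in> Hom X ?Q G"
    using q0 by (simp_all add: a_def b_def d_def)
  have ab: "mul 0 a b \<in> Hom X ?Q G" "mul 0 b d \<in> Hom X ?Q G"
    using mul_Hom[of a ?Q 0 b] mul_Hom[of b ?Q 0 d] abd by simp_all
  have "prod_pair X (prod_pair X a b \<Zcomp> m) d \<Zcomp> m = prod_pair X a (prod_pair X b d \<Zcomp> m) \<Zcomp> m"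
    using grp unfolding group_object_def Let_def a_def b_def d_def q0_def by blast
  then have "mul 0 (mul 0 a b) d = mul 0 a (mul 0 b d)"
    using prod_pair_m[of _ ?Q] abd ab by simp
  then have "Tan n (mul 0 (mul 0 a b) d) = Tan n (mul 0 a (mul 0 b d))" by simp
  then have E: "mul n (mul n (Tan n a) (Tan n b)) (Tan n d) = mul n (Tan n a) (mul n (Tan n b) (Tan n d))"
    using Tan_mul[of _ ?Q] abd ab by simp
  have Q: "is_product X (Tan n q0) (Tan n d)"
    using Tan_product[OF Prod_product[of ?P G]] by (simp add: q0_def d_def)
  define s where "s = pair X (Tan n (pr0 X G G)) (Tan n (pr1 X G G)) f g"
  have s: "s \<in> Hom X Y (Ton n ?P)" "s \<Zcomp> Tan n (pr0 X G G) = f" "s \<Zcomp> Tan n (pr1 X G G) = g"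
    using mul_pair[OF f g] by (simp_all add: s_def)
  define t where "t = pair X (Tan n q0) (Tan n d) s h"
  have t: "t \<in> Hom X Y (Ton n ?Q)" "t \<Zcomp> Tan n q0 = s" "t \<Zcomp> Tan n d = h"
    using pair_product[OF Q, of s Y h] s h q0 abd by (simp_all add: t_def)
  have "t \<Zcomp> Tan n a = (t \<Zcomp> Tan n q0) \<Zcomp> Tan n (pr0 X G G)"
    "t \<Zcomp> Tan n b = (t \<Zcomp> Tan n q0) \<Zcomp> Tan n (pr1 X G G)"
    using t(1) q0 by (simp_all add: a_def b_def Tan_Comp)
  then have tab: "t \<Zcomp> Tan n a = f" "t \<Zcomp> Tan n b = g" using t(2) s by simp_all
  have "t \<Zcomp> mul n (mul n (Tan n a) (Tan n b)) (Tan n d) = mul n (mul n f g) h"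
    using mul_precomp[of _ "Ton n ?Q" n _ t Y] mul_Hom[of "Tan n a" "Ton n ?Q" n "Tan n b"]
      abd t tab by simp
  moreover have "t \<Zcomp> mul n (Tan n a) (mul n (Tan n b) (Tan n d)) = mul n f (mul n g h)"
    using mul_precomp[of _ "Ton n ?Q" n _ t Y] mul_Hom[of "Tan n b" "Ton n ?Q" n "Tan n d"]
      abd t tab by simp
  ultimately show ?thesis using E by simp
qed

lemma Gam_one_eq: "f \<in> Hom X Y (Ton n G) \<Longrightarrow> \<one>\<^bsub>Gam n Y\<^esub> = f \<Zcomp> (Tan n (bang X G) \<Zcomp> Tan n u)"
  using Gam_one[of "f \<Zcomp> Tan n (bang X G)" Y n] by simp

lemma Gam_group [intro]:
  assumes Y: "Y \<in> Obj X"
  shows "group (Gam n Y)"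
proof (rule groupI)
  obtain t where t: "t \<in> Hom X Y (Ton n (One X))" using terminal_ex[OF Ton_terminal Y] by blast
  then show "\<one>\<^bsub>Gam n Y\<^esub> \<in> carrier (Gam n Y)" by (simp add: Gam_one[OF t])
next
  fix f assume f: "f \<in> carrier (Gam n Y)"
  have "mul 0 (bang X G \<Zcomp> u) (Id X G) = Id X G"
    using grp prod_pair_m[of "bang X G \<Zcomp> u" G "Id X G"] unfolding group_object_def by auto
  then have "Tan n (mul 0 (bang X G \<Zcomp> u) (Id X G)) = Id X (Ton n G)" by simp
  then have "f \<Zcomp> mul n (Tan n (bang X G \<Zcomp> u)) (Id X (Ton n G)) = f \<Zcomp> Id X (Ton n G)"
    by (simp add: Tan_mul[of _ G])
  then have "mul n (f \<Zcomp> (Tan n (bang X G) \<Zcomp> Tan n u)) f = f"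
    using f mul_precomp[of "Tan n (bang X G \<Zcomp> u)" "Ton n G" n "Id X (Ton n G)" f Y] by (simp add: Tan_Comp)
  then show "\<one>\<^bsub>Gam n Y\<^esub> \<otimes>\<^bsub>Gam n Y\<^esub> f = f" using f by (simp add: Gam_mult Gam_one_eq[of f])
  have "mul 0 i (Id X G) = bang X G \<Zcomp> u"
    using grp prod_pair_m[of i G "Id X G"] unfolding group_object_def by auto
  then have "Tan n (mul 0 i (Id X G)) = Tan n (bang X G) \<Zcomp> Tan n u" by (simp add: Tan_Comp)
  then have "f \<Zcomp> mul n (Tan n i) (Id X (Ton n G)) = f \<Zcomp> (Tan n (bang X G) \<Zcomp> Tan n u)"
    by (simp add: Tan_mul[of _ G])
  then have "(f \<Zcomp> Tan n i) \<otimes>\<^bsub>Gam n Y\<^esub> f = \<one>\<^bsub>Gam n Y\<^esub>"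
    using f mul_precomp[of "Tan n i" "Ton n G" n "Id X (Ton n G)" f Y] by (simp add: Gam_mult Gam_one_eq[of f])
  then show "\<exists>g\<in>carrier (Gam n Y). g \<otimes>\<^bsub>Gam n Y\<^esub> f = \<one>\<^bsub>Gam n Y\<^esub>"
    using f by (intro bexI[of _ "f \<Zcomp> Tan n i"]) simp_all
qed (use mul_Hom mul_assoc in \<open>auto simp: Gam_mult\<close>)

lemma precomp_hom: "t \<in> Hom X Z Y \<Longrightarrow> (\<lambda>f. t \<Zcomp> f) \<in> hom (Gam n Y) (Gam n Z)"
  by (auto simp: hom_def Gam_mult mul_precomp)

text \<open>A natural transformation commutes with the images of both projections and of \<open>m\<close>. Applied to
\<open>p\<close>, \<open>0\<close>, \<open>\<ell>\<close>, \<open>c\<close> and their images under \<open>T\<close>, this turns the tangent structure into group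
homomorphisms.\<close>
lemma natural_hom:
  assumes "is_natural X (Ton k) (Tan k) (Ton l) (Tan l) \<tau>"
  shows "(\<lambda>f. f \<Zcomp> \<tau> G) \<in> hom (Gam k Y) (Gam l Y)"
proof (rule homI)
  have ty [simp]: "\<tau> M \<in> Arr X" "Dom X (\<tau> M) = Ton k M" "Cod X (\<tau> M) = Ton l M" if "M \<in> Obj X" for M
    using natural_Hom[OF assms that] by simp_all
  have nt: "Tan k f \<Zcomp> \<tau> (Cod X f) = \<tau> (Dom X f) \<Zcomp> Tan l f" if "f \<in> Arr X" for f
    using natural_eq[OF assms that] .
  fix f g
  assume fg: "f \<in> carrier (Gam k Y)" "g \<in> carrier (Gam k Y)"
  define s where "s = pair X (Tan k (pr0 X G G)) (Tan k (pr1 X G G)) f g"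
  have s: "s \<in> Hom X Y (Ton k (Prod X G G))" "s \<Zcomp> Tan k (pr0 X G G) = f" "s \<Zcomp> Tan k (pr1 X G G) = g"
    using mul_pair[of f Y k g] fg by (simp_all add: s_def)
  have ex: "(s \<Zcomp> \<tau> (Prod X G G)) \<Zcomp> Tan l h = (s \<Zcomp> Tan k h) \<Zcomp> \<tau> G" if "h \<in> Hom X (Prod X G G) G" for h
    using nt[of h] s that by simp
  have "pair X (Tan l (pr0 X G G)) (Tan l (pr1 X G G)) (f \<Zcomp> \<tau> G) (g \<Zcomp> \<tau> G) = s \<Zcomp> \<tau> (Prod X G G)"
    by (rule pair_product_eqI[OF G_product, of _ Y])
      (use s ex[of "pr0 X G G"] ex[of "pr1 X G G"] in simp_all)
  then show "f \<otimes>\<^bsub>Gam k Y\<^esub> g \<Zcomp> \<tau> G = (f \<Zcomp> \<tau> G) \<otimes>\<^bsub>Gam l Y\<^esub> (g \<Zcomp> \<tau> G)"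
    using s ex[of m] by (simp add: Gam_mult mul_def s_def[symmetric])
qed (use natural_Hom[OF assms G_Obj] in simp)

end

section \<open>Fibrewise addition expressed by the group law\<close>

context tangent_group
begin

lemma natural_proj:
  "is_natural X (Ton (Suc n)) (Tan (Suc n)) (Ton n) (Tan n) (\<lambda>M. proj X (Ton n M))"
  unfolding is_natural_def
proof (intro conjI ballI)
  fix f assume "f \<in> Arr X"
  then show "Tan (Suc n) f \<Zcomp> proj X (Ton n (Cod X f)) = proj X (Ton n (Dom X f)) \<Zcomp> Tan n f"
    using proj_nat[of "Tan n f"] by simp
qed simp

lemma natural_tzero:
  "is_natural X (Ton n) (Tan n) (Ton (Suc n)) (Tan (Suc n)) (\<lambda>M. tzero X (Ton n M))"
  unfolding is_natural_def
proof (intro conjI ballI)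
  fix f assume "f \<in> Arr X"
  then show "Tan n f \<Zcomp> tzero X (Ton n (Cod X f)) = tzero X (Ton n (Dom X f)) \<Zcomp> Tan (Suc n) f"
    using tzero_nat[of "Tan n f"] by simp
qed simp

lemma natural_vlift:
  "is_natural X (Ton (Suc n)) (Tan (Suc n)) (Ton (Suc (Suc n))) (Tan (Suc (Suc n))) (\<lambda>M. vlift X (Ton n M))"
  unfolding is_natural_def
proof (intro conjI ballI)
  fix f assume "f \<in> Arr X"
  then show "Tan (Suc n) f \<Zcomp> vlift X (Ton n (Cod X f)) = vlift X (Ton n (Dom X f)) \<Zcomp> Tan (Suc (Suc n)) f"
    using natural_eq[OF vlift_natural, of "Tan n f"] by simp
qed simp

lemma natural_flip:
  "is_natural X (Ton (Suc (Suc n))) (Tan (Suc (Suc n))) (Ton (Suc (Suc n))) (Tan (Suc (Suc n))) (\<lambda>M. flip X (Ton n M))"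
  unfolding is_natural_def
proof (intro conjI ballI)
  fix f assume "f \<in> Arr X"
  then show "Tan (Suc (Suc n)) f \<Zcomp> flip X (Ton n (Cod X f)) = flip X (Ton n (Dom X f)) \<Zcomp> Tan (Suc (Suc n)) f"
    using natural_eq[OF flip_natural, of "Tan n f"] by simp
qed simp

lemma natural_Tar:
  assumes "is_natural X (Ton k) (Tan k) (Ton l) (Tan l) \<tau>"
  shows "is_natural X (Ton (Suc k)) (Tan (Suc k)) (Ton (Suc l)) (Tan (Suc l)) (\<lambda>M. Tar X (\<tau> M))"
  unfolding is_natural_def
proof (intro conjI ballI)
  have ty: "\<tau> M \<in> Arr X" "Dom X (\<tau> M) = Ton k M" "Cod X (\<tau> M) = Ton l M" if "M \<in> Obj X" for M
    using natural_Hom[OF assms that] by simp_all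
  show "Tar X (\<tau> M) \<in> Hom X (Ton (Suc k) M) (Ton (Suc l) M)" if "M \<in> Obj X" for M
    using ty[OF that] by simp
  fix f assume f: "f \<in> Arr X"
  then have "Tar X (Tan k f \<Zcomp> \<tau> (Cod X f)) = Tar X (\<tau> (Dom X f) \<Zcomp> Tan l f)"
    using natural_eq[OF assms f] by simp
  then show "Tan (Suc k) f \<Zcomp> Tar X (\<tau> (Cod X f)) = Tar X (\<tau> (Dom X f)) \<Zcomp> Tan (Suc l) f"
    using f ty by (simp add: Tar_Comp_arr)
qed

lemmas proj_hom = natural_hom[OF natural_proj]
lemmas tzero_hom = natural_hom[OF natural_tzero]
lemmas vlift_hom = natural_hom[OF natural_vlift]
lemmas flip_hom = natural_hom[OF natural_flip]
lemmas T_tzero_hom = natural_hom[OF natural_Tar[OF natural_tzero]]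
lemmas T_vlift_hom = natural_hom[OF natural_Tar[OF natural_vlift]]
lemmas T_flip_hom = natural_hom[OF natural_Tar[OF natural_flip]]
lemmas TT_tzero_hom = natural_hom[OF natural_Tar[OF natural_Tar[OF natural_tzero]]]

lemma Gam_hom_one: "\<lbrakk>\<phi> \<in> hom (Gam k Y) (Gam l Z); Y \<in> Obj X; Z \<in> Obj X\<rbrakk> \<Longrightarrow> \<phi> \<one>\<^bsub>Gam k Y\<^esub> = \<one>\<^bsub>Gam l Z\<^esub>"
  by (rule group_hom.hom_one[OF group_hom.intro]) (auto simp: group_hom_axioms_def)

lemma Gam_hom_inv:
  "\<lbrakk>\<phi> \<in> hom (Gam k Y) (Gam l Z); Y \<in> Obj X; Z \<in> Obj X; x \<in> carrier (Gam k Y)\<rbrakk>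
    \<Longrightarrow> \<phi> (inv\<^bsub>Gam k Y\<^esub> x) = inv\<^bsub>Gam l Z\<^esub> (\<phi> x)"
  by (rule group_hom.hom_inv[OF group_hom.intro]) (auto simp: group_hom_axioms_def)

text \<open>The multiplication of \<open>T\<^sup>n\<^sup>+\<^sup>1(G)\<close> is the image under \<open>T\<close> of a map, so it preserves the fibrewise
addition, which is computed componentwise in \<open>T(T\<^sup>n(G \<times> G))\<close>.\<close>
lemma interchange:
  assumes Y: "Y \<in> Obj X"
    and x: "x \<in> Hom X Y (Ton (Suc n) G)" "x' \<in> Hom X Y (Ton (Suc n) G)"
    and y: "y \<in> Hom X Y (Ton (Suc n) G)" "y' \<in> Hom X Y (Ton (Suc n) G)"
    and xx: "x \<Zcomp> proj X (Ton n G) = x' \<Zcomp> proj X (Ton n G)"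
    and yy: "y \<Zcomp> proj X (Ton n G) = y' \<Zcomp> proj X (Ton n G)"
  shows "mul (Suc n) (tangent_sum X (Ton n G) x x') (tangent_sum X (Ton n G) y y')
    = tangent_sum X (Ton n G) (mul (Suc n) x y) (mul (Suc n) x' y')"
proof -
  let ?P = "Ton n (Prod X G G)"
  let ?a = "Tan n (pr0 X G G)" and ?b = "Tan n (pr1 X G G)"
  define s s' where "s = pair X (Tar X ?a) (Tar X ?b) x y" and "s' = pair X (Tar X ?a) (Tar X ?b) x' y'"
  have s: "s \<in> Hom X Y (Tob X ?P)" "s \<Zcomp> Tar X ?a = x" "s \<Zcomp> Tar X ?b = y"
    using mul_pair[OF x(1) y(1)] by (simp_all add: s_def)
  have s': "s' \<in> Hom X Y (Tob X ?P)" "s' \<Zcomp> Tar X ?a = x'" "s' \<Zcomp> Tar X ?b = y'"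
    using mul_pair[OF x(2) y(2)] by (simp_all add: s'_def)
  have pa: "proj X ?P \<Zcomp> ?a = Tar X ?a \<Zcomp> proj X (Ton n G)" "proj X ?P \<Zcomp> ?b = Tar X ?b \<Zcomp> proj X (Ton n G)"
    using proj_nat[of ?a] proj_nat[of ?b] by simp_all
  have ex: "(r \<Zcomp> proj X ?P) \<Zcomp> ?a = (r \<Zcomp> Tar X ?a) \<Zcomp> proj X (Ton n G)"
    "(r \<Zcomp> proj X ?P) \<Zcomp> ?b = (r \<Zcomp> Tar X ?b) \<Zcomp> proj X (Ton n G)" if "r \<in> Hom X Y (Tob X ?P)" for r
    using that by (simp_all add: pa)
  have ss: "s \<Zcomp> proj X ?P = s' \<Zcomp> proj X ?P"
    by (rule product_ext[OF G_product[of n], of _ Y])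
      (use s(1) s'(1) ex[OF s(1)] ex[OF s'(1)] in \<open>simp_all only: s s' xx yy, simp_all\<close>)
  note P = Ton_Obj[OF Prod_Obj[OF G_Obj G_Obj], of n]
  let ?S = "tangent_sum X ?P s s'"
  have S: "?S \<in> Hom X Y (Tob X ?P)" by (rule tangent_sum_Hom[OF P s(1) s'(1) ss])
  have Sf: "?S \<Zcomp> Tar X f = tangent_sum X (Ton n G) (s \<Zcomp> Tar X f) (s' \<Zcomp> Tar X f)" if "f \<in> Hom X ?P (Ton n G)" for f
    by (rule tangent_sum_T[OF P s(1) s'(1) ss that])
  have "pair X (Tar X ?a) (Tar X ?b) (tangent_sum X (Ton n G) x x') (tangent_sum X (Ton n G) y y') = ?S"
    by (rule pair_product_eqI[OF G_product[of "Suc n", simplified], of _ Y])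
      (use S Sf[of ?a] Sf[of ?b] s s' in simp_all)
  then show ?thesis
    using Sf[of "Tan n m"] by (simp add: mul_def s_def s'_def)
qed

text \<open>Let \<open>e\<close> be the zero over the common base point. Then \<open>x = x (e\<inverse> e)\<close> and \<open>y = e (e\<inverse> y)\<close>, and
interchange turns the sum into \<open>(x + e) (e\<inverse> + e\<inverse>) (e + y) = x e\<inverse> y\<close>.\<close>
lemma sum_formula:
  fixes n Y
  defines "\<Gamma> \<equiv> Gam (Suc n) Y"
  assumes Y: "Y \<in> Obj X"
    and x: "x \<in> Hom X Y (Ton (Suc n) G)" and y: "y \<in> Hom X Y (Ton (Suc n) G)"
    and xy: "x \<Zcomp> proj X (Ton n G) = y \<Zcomp> proj X (Ton n G)"
  shows "tangent_sum X (Ton n G) x y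
    = x \<otimes>\<^bsub>\<Gamma>\<^esub> inv\<^bsub>\<Gamma>\<^esub> (x \<Zcomp> proj X (Ton n G) \<Zcomp> tzero X (Ton n G)) \<otimes>\<^bsub>\<Gamma>\<^esub> y"
proof -
  interpret \<Gamma>: group \<Gamma> using Gam_group[OF Y] by (simp add: \<Gamma>_def)
  let ?p = "proj X (Ton n G)" and ?z = "tzero X (Ton n G)"
  have M [simp]: "Ton n G \<in> Obj X" by simp
  define e where "e = x \<Zcomp> ?p \<Zcomp> ?z"
  define e' where "e' = inv\<^bsub>\<Gamma>\<^esub> e"
  have [simp]: "x \<in> carrier \<Gamma>" "y \<in> carrier \<Gamma>" "e \<in> carrier \<Gamma>"
    using x y by (simp_all add: \<Gamma>_def e_def)
  have [simp]: "e' \<in> carrier \<Gamma>" by (simp add: e'_def)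
  have c: "h \<in> Hom X Y (Ton (Suc n) G)" if "h \<in> carrier \<Gamma>" for h using that by (simp add: \<Gamma>_def)
  have p: "(f \<otimes>\<^bsub>\<Gamma>\<^esub> g) \<Zcomp> ?p = (f \<Zcomp> ?p) \<otimes>\<^bsub>Gam n Y\<^esub> (g \<Zcomp> ?p)" if "f \<in> carrier \<Gamma>" "g \<in> carrier \<Gamma>" for f g
    using hom_mult[OF proj_hom, of f n Y g] that by (simp add: \<Gamma>_def)
  have ep: "e \<Zcomp> ?p = x \<Zcomp> ?p" "e \<Zcomp> ?p = y \<Zcomp> ?p" using x y xy by (simp_all add: e_def)
  have pz: "(\<lambda>f. (f \<Zcomp> ?p) \<Zcomp> ?z) \<in> hom \<Gamma> \<Gamma>"
    using hom_compose[OF proj_hom[of n Y] tzero_hom[of n Y]] by (simp add: \<Gamma>_def comp_def)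
  have "(e' \<Zcomp> ?p) \<Zcomp> ?z = inv\<^bsub>\<Gamma>\<^esub> ((e \<Zcomp> ?p) \<Zcomp> ?z)"
    unfolding e'_def \<Gamma>_def
    by (rule Gam_hom_inv[OF pz[unfolded \<Gamma>_def] Y Y]) (use \<open>e \<in> carrier \<Gamma>\<close> in \<open>simp add: \<Gamma>_def\<close>)
  also have "(e \<Zcomp> ?p) \<Zcomp> ?z = e" unfolding ep(1) by (simp add: e_def)
  finally have e'z: "e' \<Zcomp> ?p \<Zcomp> ?z = e'" by (simp add: e'_def)
  have e'e': "tangent_sum X (Ton n G) e' e' = e'"
    using tangent_sum_zero_right[OF M, of e' Y] c[of e'] e'z by simp
  have xe: "tangent_sum X (Ton n G) x e = x"
    using tangent_sum_zero_right[OF M, of x Y] x by (simp add: e_def)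
  have "tangent_sum X (Ton n G) e y = tangent_sum X (Ton n G) y e"
    by (rule tangent_sum_comm[OF M, of _ Y]) (use c[of e] y ep in simp_all)
  also have "\<dots> = y"
    using tangent_sum_zero_right[OF M, of y Y] y xy by (simp add: e_def)
  finally have ey: "tangent_sum X (Ton n G) e y = y" .
  have xe'e: "x \<otimes>\<^bsub>\<Gamma>\<^esub> (e' \<otimes>\<^bsub>\<Gamma>\<^esub> e) = x" "e \<otimes>\<^bsub>\<Gamma>\<^esub> (e' \<otimes>\<^bsub>\<Gamma>\<^esub> y) = y"
    by (simp_all add: e'_def \<Gamma>.m_assoc[symmetric])
  have I: "tangent_sum X (Ton n G) a a' \<otimes>\<^bsub>\<Gamma>\<^esub> tangent_sum X (Ton n G) b b'
      = tangent_sum X (Ton n G) (a \<otimes>\<^bsub>\<Gamma>\<^esub> b) (a' \<otimes>\<^bsub>\<Gamma>\<^esub> b')"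
    if "a \<in> carrier \<Gamma>" "a' \<in> carrier \<Gamma>" "b \<in> carrier \<Gamma>" "b' \<in> carrier \<Gamma>"
      "a \<Zcomp> ?p = a' \<Zcomp> ?p" "b \<Zcomp> ?p = b' \<Zcomp> ?p" for a a' b b'
    using interchange[OF Y, of a n a' b b'] that by (simp add: \<Gamma>_def Gam_mult)
  have "tangent_sum X (Ton n G) x y = tangent_sum X (Ton n G) (x \<otimes>\<^bsub>\<Gamma>\<^esub> (e' \<otimes>\<^bsub>\<Gamma>\<^esub> e)) (e \<otimes>\<^bsub>\<Gamma>\<^esub> (e' \<otimes>\<^bsub>\<Gamma>\<^esub> y))"
    by (simp only: xe'e)
  also have "\<dots> = tangent_sum X (Ton n G) x e \<otimes>\<^bsub>\<Gamma>\<^esub> tangent_sum X (Ton n G) (e' \<otimes>\<^bsub>\<Gamma>\<^esub> e) (e' \<otimes>\<^bsub>\<Gamma>\<^esub> y)"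
    by (rule I[symmetric]) (simp_all add: ep p xy)
  also have "tangent_sum X (Ton n G) (e' \<otimes>\<^bsub>\<Gamma>\<^esub> e) (e' \<otimes>\<^bsub>\<Gamma>\<^esub> y)
      = tangent_sum X (Ton n G) e' e' \<otimes>\<^bsub>\<Gamma>\<^esub> tangent_sum X (Ton n G) e y"
    by (rule I[symmetric]) (simp_all add: ep xy)
  finally have "tangent_sum X (Ton n G) x y = x \<otimes>\<^bsub>\<Gamma>\<^esub> (e' \<otimes>\<^bsub>\<Gamma>\<^esub> y)"
    by (simp only: xe e'e' ey)
  also have "\<dots> = x \<otimes>\<^bsub>\<Gamma>\<^esub> e' \<otimes>\<^bsub>\<Gamma>\<^esub> y"
    by (simp add: \<Gamma>.m_assoc)
  finally show ?thesis unfolding e'_def e_def .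
qed

lemma sum_on_kernel:
  assumes Y: "Y \<in> Obj X"
    and x: "x \<in> Hom X Y (Ton (Suc n) G)" "x \<Zcomp> proj X (Ton n G) = \<one>\<^bsub>Gam n Y\<^esub>"
    and y: "y \<in> Hom X Y (Ton (Suc n) G)" "y \<Zcomp> proj X (Ton n G) = \<one>\<^bsub>Gam n Y\<^esub>"
  shows "tangent_sum X (Ton n G) x y = x \<otimes>\<^bsub>Gam (Suc n) Y\<^esub> y"
proof -
  interpret \<Gamma>: group "Gam (Suc n) Y" using Gam_group[OF Y] .
  have "\<one>\<^bsub>Gam n Y\<^esub> \<Zcomp> tzero X (Ton n G) = \<one>\<^bsub>Gam (Suc n) Y\<^esub>"
    by (rule Gam_hom_one[OF tzero_hom Y Y])
  then show ?thesis using sum_formula[OF Y x(1) y(1)] x y by simp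
qed

text \<open>The two operations agree on the kernel of \<open>p\<close>, and addition is commutative.\<close>
lemma kernel_commute:
  assumes Y: "Y \<in> Obj X"
    and x: "x \<in> Hom X Y (Ton (Suc n) G)" "x \<Zcomp> proj X (Ton n G) = \<one>\<^bsub>Gam n Y\<^esub>"
    and y: "y \<in> Hom X Y (Ton (Suc n) G)" "y \<Zcomp> proj X (Ton n G) = \<one>\<^bsub>Gam n Y\<^esub>"
  shows "x \<otimes>\<^bsub>Gam (Suc n) Y\<^esub> y = y \<otimes>\<^bsub>Gam (Suc n) Y\<^esub> x"
  using sum_on_kernel[OF assms] sum_on_kernel[OF Y y x]
    tangent_sum_comm[OF Ton_Obj[OF G_Obj], of x Y n y] x y by simp

text \<open>By the sum formula a negative of \<open>v\<close> is a solution \<open>w\<close> of \<open>v e\<inverse> w = e\<close>. It exists, is unique, and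
gives the negation as an arrow when \<open>v\<close> is the identity.\<close>
lemma neg_formula:
  fixes n Y
  defines "\<Gamma> \<equiv> Gam (Suc n) Y"
  assumes Y: "Y \<in> Obj X" and v: "v \<in> Hom X Y (Ton (Suc n) G)"
  shows "v \<Zcomp> neg X (Ton n G) = (v \<Zcomp> proj X (Ton n G) \<Zcomp> tzero X (Ton n G))
      \<otimes>\<^bsub>\<Gamma>\<^esub> inv\<^bsub>\<Gamma>\<^esub> v \<otimes>\<^bsub>\<Gamma>\<^esub> (v \<Zcomp> proj X (Ton n G) \<Zcomp> tzero X (Ton n G))"
    and "neg X (Ton n G) \<in> Hom X (Ton (Suc n) G) (Ton (Suc n) G)"
    and "neg X (Ton n G) \<Zcomp> proj X (Ton n G) = proj X (Ton n G)"
proof -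
  let ?M = "Ton n G" and ?H = "Ton (Suc n) G"
  let ?p = "proj X ?M" and ?z = "tzero X ?M"
  have M [simp]: "?M \<in> Obj X" and H [simp]: "?H \<in> Obj X" by simp_all
  let ?D = "Gam (Suc n) ?H"
  interpret D: group ?D using Gam_group[OF H] .
  interpret E: group "Gam n ?H" using Gam_group[OF H] .
  \<comment> \<open>The generic tangent vector, namely the identity of the total space.\<close>
  define w where "w = Id X ?H"
  define e where "e = ?p \<Zcomp> ?z"
  have we [simp]: "w \<in> carrier ?D" "e \<in> carrier ?D" by (simp_all add: w_def e_def)
  have weH: "w \<in> Hom X ?H ?H" "e \<in> Hom X ?H ?H" by (simp_all add: w_def e_def)
  have e: "w \<Zcomp> ?p \<Zcomp> ?z = e" by (simp add: w_def e_def)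
  have ep: "e \<Zcomp> ?p = ?p" "w \<Zcomp> ?p = ?p" by (simp_all add: e_def w_def)
  have pc [simp]: "?p \<in> carrier (Gam n ?H)" by simp
  define r where "r = e \<otimes>\<^bsub>?D\<^esub> inv\<^bsub>?D\<^esub> w \<otimes>\<^bsub>?D\<^esub> e"
  have rD [simp]: "r \<in> carrier ?D" unfolding r_def by (intro D.m_closed D.inv_closed we)
  then have rH: "r \<in> Hom X ?H ?H" by simp
  have "r \<Zcomp> ?p = (e \<Zcomp> ?p) \<otimes>\<^bsub>Gam n ?H\<^esub> inv\<^bsub>Gam n ?H\<^esub> (w \<Zcomp> ?p) \<otimes>\<^bsub>Gam n ?H\<^esub> (e \<Zcomp> ?p)"
    using hom_mult[OF proj_hom, of "e \<otimes>\<^bsub>?D\<^esub> inv\<^bsub>?D\<^esub> w" n ?H e]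
      hom_mult[OF proj_hom, of e n ?H "inv\<^bsub>?D\<^esub> w"] Gam_hom_inv[OF proj_hom H H we(1)]
    unfolding r_def by (simp only: we D.m_closed D.inv_closed)
  also have "\<dots> = ?p" unfolding ep using E.r_inv[OF pc] E.l_one[OF pc] by (simp only:)
  finally have rp: "r \<Zcomp> ?p = ?p" .
  have neg: "is_negation X (tangent_bundle X ?M) h \<longleftrightarrow> h \<in> Hom X ?H ?H \<and> h \<Zcomp> ?p = ?p \<and> tangent_sum X ?M w h = e" for h
    by (simp add: is_negation_def Let_def tangent_sum_def w_def e_def) (simp add: tangent_bundle_def)
  have sum: "tangent_sum X ?M w h = w \<otimes>\<^bsub>?D\<^esub> inv\<^bsub>?D\<^esub> e \<otimes>\<^bsub>?D\<^esub> h" if "h \<in> Hom X ?H ?H" "h \<Zcomp> ?p = ?p" for h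
    using sum_formula[OF H weH(1), of h] that ep(2) e by (simp only:)
  have nr: "neg X ?M = r"
    unfolding neg_def
  proof (rule the_equality)
    have "w \<otimes>\<^bsub>?D\<^esub> inv\<^bsub>?D\<^esub> e \<otimes>\<^bsub>?D\<^esub> r = e"
      unfolding r_def using we by (simp only: D.m_assoc D.m_closed D.inv_closed D.inv_cancel D.r_inv D.l_one D.r_one)
    then show "is_negation X (tangent_bundle X ?M) r" using neg sum[OF rH rp] rH rp by simp
  next
    fix h assume "is_negation X (tangent_bundle X ?M) h"
    then have h: "h \<in> Hom X ?H ?H" "h \<Zcomp> ?p = ?p" "tangent_sum X ?M w h = e" using neg by blast+
    have hD: "h \<in> carrier ?D" using h by simp
    have "w \<otimes>\<^bsub>?D\<^esub> inv\<^bsub>?D\<^esub> e \<otimes>\<^bsub>?D\<^esub> h = e" using sum[OF h(1,2)] h(3) by simp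
    then have "h = inv\<^bsub>?D\<^esub> (w \<otimes>\<^bsub>?D\<^esub> inv\<^bsub>?D\<^esub> e) \<otimes>\<^bsub>?D\<^esub> e"
      using hD by (metis D.inv_closed D.inv_solve_left D.m_closed we)
    then show "h = r" unfolding r_def using we
      by (simp only: D.inv_mult_group D.inv_closed D.inv_inv)
  qed
  show "neg X ?M \<in> Hom X ?H ?H" "neg X ?M \<Zcomp> ?p = ?p" using nr rH rp by simp_all
  have pre: "(\<lambda>f. v \<Zcomp> f) \<in> hom ?D \<Gamma>" unfolding \<Gamma>_def by (rule precomp_hom) (use v in simp)
  have "v \<Zcomp> r = (v \<Zcomp> e) \<otimes>\<^bsub>\<Gamma>\<^esub> inv\<^bsub>\<Gamma>\<^esub> (v \<Zcomp> w) \<otimes>\<^bsub>\<Gamma>\<^esub> (v \<Zcomp> e)"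
    using hom_mult[OF pre, of "e \<otimes>\<^bsub>?D\<^esub> inv\<^bsub>?D\<^esub> w" e] hom_mult[OF pre, of e "inv\<^bsub>?D\<^esub> w"]
      Gam_hom_inv[OF pre[unfolded \<Gamma>_def] H Y we(1)]
    unfolding r_def \<Gamma>_def by (simp only: we D.m_closed D.inv_closed)
  then show "v \<Zcomp> neg X ?M = (v \<Zcomp> ?p \<Zcomp> ?z) \<otimes>\<^bsub>\<Gamma>\<^esub> inv\<^bsub>\<Gamma>\<^esub> v \<otimes>\<^bsub>\<Gamma>\<^esub> (v \<Zcomp> ?p \<Zcomp> ?z)"
    using v by (simp add: nr w_def e_def)
qed

end

section \<open>Left-invariant vector fields\<close>

context tangent_group
begin

definition unit_tangent :: "'a set"
  where "unit_tangent = {x \<in> Hom X (One X) (Tob X G). x \<Zcomp> proj X G = u}"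

text \<open>The vector field that carries \<open>x\<close> to every point by left translation.\<close>
definition translate :: "'a \<Rightarrow> 'a"
  where "translate x = mul (Suc 0) (tzero X G) (bang X G \<Zcomp> x)"

lemma unit_tangent_iff: "x \<in> unit_tangent \<longleftrightarrow> x \<in> Hom X (One X) (Tob X G) \<and> x \<Zcomp> proj X G = u"
  by (simp add: unit_tangent_def)

lemma one_unit: "\<one>\<^bsub>Gam 0 (One X)\<^esub> = u"
  using Gam_one[of "Id X (One X)" "One X" 0] by simp

lemma one_bang: "Y \<in> Obj X \<Longrightarrow> \<one>\<^bsub>Gam 0 Y\<^esub> = bang X Y \<Zcomp> u"
  using Gam_one[of "bang X Y" Y 0] by simp

lemma bang_precomp: "t \<in> Hom X Z Y \<Longrightarrow> t \<Zcomp> bang X Y = bang X Z"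
  by (rule terminal_eq[OF One_terminal, of _ Z]) (auto intro: Dom_Obj Cod_Obj)

lemma bang_One: "bang X (One X) = Id X (One X)"
  by (rule terminal_eq[OF One_terminal, of _ "One X"]) simp_all

lemma translate_Hom: "x \<in> Hom X (One X) (Tob X G) \<Longrightarrow> translate x \<in> Hom X G (Tob X G)"
  unfolding translate_def using mul_Hom[of "tzero X G" G "Suc 0" "bang X G \<Zcomp> x"] by simp

lemma precomp_translate:
  assumes x: "x \<in> Hom X (One X) (Tob X G)" and t: "t \<in> Hom X Y G"
  shows "t \<Zcomp> translate x = mul (Suc 0) (t \<Zcomp> tzero X G) (bang X Y \<Zcomp> x)"
proof -
  have "t \<Zcomp> (bang X G \<Zcomp> x) = (t \<Zcomp> bang X G) \<Zcomp> x" using x t by simp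
  then show ?thesis
    unfolding translate_def
    using mul_precomp[of "tzero X G" G "Suc 0" "bang X G \<Zcomp> x" t Y] x t bang_precomp[OF t] by simp
qed

lemma unit_translate:
  assumes x: "x \<in> Hom X (One X) (Tob X G)"
  shows "u \<Zcomp> translate x = x"
proof -
  interpret group "Gam (Suc 0) (One X)" by (rule Gam_group) simp
  have "u \<Zcomp> tzero X G = \<one>\<^bsub>Gam (Suc 0) (One X)\<^esub>"
    using Gam_hom_one[OF tzero_hom[of 0 "One X"]] by (simp add: one_unit)
  then show ?thesis
    using precomp_translate[OF x, of u "One X"] x l_one[of x] by (simp add: bang_One Gam_mult)
qed

lemma translate_vector_field:
  assumes x: "x \<in> unit_tangent"
  shows "translate x \<in> vector_fields X G"
proof -
  interpret group "Gam 0 G" by (rule Gam_group) simp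
  have x': "x \<in> Hom X (One X) (Tob X G)" "x \<Zcomp> proj X G = u" using x by (simp_all add: unit_tangent_iff)
  have "translate x \<Zcomp> proj X G = Id X G \<otimes>\<^bsub>Gam 0 G\<^esub> (bang X G \<Zcomp> u)"
    unfolding translate_def
    using hom_mult[OF proj_hom[of 0 G], of "tzero X G" "bang X G \<Zcomp> x"] x' by (simp add: Gam_mult)
  also have "\<dots> = Id X G"
    using r_one[of "Id X G"] by (simp add: one_bang)
  finally show ?thesis using translate_Hom[OF x'(1)] by (simp add: vector_fields_def)
qed

text \<open>Left invariance without the identification of \<open>T(G) \<times> T(G)\<close> with \<open>T(G \<times> G)\<close>.\<close>
lemma left_invariant_iff:
  "\<xi> \<in> left_invariant_vfs X G m \<longleftrightarrow> \<xi> \<in> vector_fields X G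
    \<and> mul (Suc 0) (pr0 X G G \<Zcomp> tzero X G) (pr1 X G G \<Zcomp> \<xi>) = m \<Zcomp> \<xi>"
proof (cases "\<xi> \<in> vector_fields X G")
  case True
  then have \<xi>: "\<xi> \<in> Hom X G (Tob X G)" by (simp add: vector_fields_def)
  have "prod_map X (tzero X G) \<xi> = prod_pair X (pr0 X G G \<Zcomp> tzero X G) (pr1 X G G \<Zcomp> \<xi>)"
    using \<xi> by (simp add: prod_map_def)
  then have "prod_map X (tzero X G) \<xi> \<Zcomp> inverse_arr X (T_comparison X G G) \<Zcomp> Tar X m
      = mul (Suc 0) (pr0 X G G \<Zcomp> tzero X G) (pr1 X G G \<Zcomp> \<xi>)"
    using inverse_T_comparison[of "pr0 X G G \<Zcomp> tzero X G" "Prod X G G" G "pr1 X G G \<Zcomp> \<xi>" G] \<xi>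
    by (simp add: mul_def)
  then show ?thesis using True by (simp add: left_invariant_vfs_def)
qed (simp add: left_invariant_vfs_def)

lemma translate_left_invariant:
  assumes x: "x \<in> unit_tangent"
  shows "translate x \<in> left_invariant_vfs X G m"
proof -
  let ?P = "Prod X G G"
  interpret group "Gam (Suc 0) ?P" by (rule Gam_group) simp
  have x': "x \<in> Hom X (One X) (Tob X G)" using x by (simp add: unit_tangent_iff)
  have "m = mul 0 (pr0 X G G) (pr1 X G G)"
    using pair_product_eqI[OF Prod_product[of G G], of "Id X ?P" ?P] by (simp add: mul_def)
  then have m: "m \<Zcomp> tzero X G = (pr0 X G G \<Zcomp> tzero X G) \<otimes>\<^bsub>Gam (Suc 0) ?P\<^esub> (pr1 X G G \<Zcomp> tzero X G)"
    using hom_mult[OF tzero_hom[of 0 ?P], of "pr0 X G G" "pr1 X G G"] by (simp add: Gam_mult)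
  have "m \<Zcomp> translate x = (pr0 X G G \<Zcomp> tzero X G) \<otimes>\<^bsub>Gam (Suc 0) ?P\<^esub> (pr1 X G G \<Zcomp> tzero X G)
      \<otimes>\<^bsub>Gam (Suc 0) ?P\<^esub> (bang X ?P \<Zcomp> x)"
    using precomp_translate[OF x', of m ?P] m by (simp add: Gam_mult)
  also have "\<dots> = (pr0 X G G \<Zcomp> tzero X G) \<otimes>\<^bsub>Gam (Suc 0) ?P\<^esub>
      ((pr1 X G G \<Zcomp> tzero X G) \<otimes>\<^bsub>Gam (Suc 0) ?P\<^esub> (bang X ?P \<Zcomp> x))"
    by (rule m_assoc) (use x' in simp_all)
  also have "(pr1 X G G \<Zcomp> tzero X G) \<otimes>\<^bsub>Gam (Suc 0) ?P\<^esub> (bang X ?P \<Zcomp> x) = pr1 X G G \<Zcomp> translate x"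
    using precomp_translate[OF x', of "pr1 X G G" ?P] by (simp add: Gam_mult)
  finally show ?thesis
    using translate_vector_field[OF x] by (simp add: left_invariant_iff Gam_mult)
qed

text \<open>Restrict the equation of left invariance along \<open>\<langle>1, ! u\<rangle> : G \<rightarrow> G \<times> G\<close>, a section of \<open>m\<close>.\<close>
lemma left_invariant_eq_translate:
  assumes \<xi>: "\<xi> \<in> left_invariant_vfs X G m"
  shows "u \<Zcomp> \<xi> \<in> unit_tangent" "\<xi> = translate (u \<Zcomp> \<xi>)"
proof -
  have \<xi>': "\<xi> \<in> Hom X G (Tob X G)" "\<xi> \<Zcomp> proj X G = Id X G"
    and inv: "mul (Suc 0) (pr0 X G G \<Zcomp> tzero X G) (pr1 X G G \<Zcomp> \<xi>) = m \<Zcomp> \<xi>"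
    using \<xi> by (simp_all add: left_invariant_iff vector_fields_def)
  show "u \<Zcomp> \<xi> \<in> unit_tangent" using \<xi>' by (simp add: unit_tangent_iff)
  interpret group "Gam 0 G" by (rule Gam_group) simp
  let ?t = "pair X (pr0 X G G) (pr1 X G G) (Id X G) (bang X G \<Zcomp> u)"
  have t: "?t \<in> Hom X G (Prod X G G)" "?t \<Zcomp> pr0 X G G = Id X G" "?t \<Zcomp> pr1 X G G = bang X G \<Zcomp> u"
    using pair_product[OF Prod_product[of G G], of "Id X G" G "bang X G \<Zcomp> u"] by simp_all
  have tm: "?t \<Zcomp> m = Id X G"
    using r_one[of "Id X G"] by (simp add: one_bang Gam_mult mul_def)
  have "?t \<Zcomp> (pr0 X G G \<Zcomp> tzero X G) = (?t \<Zcomp> pr0 X G G) \<Zcomp> tzero X G"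
    "?t \<Zcomp> (pr1 X G G \<Zcomp> \<xi>) = (?t \<Zcomp> pr1 X G G) \<Zcomp> \<xi>"
    using t(1) \<xi>'(1) by simp_all
  then have a: "?t \<Zcomp> (pr0 X G G \<Zcomp> tzero X G) = tzero X G"
    "?t \<Zcomp> (pr1 X G G \<Zcomp> \<xi>) = bang X G \<Zcomp> (u \<Zcomp> \<xi>)"
    unfolding t(2,3) using \<xi>'(1) by simp_all
  have "?t \<Zcomp> mul (Suc 0) (pr0 X G G \<Zcomp> tzero X G) (pr1 X G G \<Zcomp> \<xi>)
      = mul (Suc 0) (?t \<Zcomp> (pr0 X G G \<Zcomp> tzero X G)) (?t \<Zcomp> (pr1 X G G \<Zcomp> \<xi>))"
    by (rule mul_precomp) (use t(1) \<xi>'(1) in simp_all)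
  also have "\<dots> = translate (u \<Zcomp> \<xi>)" unfolding a translate_def ..
  finally have "?t \<Zcomp> mul (Suc 0) (pr0 X G G \<Zcomp> tzero X G) (pr1 X G G \<Zcomp> \<xi>) = translate (u \<Zcomp> \<xi>)" .
  moreover have "?t \<Zcomp> (m \<Zcomp> \<xi>) = (?t \<Zcomp> m) \<Zcomp> \<xi>" using t(1) \<xi>'(1) by simp
  then have "?t \<Zcomp> (m \<Zcomp> \<xi>) = \<xi>" unfolding tm using \<xi>'(1) by simp
  ultimately show "\<xi> = translate (u \<Zcomp> \<xi>)" unfolding inv by simp
qed


section \<open>The bracket as a commutator\<close>

text \<open>A point of \<open>T(G)\<close> is placed in the outer or in the inner infinitesimal direction of \<open>T\<^sup>2(G)\<close>, in the
sense that \<open>\<epsilon>1 x p = 1\<close> for \<open>x\<close> over the unit and \<open>\<epsilon>2 x p = x\<close>; the flip exchanges the two.\<close>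
abbreviation \<epsilon>1 :: "'a \<Rightarrow> 'a" where "\<epsilon>1 x \<equiv> x \<Zcomp> Tar X (tzero X G)"
abbreviation \<epsilon>2 :: "'a \<Rightarrow> 'a" where "\<epsilon>2 x \<equiv> x \<Zcomp> tzero X (Tob X G)"
abbreviation \<Gamma>1 where "\<Gamma>1 \<equiv> Gam (Suc 0) (One X)"
abbreviation \<Gamma>2 where "\<Gamma>2 \<equiv> Gam (Suc (Suc 0)) (One X)"
abbreviation \<Gamma>3 where "\<Gamma>3 \<equiv> Gam (Suc (Suc (Suc 0))) (One X)"

definition unit_bracket :: "'a \<Rightarrow> 'a \<Rightarrow> 'a"
  where "unit_bracket x y = u \<Zcomp> vf_bracket X G (translate x) (translate y)"

text \<open>\<open>T\<close> is multiplicative, and the composite \<open>1 \<rightarrow> T(G) \<rightarrow> T(1)\<close> can only be the zero of the terminal object,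
so the constant factor of the translate contributes \<open>0\<^sub>1 T(y) = y 0\<close>.\<close>
lemma element_T_translate:
  assumes x: "x \<in> Hom X (One X) (Tob X G)" and y: "y \<in> Hom X (One X) (Tob X G)"
  shows "x \<Zcomp> Tar X (translate y) = \<epsilon>1 x \<otimes>\<^bsub>\<Gamma>2\<^esub> \<epsilon>2 y"
proof -
  have b: "x \<Zcomp> Tar X (bang X G) = tzero X (One X)"
    by (rule terminal_eq[OF T_One_terminal, of _ "One X"]) (use x in simp_all)
  have "Tar X (translate y) = mul (Suc (Suc 0)) (Tar X (tzero X G)) (Tar X (bang X G) \<Zcomp> Tar X y)"
    unfolding translate_def
    using Tar_mul[of "tzero X G" G "Suc 0" "bang X G \<Zcomp> y"] y by (simp add: Tar_Comp_arr)
  moreover have "x \<Zcomp> mul (Suc (Suc 0)) (Tar X (tzero X G)) (Tar X (bang X G) \<Zcomp> Tar X y)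
    = mul (Suc (Suc 0)) (\<epsilon>1 x) (x \<Zcomp> (Tar X (bang X G) \<Zcomp> Tar X y))"
    by (rule mul_precomp) (use x y in simp_all)
  moreover have "x \<Zcomp> (Tar X (bang X G) \<Zcomp> Tar X y) = \<epsilon>2 y"
    using Comp_assoc_right[of x "Tar X (bang X G)" "Tar X y"] x y b tzero_nat[of y]
    by (simp del: Comp_assoc_right)
  ultimately show ?thesis by (simp add: Gam_mult)
qed

lemma T_tzero_proj:
  "M \<in> Obj X \<Longrightarrow> Tar X (tzero X M) \<Zcomp> proj X (Tob X M) = proj X M \<Zcomp> tzero X M"
  using proj_nat[of "tzero X M"] by simp

lemma \<epsilon>_proj:
  assumes "x \<in> unit_tangent"
  shows "\<epsilon>1 x \<in> carrier \<Gamma>2" "\<epsilon>2 x \<in> carrier \<Gamma>2" "x \<Zcomp> vlift X G \<in> carrier \<Gamma>2"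
    "\<epsilon>1 x \<Zcomp> proj X (Tob X G) = \<one>\<^bsub>\<Gamma>1\<^esub>" "\<epsilon>2 x \<Zcomp> proj X (Tob X G) = x"
    "(x \<Zcomp> vlift X G) \<Zcomp> proj X (Tob X G) = \<one>\<^bsub>\<Gamma>1\<^esub>"
proof -
  have x: "x \<in> Hom X (One X) (Tob X G)" "x \<Zcomp> proj X G = u" using assms by (simp_all add: unit_tangent_iff)
  have u0: "u \<Zcomp> tzero X G = \<one>\<^bsub>\<Gamma>1\<^esub>"
    using Gam_hom_one[OF tzero_hom[of 0 "One X"]] by (simp add: one_unit)
  have xp: "x \<Zcomp> (proj X G \<Zcomp> tzero X G) = \<one>\<^bsub>\<Gamma>1\<^esub>"
    using Comp_assoc_right[of x "proj X G" "tzero X G"] x u0 by (simp del: Comp_assoc_right)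
  show "\<epsilon>1 x \<in> carrier \<Gamma>2" "\<epsilon>2 x \<in> carrier \<Gamma>2" "x \<Zcomp> vlift X G \<in> carrier \<Gamma>2"
    "\<epsilon>1 x \<Zcomp> proj X (Tob X G) = \<one>\<^bsub>\<Gamma>1\<^esub>" "\<epsilon>2 x \<Zcomp> proj X (Tob X G) = x"
    "(x \<Zcomp> vlift X G) \<Zcomp> proj X (Tob X G) = \<one>\<^bsub>\<Gamma>1\<^esub>"
    using x xp by (simp_all add: T_tzero_proj vlift_proj)
qed

lemma flip_\<epsilon>:
  assumes x: "x \<in> Hom X (One X) (Tob X G)"
  shows "\<epsilon>1 x \<Zcomp> flip X G = \<epsilon>2 x" "\<epsilon>2 x \<Zcomp> flip X G = \<epsilon>1 x" "(x \<Zcomp> vlift X G) \<Zcomp> flip X G = x \<Zcomp> vlift X G"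
  using x by (simp_all add: T_tzero_flip tzero_flip vlift_flip)

text \<open>Let \<open>\<xi>\<close> and \<open>\<zeta>\<close> be the translates of \<open>x\<close> and \<open>y\<close>. At the unit, \<open>\<xi> T(\<zeta>)\<close> becomes
\<open>\<epsilon>1 x \<cdot> \<epsilon>2 y\<close> and \<open>\<zeta> T(\<xi>) c\<close> becomes \<open>\<epsilon>2 y \<cdot> \<epsilon>1 x\<close>. Both lie over \<open>y\<close>, so
by the formulas for sums and negatives their difference is their quotient times the zero \<open>\<epsilon>2 y\<close>.
The brace removes exactly this zero, in the bundle \<open>T(p)\<close>.\<close>
lemma unit_bracket_commutator:
  assumes x: "x \<in> unit_tangent" and y: "y \<in> unit_tangent"
  shows "unit_bracket x y \<in> unit_tangent"
    and "unit_bracket x y \<Zcomp> vlift X G = group_commutator \<Gamma>2 (\<epsilon>1 x) (\<epsilon>2 y)"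
proof -
  interpret \<Gamma>1: group \<Gamma>1 by (rule Gam_group) simp
  interpret \<Gamma>2: group \<Gamma>2 by (rule Gam_group) simp
  have xH: "x \<in> Hom X (One X) (Tob X G)" and yH: "y \<in> Hom X (One X) (Tob X G)"
    and yp: "y \<Zcomp> proj X G = u"
    using x y by (simp_all add: unit_tangent_iff)
  define \<xi> \<zeta> where "\<xi> = translate x" and "\<zeta> = translate y"
  have \<xi>: "\<xi> \<in> Hom X G (Tob X G)" "\<xi> \<Zcomp> proj X G = Id X G" "u \<Zcomp> \<xi> = x"
    using translate_vector_field[OF x] unit_translate[OF xH] by (simp_all add: \<xi>_def vector_fields_def)
  have \<zeta>: "\<zeta> \<in> Hom X G (Tob X G)" "\<zeta> \<Zcomp> proj X G = Id X G" "u \<Zcomp> \<zeta> = y"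
    using translate_vector_field[OF y] unit_translate[OF yH] by (simp_all add: \<zeta>_def vector_fields_def)
  have T\<xi>: "Tar X \<xi> \<Zcomp> Tar X (proj X G) = Id X (Tob X G)" "Tar X \<xi> \<Zcomp> proj X (Tob X G) = proj X G \<Zcomp> \<xi>"
    using \<xi> proj_nat[of \<xi>] by (simp_all add: Tar_Comp_arr[symmetric])
  have T\<zeta>: "Tar X \<zeta> \<Zcomp> Tar X (proj X G) = Id X (Tob X G)" "Tar X \<zeta> \<Zcomp> proj X (Tob X G) = proj X G \<Zcomp> \<zeta>"
    using \<zeta> proj_nat[of \<zeta>] by (simp_all add: Tar_Comp_arr[symmetric])
  let ?n = "neg X (Tob X G)"
  have n: "?n \<in> Hom X (Tob X (Tob X G)) (Tob X (Tob X G))" "?n \<Zcomp> proj X (Tob X G) = proj X (Tob X G)"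
    using neg_formula(2,3)[of "One X" "\<epsilon>1 x" "Suc 0"] xH by simp_all
  define a b where "a = \<xi> \<Zcomp> Tar X \<zeta>" and "b = \<zeta> \<Zcomp> Tar X \<xi> \<Zcomp> flip X G"
  have a: "a \<in> Hom X G (Tob X (Tob X G))" and b: "b \<in> Hom X G (Tob X (Tob X G))"
    using \<xi> \<zeta> by (simp_all add: a_def b_def)
  have ap: "a \<Zcomp> proj X (Tob X G) = \<zeta>" "a \<Zcomp> Tar X (proj X G) = \<xi>"
    using \<xi> \<zeta> T\<zeta> Comp_eq_extend[of \<xi> "proj X G" "Id X G" "Id X G" \<zeta>] by (simp_all add: a_def)
  have bp: "b \<Zcomp> proj X (Tob X G) = \<zeta>" "b \<Zcomp> Tar X (proj X G) = \<xi>"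
    using \<xi> \<zeta> T\<xi> Comp_eq_extend[of \<zeta> "proj X G" "Id X G" "Id X G" \<xi>]
    by (simp_all add: b_def flip_proj flip_T_proj)
  define f where "f = tangent_sum X (Tob X G) a (b \<Zcomp> ?n)"
  have bn: "b \<Zcomp> ?n \<in> Hom X G (Tob X (Tob X G))" "(b \<Zcomp> ?n) \<Zcomp> proj X (Tob X G) = \<zeta>"
    using b n bp by simp_all
  have TG: "Tob X G \<in> Obj X" by simp
  have f: "f \<in> Hom X G (Tob X (Tob X G))" "f \<Zcomp> proj X (Tob X G) = \<zeta>"
    unfolding f_def using tangent_sum_Hom[OF TG a bn(1)] tangent_sum_proj[OF TG a bn(1)] ap bn by simp_all
  have uf: "u \<Zcomp> f = tangent_sum X (Tob X G) (u \<Zcomp> a) (u \<Zcomp> (b \<Zcomp> ?n))"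
    unfolding f_def by (rule tangent_sum_precomp[OF TG a bn(1), of _ "One X"]) (use ap bn in simp_all)
  \<comment> \<open>Since \<open>T(p)\<close> sends both terms to \<open>\<xi>\<close>, it sends their difference to zero; so the brace exists.\<close>
  have fT: "f \<Zcomp> Tar X (proj X G) = tzero X G"
  proof -
    have cancel: "tangent_sum X (Tob X G) b (b \<Zcomp> ?n) = b \<Zcomp> proj X (Tob X G) \<Zcomp> tzero X (Tob X G)"
    proof -
      interpret D: group "Gam (Suc (Suc 0)) G" by (rule Gam_group) simp
      let ?e = "b \<Zcomp> proj X (Tob X G) \<Zcomp> tzero X (Tob X G)"
      have c: "b \<in> carrier (Gam (Suc (Suc 0)) G)" "?e \<in> carrier (Gam (Suc (Suc 0)) G)" using b by simp_all
      have "tangent_sum X (Tob X G) b (b \<Zcomp> ?n)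
        = b \<otimes>\<^bsub>Gam (Suc (Suc 0)) G\<^esub> inv\<^bsub>Gam (Suc (Suc 0)) G\<^esub> ?e \<otimes>\<^bsub>Gam (Suc (Suc 0)) G\<^esub> (b \<Zcomp> ?n)"
        using sum_formula[of G b "Suc 0" "b \<Zcomp> ?n"] b bn bp by simp
      moreover have "b \<Zcomp> ?n = ?e \<otimes>\<^bsub>Gam (Suc (Suc 0)) G\<^esub> inv\<^bsub>Gam (Suc (Suc 0)) G\<^esub> b \<otimes>\<^bsub>Gam (Suc (Suc 0)) G\<^esub> ?e"
        using neg_formula(1)[of G b "Suc 0"] b by simp
      moreover have "b \<otimes>\<^bsub>Gam (Suc (Suc 0)) G\<^esub> inv\<^bsub>Gam (Suc (Suc 0)) G\<^esub> ?e \<otimes>\<^bsub>Gam (Suc (Suc 0)) G\<^esub>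
          (?e \<otimes>\<^bsub>Gam (Suc (Suc 0)) G\<^esub> inv\<^bsub>Gam (Suc (Suc 0)) G\<^esub> b \<otimes>\<^bsub>Gam (Suc (Suc 0)) G\<^esub> ?e) = ?e"
        using c by (simp only: D.m_assoc D.m_closed D.inv_closed D.inv_cancel)
      ultimately show ?thesis by (simp only:)
    qed
    have "f \<Zcomp> Tar X (proj X G) = tangent_sum X G (a \<Zcomp> Tar X (proj X G)) ((b \<Zcomp> ?n) \<Zcomp> Tar X (proj X G))"
      unfolding f_def by (rule tangent_sum_T[OF TG a bn(1)]) (use ap bn in simp_all)
    also have "a \<Zcomp> Tar X (proj X G) = b \<Zcomp> Tar X (proj X G)" using ap bp by simp
    also have "tangent_sum X G (b \<Zcomp> Tar X (proj X G)) ((b \<Zcomp> ?n) \<Zcomp> Tar X (proj X G))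
        = tangent_sum X (Tob X G) b (b \<Zcomp> ?n) \<Zcomp> Tar X (proj X G)"
      by (rule tangent_sum_T[OF TG b bn(1), symmetric]) (use bp bn in simp_all)
    also have "\<dots> = (b \<Zcomp> proj X (Tob X G)) \<Zcomp> (tzero X (Tob X G) \<Zcomp> Tar X (proj X G))"
      using b cancel by simp
    also have "\<dots> = tzero X G"
      using bp(1) \<zeta> tzero_nat[of "proj X G"] Comp_assoc_right[of \<zeta> "proj X G" "tzero X G"]
      by (simp del: Comp_assoc_right)
    finally show ?thesis .
  qed
  have br: "vf_bracket X G \<xi> \<zeta> = brace X G f"
    using \<xi> \<zeta> n by (simp add: vf_bracket_def f_def a_def b_def tangent_sum_def)
  have eqz: "f \<Zcomp> Tar X (proj X G) = f \<Zcomp> (Tar X (proj X G) \<Zcomp> proj X G \<Zcomp> tzero X G)"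
  proof -
    have "f \<Zcomp> (Tar X (proj X G) \<Zcomp> proj X G \<Zcomp> tzero X G) = (f \<Zcomp> Tar X (proj X G)) \<Zcomp> (proj X G \<Zcomp> tzero X G)"
      using f by simp
    also have "\<dots> = (tzero X G \<Zcomp> proj X G) \<Zcomp> tzero X G"
      unfolding fT by (rule Comp_assoc_right[symmetric]) simp_all
    also have "\<dots> = tzero X G" by (simp only: tzero_proj G_Obj) simp
    finally show ?thesis unfolding fT by simp
  qed
  note bp' = brace_props[OF G_Obj f(1) eqz]
  define g where "g = brace X G f"
  have g: "g \<in> Hom X G (Tob X G)" "g \<Zcomp> proj X G = Id X G"
    "f = bsum X (T_bundle X G) (g \<Zcomp> vlift X G) (\<zeta> \<Zcomp> tzero X (Tob X G))"
    using bp'(1,2) bp'(3)[unfolded f(2)] unfolding g_def f(2) \<zeta>(2) by simp_all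
  define h where "h = unit_bracket x y"
  have h: "h = u \<Zcomp> g" by (simp add: h_def unit_bracket_def br g_def flip: \<xi>_def \<zeta>_def)
  have hH: "h \<in> Hom X (One X) (Tob X G)" "h \<Zcomp> proj X G = u" using g(1,2) by (simp_all add: h)
  then have hL: "h \<in> unit_tangent" by (simp add: unit_tangent_iff)
  then show "unit_bracket x y \<in> unit_tangent" by (simp add: h_def)
  note \<epsilon>x = \<epsilon>_proj[OF x] and \<epsilon>y = \<epsilon>_proj[OF y] and \<epsilon>h = \<epsilon>_proj[OF hL]

  have ua: "u \<Zcomp> a = \<epsilon>1 x \<otimes>\<^bsub>\<Gamma>2\<^esub> \<epsilon>2 y"
    using element_T_translate[OF xH yH] \<xi> \<zeta>(1) Comp_assoc_right[of u \<xi> "Tar X \<zeta>"]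
    by (simp add: a_def flip: \<zeta>_def)
  have ub: "u \<Zcomp> b = \<epsilon>2 y \<otimes>\<^bsub>\<Gamma>2\<^esub> \<epsilon>1 x"
  proof -
    have "u \<Zcomp> b = ((u \<Zcomp> \<zeta>) \<Zcomp> Tar X \<xi>) \<Zcomp> flip X G" using \<xi>(1) \<zeta>(1) by (simp add: b_def)
    also have "(u \<Zcomp> \<zeta>) \<Zcomp> Tar X \<xi> = \<epsilon>1 y \<otimes>\<^bsub>\<Gamma>2\<^esub> \<epsilon>2 x"
      unfolding \<zeta>(3) \<xi>_def by (rule element_T_translate[OF yH xH])
    also have "(\<epsilon>1 y \<otimes>\<^bsub>\<Gamma>2\<^esub> \<epsilon>2 x) \<Zcomp> flip X G = (\<epsilon>1 y \<Zcomp> flip X G) \<otimes>\<^bsub>\<Gamma>2\<^esub> (\<epsilon>2 x \<Zcomp> flip X G)"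
      using hom_mult[OF flip_hom[of 0 "One X"] \<epsilon>y(1) \<epsilon>x(2)] by simp
    finally show ?thesis using flip_\<epsilon>[OF xH] flip_\<epsilon>[OF yH] by (simp only:)
  qed
  have upa: "(u \<Zcomp> a) \<Zcomp> proj X (Tob X G) = y" "(u \<Zcomp> b) \<Zcomp> proj X (Tob X G) = y"
    using a b ap bp \<zeta>(3) by simp_all
  have ubn: "u \<Zcomp> (b \<Zcomp> ?n) = \<epsilon>2 y \<otimes>\<^bsub>\<Gamma>2\<^esub> inv\<^bsub>\<Gamma>2\<^esub> (u \<Zcomp> b) \<otimes>\<^bsub>\<Gamma>2\<^esub> \<epsilon>2 y"
    using neg_formula(1)[of "One X" "u \<Zcomp> b" "Suc 0"] b n upa(2) by simp
  have uf1: "u \<Zcomp> f = (u \<Zcomp> a) \<otimes>\<^bsub>\<Gamma>2\<^esub> inv\<^bsub>\<Gamma>2\<^esub> \<epsilon>2 y \<otimes>\<^bsub>\<Gamma>2\<^esub> (u \<Zcomp> (b \<Zcomp> ?n))"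
  proof -
    have "(u \<Zcomp> (b \<Zcomp> ?n)) \<Zcomp> proj X (Tob X G) = y" using b n bn(2) \<zeta>(3) by simp
    then show ?thesis
      unfolding uf using sum_formula[of "One X" "u \<Zcomp> a" "Suc 0" "u \<Zcomp> (b \<Zcomp> ?n)"] a b n upa by simp
  qed
  have uf2: "u \<Zcomp> f = (h \<Zcomp> vlift X G) \<otimes>\<^bsub>\<Gamma>2\<^esub> \<epsilon>2 y"
  proof -
    let ?l = "g \<Zcomp> vlift X G" and ?z = "\<zeta> \<Zcomp> tzero X (Tob X G)"
    have lz: "?l \<in> Hom X G (Tob X (Tob X G))" "?z \<in> Hom X G (Tob X (Tob X G))" using g \<zeta> by simp_all
    \<comment> \<open>The flip turns the sum in \<open>T(p)\<close> into one in \<open>p\<^sub>T\<close>, whose values at the unit lie in the kernel.\<close>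
    have lzT: "?l \<Zcomp> Tar X (proj X G) = ?z \<Zcomp> Tar X (proj X G)"
      using g(1,2) \<zeta> tzero_nat[of "proj X G"] Comp_assoc_right[of \<zeta> "proj X G" "tzero X G"]
        Comp_assoc_right[of g "proj X G" "tzero X G"]
      by simp
    have fc: "f \<Zcomp> flip X G = tangent_sum X (Tob X G) (?l \<Zcomp> flip X G) (?z \<Zcomp> flip X G)"
      using T_bundle_sum(2)[OF G_Obj lz lzT] g(3) by simp
    have "(u \<Zcomp> f) \<Zcomp> flip X G = u \<Zcomp> tangent_sum X (Tob X G) (?l \<Zcomp> flip X G) (?z \<Zcomp> flip X G)"
      using f fc by simp
    also have "\<dots> = tangent_sum X (Tob X G) (u \<Zcomp> (?l \<Zcomp> flip X G)) (u \<Zcomp> (?z \<Zcomp> flip X G))"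
      by (rule tangent_sum_precomp[OF TG, of _ G])
        (use g(1) \<zeta>(1) lzT in \<open>simp_all add: flip_proj\<close>)
    also have "u \<Zcomp> (?l \<Zcomp> flip X G) = (h \<Zcomp> vlift X G) \<Zcomp> flip X G" using g(1) by (simp add: h)
    also have "\<dots> = h \<Zcomp> vlift X G" by (rule flip_\<epsilon>(3)[OF hH(1)])
    also have "u \<Zcomp> (?z \<Zcomp> flip X G) = \<epsilon>2 (u \<Zcomp> \<zeta>) \<Zcomp> flip X G" using \<zeta>(1) by simp
    also have "\<dots> = \<epsilon>1 y" unfolding \<zeta>(3) by (rule flip_\<epsilon>(2)[OF yH])
    also have "tangent_sum X (Tob X G) (h \<Zcomp> vlift X G) (\<epsilon>1 y) = (h \<Zcomp> vlift X G) \<otimes>\<^bsub>\<Gamma>2\<^esub> \<epsilon>1 y"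
      using sum_on_kernel[of "One X" "h \<Zcomp> vlift X G" "Suc 0" "\<epsilon>1 y"] \<epsilon>h \<epsilon>y by simp
    finally have "((u \<Zcomp> f) \<Zcomp> flip X G) \<Zcomp> flip X G = ((h \<Zcomp> vlift X G) \<otimes>\<^bsub>\<Gamma>2\<^esub> \<epsilon>1 y) \<Zcomp> flip X G"
      by (simp only:)
    also have "\<dots> = ((h \<Zcomp> vlift X G) \<Zcomp> flip X G) \<otimes>\<^bsub>\<Gamma>2\<^esub> (\<epsilon>1 y \<Zcomp> flip X G)"
      using hom_mult[OF flip_hom[of 0 "One X"] \<epsilon>h(3) \<epsilon>y(1)] by simp
    also have "\<dots> = (h \<Zcomp> vlift X G) \<otimes>\<^bsub>\<Gamma>2\<^esub> \<epsilon>2 y"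
      using flip_\<epsilon>[OF hH(1)] flip_\<epsilon>[OF yH] by (simp only:)
    finally show ?thesis using f(1) by (simp add: flip_flip)
  qed
  define E1 E2 hl where "E1 = \<epsilon>1 x" and "E2 = \<epsilon>2 y" and "hl = h \<Zcomp> vlift X G"
  have c: "E1 \<in> carrier \<Gamma>2" "E2 \<in> carrier \<Gamma>2" "hl \<in> carrier \<Gamma>2"
    unfolding E1_def E2_def hl_def by (fact \<epsilon>x \<epsilon>y \<epsilon>h)+
  have "hl \<otimes>\<^bsub>\<Gamma>2\<^esub> E2 = (E1 \<otimes>\<^bsub>\<Gamma>2\<^esub> E2) \<otimes>\<^bsub>\<Gamma>2\<^esub> inv\<^bsub>\<Gamma>2\<^esub> E2
      \<otimes>\<^bsub>\<Gamma>2\<^esub> (E2 \<otimes>\<^bsub>\<Gamma>2\<^esub> inv\<^bsub>\<Gamma>2\<^esub> (E2 \<otimes>\<^bsub>\<Gamma>2\<^esub> E1) \<otimes>\<^bsub>\<Gamma>2\<^esub> E2)"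
    using uf1 uf2 unfolding ua ub ubn E1_def E2_def hl_def by (simp only:)
  also have "\<dots> = (E1 \<otimes>\<^bsub>\<Gamma>2\<^esub> E2 \<otimes>\<^bsub>\<Gamma>2\<^esub> inv\<^bsub>\<Gamma>2\<^esub> E1 \<otimes>\<^bsub>\<Gamma>2\<^esub> inv\<^bsub>\<Gamma>2\<^esub> E2) \<otimes>\<^bsub>\<Gamma>2\<^esub> E2"
    using c by (simp only: \<Gamma>2.m_assoc \<Gamma>2.m_closed \<Gamma>2.inv_closed \<Gamma>2.inv_cancel \<Gamma>2.inv_mult_group)
  finally have "hl = E1 \<otimes>\<^bsub>\<Gamma>2\<^esub> E2 \<otimes>\<^bsub>\<Gamma>2\<^esub> inv\<^bsub>\<Gamma>2\<^esub> E1 \<otimes>\<^bsub>\<Gamma>2\<^esub> inv\<^bsub>\<Gamma>2\<^esub> E2"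
    using c by (simp only: \<Gamma>2.m_closed \<Gamma>2.inv_closed \<Gamma>2.right_cancel)
  then show "unit_bracket x y \<Zcomp> vlift X G = group_commutator \<Gamma>2 (\<epsilon>1 x) (\<epsilon>2 y)"
    unfolding E1_def E2_def hl_def h_def group_commutator_def .
qed

end

section \<open>Bilinearity, antisymmetry and the Jacobi identity\<close>

context tangent_group
begin

lemma group_Gam_One: "group (Gam n (One X))"
  by (rule Gam_group) simp

lemmas unit_bracket_in [simp] = unit_bracket_commutator(1)
lemmas vlift_unit_bracket = unit_bracket_commutator(2)

lemma unit_tangent_carrier: "x \<in> unit_tangent \<Longrightarrow> x \<in> carrier \<Gamma>1"
  by (simp add: unit_tangent_iff)

lemma unit_tangent_Hom: "x \<in> unit_tangent \<Longrightarrow> x \<in> Hom X (One X) (Tob X G)"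
  by (simp add: unit_tangent_iff)

lemma unit_tangent_subgroup: "subgroup unit_tangent \<Gamma>1"
proof -
  interpret \<Gamma>0: group "Gam 0 (One X)" by (rule group_Gam_One)
  interpret \<Gamma>1: group \<Gamma>1 by (rule group_Gam_One)
  have one: "\<one>\<^bsub>\<Gamma>1\<^esub> \<Zcomp> proj X G = u"
    using Gam_hom_one[OF proj_hom[of 0 "One X"]] by (simp add: one_unit)
  have uu: "u \<otimes>\<^bsub>Gam 0 (One X)\<^esub> u = u" "inv\<^bsub>Gam 0 (One X)\<^esub> u = u"
    using \<Gamma>0.l_one[OF \<Gamma>0.one_closed] \<Gamma>0.inv_one by (simp_all only: one_unit)
  show ?thesis
  proof (rule \<Gamma>1.subgroupI)
    show "unit_tangent \<subseteq> carrier \<Gamma>1" using unit_tangent_carrier by blast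
    show "unit_tangent \<noteq> {}" using one \<Gamma>1.one_closed by (auto simp: unit_tangent_def)
    show "inv\<^bsub>\<Gamma>1\<^esub> x \<in> unit_tangent" if x: "x \<in> unit_tangent" for x
      using Gam_hom_inv[OF proj_hom[of 0 "One X"], of x] \<Gamma>1.inv_closed[of x] x uu
      by (simp add: unit_tangent_iff)
    show "x \<otimes>\<^bsub>\<Gamma>1\<^esub> y \<in> unit_tangent" if x: "x \<in> unit_tangent" and y: "y \<in> unit_tangent" for x y
      using hom_mult[OF proj_hom[of 0 "One X"], of x y] \<Gamma>1.m_closed[of x y] x y uu
      by (simp add: unit_tangent_iff)
  qed
qed

lemma unit_tangent_commute:
  "\<lbrakk>x \<in> unit_tangent; y \<in> unit_tangent\<rbrakk> \<Longrightarrow> x \<otimes>\<^bsub>\<Gamma>1\<^esub> y = y \<otimes>\<^bsub>\<Gamma>1\<^esub> x"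
  using kernel_commute[of "One X" x 0 y] by (simp add: unit_tangent_iff one_unit)

lemma vlift_inj:
  "\<lbrakk>x \<in> unit_tangent; y \<in> unit_tangent; x \<Zcomp> vlift X G = y \<Zcomp> vlift X G\<rbrakk> \<Longrightarrow> x = y"
  using vlift_mono[of G x "One X" y] by (simp add: unit_tangent_iff)

text \<open>The flip fixes lifted vectors and exchanges \<open>\<epsilon>1\<close> and \<open>\<epsilon>2\<close>, so it turns the commutator for \<open>[x, y]\<close>
into the inverse of the commutator for \<open>[y, x]\<close>.\<close>
lemma unit_bracket_antisym:
  assumes x: "x \<in> unit_tangent" and y: "y \<in> unit_tangent"
  shows "unit_bracket x y = inv\<^bsub>\<Gamma>1\<^esub> (unit_bracket y x)"
proof -
  interpret \<Gamma>2: group \<Gamma>2 by (rule group_Gam_One)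
  have "(unit_bracket x y \<Zcomp> vlift X G) \<Zcomp> flip X G
      = group_commutator \<Gamma>2 (\<epsilon>1 x) (\<epsilon>2 y) \<Zcomp> flip X G"
    using vlift_unit_bracket[OF x y] by simp
  also have "\<dots> = group_commutator \<Gamma>2 (\<epsilon>1 x \<Zcomp> flip X G) (\<epsilon>2 y \<Zcomp> flip X G)"
    using hom_commutator[OF group_Gam_One group_Gam_One flip_hom[of 0] \<epsilon>_proj(1)[OF x] \<epsilon>_proj(2)[OF y]] by simp
  also have "\<dots> = group_commutator \<Gamma>2 (\<epsilon>2 x) (\<epsilon>1 y)"
    using flip_\<epsilon> unit_tangent_Hom x y by (simp only:)
  also have "\<dots> = inv\<^bsub>\<Gamma>2\<^esub> (unit_bracket y x \<Zcomp> vlift X G)"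
    using vlift_unit_bracket[OF y x] \<Gamma>2.inv_commutator \<epsilon>_proj(1)[OF y] \<epsilon>_proj(2)[OF x] by simp
  also have "\<dots> = inv\<^bsub>\<Gamma>1\<^esub> (unit_bracket y x) \<Zcomp> vlift X G"
    using Gam_hom_inv[OF vlift_hom[of 0] _ _ unit_tangent_carrier[OF unit_bracket_in[OF y x]]] by simp
  finally have "unit_bracket x y \<Zcomp> vlift X G = inv\<^bsub>\<Gamma>1\<^esub> (unit_bracket y x) \<Zcomp> vlift X G"
    using flip_\<epsilon>(3)[OF unit_tangent_Hom[OF unit_bracket_in[OF x y]]] by (simp only:)
  then show ?thesis
    using vlift_inj x y subgroup.m_inv_closed[OF unit_tangent_subgroup] by simp
qed

text \<open>Commutators are additive in the first argument up to conjugation by \<open>\<epsilon>1 x\<close>, and this conjugation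
is trivial on lifted vectors because both lie in the kernel of \<open>p\<close>.\<close>
lemma unit_bracket_add_left:
  assumes x: "x \<in> unit_tangent" and x': "x' \<in> unit_tangent" and y: "y \<in> unit_tangent"
  shows "unit_bracket (x \<otimes>\<^bsub>\<Gamma>1\<^esub> x') y = unit_bracket x y \<otimes>\<^bsub>\<Gamma>1\<^esub> unit_bracket x' y"
proof -
  interpret \<Gamma>2: group \<Gamma>2 by (rule group_Gam_One)
  note closed = subgroup.m_closed[OF unit_tangent_subgroup]
  let ?a = "\<epsilon>1 x" and ?a' = "\<epsilon>1 x'" and ?b = "\<epsilon>2 y"
  note c = \<epsilon>_proj(1)[OF x] \<epsilon>_proj(1)[OF x'] \<epsilon>_proj(2)[OF y]
  have "\<epsilon>1 (x \<otimes>\<^bsub>\<Gamma>1\<^esub> x') = ?a \<otimes>\<^bsub>\<Gamma>2\<^esub> ?a'"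
    using hom_mult[OF T_tzero_hom[of 0 "One X"], of x x'] unit_tangent_carrier x x' by simp
  then have "unit_bracket (x \<otimes>\<^bsub>\<Gamma>1\<^esub> x') y \<Zcomp> vlift X G = group_commutator \<Gamma>2 (?a \<otimes>\<^bsub>\<Gamma>2\<^esub> ?a') ?b"
    using vlift_unit_bracket[OF closed[OF x x'] y] by (simp only:)
  also have "\<dots> = group_commutator \<Gamma>2 ?a' ?b \<otimes>\<^bsub>\<Gamma>2\<^esub> group_commutator \<Gamma>2 ?a ?b"
  proof (rule \<Gamma>2.commutator_mult_left[OF c])
    note w = unit_bracket_in[OF x' y]
    show "?a \<otimes>\<^bsub>\<Gamma>2\<^esub> group_commutator \<Gamma>2 ?a' ?b = group_commutator \<Gamma>2 ?a' ?b \<otimes>\<^bsub>\<Gamma>2\<^esub> ?a"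
      unfolding vlift_unit_bracket[OF x' y, symmetric]
      using kernel_commute[of "One X" ?a "Suc 0" "unit_bracket x' y \<Zcomp> vlift X G"]
        \<epsilon>_proj(1,4)[OF x] \<epsilon>_proj(3,6)[OF w] by simp
  qed
  also have "\<dots> = (unit_bracket x' y \<otimes>\<^bsub>\<Gamma>1\<^esub> unit_bracket x y) \<Zcomp> vlift X G"
    unfolding vlift_unit_bracket[OF x y, symmetric] vlift_unit_bracket[OF x' y, symmetric]
    using hom_mult[OF vlift_hom[of 0 "One X"], of "unit_bracket x' y" "unit_bracket x y"]
      unit_tangent_carrier unit_bracket_in x x' y by simp
  finally have "unit_bracket (x \<otimes>\<^bsub>\<Gamma>1\<^esub> x') y = unit_bracket x' y \<otimes>\<^bsub>\<Gamma>1\<^esub> unit_bracket x y"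
    using vlift_inj x x' y closed by simp
  then show ?thesis using unit_tangent_commute x x' y by simp
qed

text \<open>The three ways of inserting a zero direction into \<open>T\<^sup>2(G)\<close>. Placing \<open>x\<close>, \<open>y\<close>, \<open>z\<close> in the three
directions of \<open>T\<^sup>3(G)\<close> gives \<open>\<delta>2 (\<epsilon>1 x)\<close>, \<open>\<delta>1 (\<epsilon>1 y)\<close> and \<open>\<delta>1 (\<epsilon>2 z)\<close>, where \<open>\<delta>\<epsilon>\<close> records the other
descriptions of these elements. For \<open>x\<close> and \<open>y\<close>, \<open>x\<close> and \<open>z\<close>, \<open>y\<close> and \<open>z\<close>, the missing third
direction is inserted by \<open>\<delta>3\<close>, \<open>\<delta>2\<close> and \<open>\<delta>1\<close> respectively.\<close>
abbreviation \<delta>1 :: "'a \<Rightarrow> 'a" where "\<delta>1 t \<equiv> t \<Zcomp> tzero X (Tob X (Tob X G))"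
abbreviation \<delta>2 :: "'a \<Rightarrow> 'a" where "\<delta>2 t \<equiv> t \<Zcomp> Tar X (tzero X (Tob X G))"
abbreviation \<delta>3 :: "'a \<Rightarrow> 'a" where "\<delta>3 t \<equiv> t \<Zcomp> Tar X (Tar X (tzero X G))"
abbreviation lift2 :: "'a \<Rightarrow> 'a" where "lift2 w \<equiv> w \<Zcomp> vlift X G"
abbreviation lift3 :: "'a \<Rightarrow> 'a" where "lift3 w \<equiv> w \<Zcomp> vlift X G \<Zcomp> vlift X (Tob X G)"

lemma \<delta>_hom: "\<delta>1 \<in> hom \<Gamma>2 \<Gamma>3" "\<delta>2 \<in> hom \<Gamma>2 \<Gamma>3" "\<delta>3 \<in> hom \<Gamma>2 \<Gamma>3"
  using tzero_hom[of "Suc (Suc 0)" "One X"] T_tzero_hom[of "Suc 0" "One X"] TT_tzero_hom[of 0 "One X"]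
  by simp_all

lemma \<delta>\<epsilon>:
  assumes x: "x \<in> Hom X (One X) (Tob X G)"
  shows "\<delta>3 (\<epsilon>1 x) = \<delta>2 (\<epsilon>1 x)" "\<delta>3 (\<epsilon>2 x) = \<delta>1 (\<epsilon>1 x)" "\<delta>2 (\<epsilon>2 x) = \<delta>1 (\<epsilon>2 x)"
proof -
  have "tzero X G \<Zcomp> tzero X (Tob X G) = tzero X G \<Zcomp> Tar X (tzero X G)"
    using tzero_nat[of "tzero X G"] by simp
  then have "Tar X (tzero X G) \<Zcomp> Tar X (tzero X (Tob X G)) = Tar X (tzero X G) \<Zcomp> Tar X (Tar X (tzero X G))"
    by (simp add: Tar_Comp_arr[symmetric])
  then show "\<delta>3 (\<epsilon>1 x) = \<delta>2 (\<epsilon>1 x)" using x by simp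
  show "\<delta>3 (\<epsilon>2 x) = \<delta>1 (\<epsilon>1 x)" "\<delta>2 (\<epsilon>2 x) = \<delta>1 (\<epsilon>2 x)"
    using x tzero_nat[of "Tar X (tzero X G)"] tzero_nat[of "tzero X (Tob X G)"] by simp_all
qed

text \<open>The two flips transpose adjacent directions of \<open>T\<^sup>3(G)\<close>: \<open>c\<^sub>T\<close> exchanges the first two and \<open>T(c)\<close> the last
two. The doubly lifted vectors involve all directions symmetrically.\<close>
lemma flip_\<delta>:
  assumes w: "w \<in> Hom X (One X) (Tob X G)"
  shows "\<delta>3 (lift2 w) \<Zcomp> flip X (Tob X G) = \<delta>3 (lift2 w)"
    "\<delta>2 (lift2 w) \<Zcomp> flip X (Tob X G) = \<delta>1 (lift2 w)"
    "lift3 w \<Zcomp> flip X (Tob X G) = lift3 w"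
    "\<delta>3 (lift2 w) \<Zcomp> Tar X (flip X G) = \<delta>2 (lift2 w)"
    "\<delta>1 (lift2 w) \<Zcomp> Tar X (flip X G) = \<delta>1 (lift2 w)"
proof -
  have f3: "Tar X (Tar X (tzero X G)) \<Zcomp> flip X (Tob X G) = flip X G \<Zcomp> Tar X (Tar X (tzero X G))"
    using natural_eq[OF flip_natural, of "tzero X G"] by simp
  have lf: "vlift X G \<Zcomp> (flip X G \<Zcomp> h) = vlift X G \<Zcomp> h" if "h \<in> Arr X" "Dom X h = Tob X (Tob X G)" for h
    using Comp_assoc_right[of "vlift X G" "flip X G" h] that vlift_flip[of G] by (simp del: Comp_assoc_right)
  show "\<delta>3 (lift2 w) \<Zcomp> flip X (Tob X G) = \<delta>3 (lift2 w)" using w by (simp add: f3 lf)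
  show "\<delta>2 (lift2 w) \<Zcomp> flip X (Tob X G) = \<delta>1 (lift2 w)" using w by (simp add: T_tzero_flip)
  show "lift3 w \<Zcomp> flip X (Tob X G) = lift3 w" using w by (simp add: vlift_flip)
  have "Tar X (Tar X (tzero X G)) \<Zcomp> Tar X (flip X G) = Tar X (tzero X (Tob X G))"
    by (simp add: Tar_Comp_arr[symmetric] T_tzero_flip)
  then show "\<delta>3 (lift2 w) \<Zcomp> Tar X (flip X G) = \<delta>2 (lift2 w)" using w by simp
  have "tzero X (Tob X (Tob X G)) \<Zcomp> Tar X (flip X G) = flip X G \<Zcomp> tzero X (Tob X (Tob X G))"
    using tzero_nat[of "flip X G"] by simp
  then show "\<delta>1 (lift2 w) \<Zcomp> Tar X (flip X G) = \<delta>1 (lift2 w)" using w by (simp add: lf)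
qed

lemma \<delta>_kernel:
  assumes w: "w \<in> unit_tangent"
  shows "\<delta>3 (lift2 w) \<in> carrier \<Gamma>3" "\<delta>2 (lift2 w) \<in> carrier \<Gamma>3" "\<delta>1 (lift2 w) \<in> carrier \<Gamma>3" "lift3 w \<in> carrier \<Gamma>3"
    "\<delta>3 (lift2 w) \<Zcomp> proj X (Tob X (Tob X G)) = \<one>\<^bsub>\<Gamma>2\<^esub>"
    "\<delta>2 (lift2 w) \<Zcomp> proj X (Tob X (Tob X G)) = \<one>\<^bsub>\<Gamma>2\<^esub>"
    "lift3 w \<Zcomp> proj X (Tob X (Tob X G)) = \<one>\<^bsub>\<Gamma>2\<^esub>"
proof -
  have wH: "w \<in> Hom X (One X) (Tob X G)" using unit_tangent_Hom[OF w] .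
  then show "\<delta>3 (lift2 w) \<in> carrier \<Gamma>3" "\<delta>2 (lift2 w) \<in> carrier \<Gamma>3" "\<delta>1 (lift2 w) \<in> carrier \<Gamma>3" "lift3 w \<in> carrier \<Gamma>3"
    by simp_all
  have one: "\<one>\<^bsub>\<Gamma>1\<^esub> \<Zcomp> Tar X (tzero X G) = \<one>\<^bsub>\<Gamma>2\<^esub>" "\<one>\<^bsub>\<Gamma>1\<^esub> \<Zcomp> tzero X (Tob X G) = \<one>\<^bsub>\<Gamma>2\<^esub>"
    using Gam_hom_one[OF T_tzero_hom[of 0 "One X"]] Gam_hom_one[OF tzero_hom[of "Suc 0" "One X"]] by simp_all
  note k = \<epsilon>_proj(6)[OF w]
  have "\<delta>3 (lift2 w) \<Zcomp> proj X (Tob X (Tob X G)) = (lift2 w \<Zcomp> proj X (Tob X G)) \<Zcomp> Tar X (tzero X G)"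
    using wH proj_nat[of "Tar X (tzero X G)"] by simp
  then show "\<delta>3 (lift2 w) \<Zcomp> proj X (Tob X (Tob X G)) = \<one>\<^bsub>\<Gamma>2\<^esub>" unfolding k one .
  have z: "\<delta>2 t \<Zcomp> proj X (Tob X (Tob X G)) = (t \<Zcomp> proj X (Tob X G)) \<Zcomp> tzero X (Tob X G)"
    and l: "(t \<Zcomp> vlift X (Tob X G)) \<Zcomp> proj X (Tob X (Tob X G)) = (t \<Zcomp> proj X (Tob X G)) \<Zcomp> tzero X (Tob X G)"
    if "t \<in> Hom X (One X) (Tob X (Tob X G))" for t
    using that by (simp_all add: T_tzero_proj vlift_proj)
  have lw: "lift2 w \<in> Hom X (One X) (Tob X (Tob X G))" using wH by simp
  show "\<delta>2 (lift2 w) \<Zcomp> proj X (Tob X (Tob X G)) = \<one>\<^bsub>\<Gamma>2\<^esub>"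
    "lift3 w \<Zcomp> proj X (Tob X (Tob X G)) = \<one>\<^bsub>\<Gamma>2\<^esub>"
    unfolding z[OF lw] l[OF lw] k one by (rule refl)+
qed

lemma hom_commute:
  assumes "\<phi> \<in> hom \<Gamma>3 \<Gamma>3" "s \<in> carrier \<Gamma>3" "t \<in> carrier \<Gamma>3" "s \<otimes>\<^bsub>\<Gamma>3\<^esub> t = t \<otimes>\<^bsub>\<Gamma>3\<^esub> s"
  shows "\<phi> s \<otimes>\<^bsub>\<Gamma>3\<^esub> \<phi> t = \<phi> t \<otimes>\<^bsub>\<Gamma>3\<^esub> \<phi> s"
  by (simp only: hom_mult[OF assms(1,2,3), symmetric] hom_mult[OF assms(1,3,2), symmetric] assms(4))

text \<open>Elements of the kernel of \<open>p\<close> commute. The pairs that do not both lie in this kernel are obtained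
from ones that do by transposing directions.\<close>
lemma \<delta>_commute:
  assumes v: "v \<in> unit_tangent" and w: "w \<in> unit_tangent"
  shows "\<delta>3 (lift2 v) \<otimes>\<^bsub>\<Gamma>3\<^esub> \<delta>2 (lift2 w) = \<delta>2 (lift2 w) \<otimes>\<^bsub>\<Gamma>3\<^esub> \<delta>3 (lift2 v)"
    and "\<delta>3 (lift2 v) \<otimes>\<^bsub>\<Gamma>3\<^esub> \<delta>1 (lift2 w) = \<delta>1 (lift2 w) \<otimes>\<^bsub>\<Gamma>3\<^esub> \<delta>3 (lift2 v)"
    and "\<delta>2 (lift2 v) \<otimes>\<^bsub>\<Gamma>3\<^esub> \<delta>1 (lift2 w) = \<delta>1 (lift2 w) \<otimes>\<^bsub>\<Gamma>3\<^esub> \<delta>2 (lift2 v)"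
    and "lift3 v \<otimes>\<^bsub>\<Gamma>3\<^esub> \<delta>3 (lift2 w) = \<delta>3 (lift2 w) \<otimes>\<^bsub>\<Gamma>3\<^esub> lift3 v"
    and "lift3 v \<otimes>\<^bsub>\<Gamma>3\<^esub> \<delta>2 (lift2 w) = \<delta>2 (lift2 w) \<otimes>\<^bsub>\<Gamma>3\<^esub> lift3 v"
    and "lift3 v \<otimes>\<^bsub>\<Gamma>3\<^esub> \<delta>1 (lift2 w) = \<delta>1 (lift2 w) \<otimes>\<^bsub>\<Gamma>3\<^esub> lift3 v"
proof -
  note vH = unit_tangent_Hom[OF v] and wH = unit_tangent_Hom[OF w]
  note kv = \<delta>_kernel[OF v] and kw = \<delta>_kernel[OF w]
  have ker: "s \<otimes>\<^bsub>\<Gamma>3\<^esub> t = t \<otimes>\<^bsub>\<Gamma>3\<^esub> s"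
    if "s \<in> carrier \<Gamma>3" "t \<in> carrier \<Gamma>3"
      "s \<Zcomp> proj X (Tob X (Tob X G)) = \<one>\<^bsub>\<Gamma>2\<^esub>" "t \<Zcomp> proj X (Tob X (Tob X G)) = \<one>\<^bsub>\<Gamma>2\<^esub>" for s t
    using kernel_commute[of "One X" s "Suc (Suc 0)" t] that by simp
  have fl: "(\<lambda>t. t \<Zcomp> flip X (Tob X G)) \<in> hom \<Gamma>3 \<Gamma>3" "(\<lambda>t. t \<Zcomp> Tar X (flip X G)) \<in> hom \<Gamma>3 \<Gamma>3"
    using flip_hom[of "Suc 0" "One X"] T_flip_hom[of 0 "One X"] by simp_all
  show 32: "\<delta>3 (lift2 v) \<otimes>\<^bsub>\<Gamma>3\<^esub> \<delta>2 (lift2 w) = \<delta>2 (lift2 w) \<otimes>\<^bsub>\<Gamma>3\<^esub> \<delta>3 (lift2 v)"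
    by (rule ker) (fact kv kw)+
  show "lift3 v \<otimes>\<^bsub>\<Gamma>3\<^esub> \<delta>3 (lift2 w) = \<delta>3 (lift2 w) \<otimes>\<^bsub>\<Gamma>3\<^esub> lift3 v"
    by (rule ker) (fact kv kw)+
  show l2: "lift3 v \<otimes>\<^bsub>\<Gamma>3\<^esub> \<delta>2 (lift2 w) = \<delta>2 (lift2 w) \<otimes>\<^bsub>\<Gamma>3\<^esub> lift3 v"
    by (rule ker) (fact kv kw)+
  show 31: "\<delta>3 (lift2 v) \<otimes>\<^bsub>\<Gamma>3\<^esub> \<delta>1 (lift2 w) = \<delta>1 (lift2 w) \<otimes>\<^bsub>\<Gamma>3\<^esub> \<delta>3 (lift2 v)"
    using hom_commute[OF fl(1) kv(1) kw(2) 32] unfolding flip_\<delta>[OF vH] flip_\<delta>[OF wH] .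
  show "lift3 v \<otimes>\<^bsub>\<Gamma>3\<^esub> \<delta>1 (lift2 w) = \<delta>1 (lift2 w) \<otimes>\<^bsub>\<Gamma>3\<^esub> lift3 v"
    using hom_commute[OF fl(1) kv(4) kw(2) l2] unfolding flip_\<delta>[OF vH] flip_\<delta>[OF wH] .
  show "\<delta>2 (lift2 v) \<otimes>\<^bsub>\<Gamma>3\<^esub> \<delta>1 (lift2 w) = \<delta>1 (lift2 w) \<otimes>\<^bsub>\<Gamma>3\<^esub> \<delta>2 (lift2 v)"
    using hom_commute[OF fl(2) kv(1) kw(3) 31] unfolding flip_\<delta>[OF vH] flip_\<delta>[OF wH] .
qed

lemma \<delta>_bracket:
  assumes x: "x \<in> unit_tangent" and y: "y \<in> unit_tangent"
  shows "\<delta>3 (lift2 (unit_bracket x y)) = group_commutator \<Gamma>3 (\<delta>2 (\<epsilon>1 x)) (\<delta>1 (\<epsilon>1 y))"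
    "\<delta>2 (lift2 (unit_bracket x y)) = group_commutator \<Gamma>3 (\<delta>2 (\<epsilon>1 x)) (\<delta>1 (\<epsilon>2 y))"
    "\<delta>1 (lift2 (unit_bracket x y)) = group_commutator \<Gamma>3 (\<delta>1 (\<epsilon>1 x)) (\<delta>1 (\<epsilon>2 y))"
proof -
  note xH = unit_tangent_Hom[OF x] and yH = unit_tangent_Hom[OF y]
  note h = hom_commutator[OF group_Gam_One group_Gam_One _ \<epsilon>_proj(1)[OF x] \<epsilon>_proj(2)[OF y]]
  show "\<delta>3 (lift2 (unit_bracket x y)) = group_commutator \<Gamma>3 (\<delta>2 (\<epsilon>1 x)) (\<delta>1 (\<epsilon>1 y))"
    unfolding vlift_unit_bracket[OF x y] using h[OF \<delta>_hom(3)] unfolding \<delta>\<epsilon>[OF xH] \<delta>\<epsilon>[OF yH] .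
  show "\<delta>2 (lift2 (unit_bracket x y)) = group_commutator \<Gamma>3 (\<delta>2 (\<epsilon>1 x)) (\<delta>1 (\<epsilon>2 y))"
    unfolding vlift_unit_bracket[OF x y] using h[OF \<delta>_hom(2)] unfolding \<delta>\<epsilon>[OF yH] .
  show "\<delta>1 (lift2 (unit_bracket x y)) = group_commutator \<Gamma>3 (\<delta>1 (\<epsilon>1 x)) (\<delta>1 (\<epsilon>2 y))"
    unfolding vlift_unit_bracket[OF x y] by (rule h[OF \<delta>_hom(1)])
qed

text \<open>Every equation arises by mapping the commutator formula in \<open>T\<^sup>2(G)\<close> to \<open>T\<^sup>3(G)\<close> along a homomorphism
that doubles one direction: \<open>T(\<ell>)\<close> for the first, \<open>T(\<ell>) c\<^sub>T\<close> for the second and \<open>\<ell>\<^sub>T\<close> for the third.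
They agree after \<open>\<ell>\<close>, which is why the left-hand sides involve the same map \<open>lift3\<close>.\<close>
lemma iterated_bracket:
  assumes x: "x \<in> unit_tangent" and w: "w \<in> unit_tangent"
  shows "lift3 (unit_bracket x w) = group_commutator \<Gamma>3 (\<delta>2 (\<epsilon>1 x)) (\<delta>1 (lift2 w))"
    "lift3 (unit_bracket x w) = group_commutator \<Gamma>3 (\<delta>1 (\<epsilon>1 x)) (\<delta>2 (lift2 w))"
    "lift3 (unit_bracket w x) = group_commutator \<Gamma>3 (\<delta>3 (lift2 w)) (\<delta>1 (\<epsilon>2 x))"
proof -
  note xH = unit_tangent_Hom[OF x] and wH = unit_tangent_Hom[OF w]
  have h1: "(\<lambda>t. t \<Zcomp> Tar X (vlift X G)) \<in> hom \<Gamma>2 \<Gamma>3"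
    and h2: "(\<lambda>t. t \<Zcomp> vlift X (Tob X G)) \<in> hom \<Gamma>2 \<Gamma>3"
    and fl: "(\<lambda>t. t \<Zcomp> flip X (Tob X G)) \<in> hom \<Gamma>3 \<Gamma>3"
    using T_vlift_hom[of 0 "One X"] vlift_hom[of "Suc 0" "One X"] flip_hom[of "Suc 0" "One X"] by simp_all
  have lam: "lift3 v = lift2 v \<Zcomp> Tar X (vlift X G)" if "v \<in> Hom X (One X) (Tob X G)" for v
    using that vlift_vlift[of G] by simp
  have "Tar X (tzero X G \<Zcomp> vlift X G) = Tar X (tzero X G \<Zcomp> Tar X (tzero X G))" by (simp add: tzero_vlift)
  then have "Tar X (tzero X G) \<Zcomp> Tar X (vlift X G) = Tar X (tzero X G) \<Zcomp> Tar X (Tar X (tzero X G))"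
    by (simp add: Tar_Comp_arr)
  then have e1: "\<epsilon>1 x \<Zcomp> Tar X (vlift X G) = \<delta>2 (\<epsilon>1 x)" using xH \<delta>\<epsilon>(1)[OF xH] by simp
  have e2: "\<epsilon>2 w \<Zcomp> Tar X (vlift X G) = \<delta>1 (lift2 w)" using wH tzero_nat[of "vlift X G"] by simp
  have bH: "unit_bracket x w \<in> Hom X (One X) (Tob X G)" "unit_bracket w x \<in> Hom X (One X) (Tob X G)"
    using unit_tangent_Hom unit_bracket_in x w by blast+
  show 1: "lift3 (unit_bracket x w) = group_commutator \<Gamma>3 (\<delta>2 (\<epsilon>1 x)) (\<delta>1 (lift2 w))"
    unfolding lam[OF bH(1)] unfolding vlift_unit_bracket[OF x w]
    using hom_commutator[OF group_Gam_One group_Gam_One h1 \<epsilon>_proj(1)[OF x] \<epsilon>_proj(2)[OF w]]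
    unfolding e1 e2 .
  have "lift3 (unit_bracket x w) \<Zcomp> flip X (Tob X G)
    = group_commutator \<Gamma>3 (\<delta>2 (\<epsilon>1 x) \<Zcomp> flip X (Tob X G)) (\<delta>1 (lift2 w) \<Zcomp> flip X (Tob X G))"
    unfolding 1 by (rule hom_commutator[OF group_Gam_One group_Gam_One fl]) (use xH wH in simp_all)
  moreover have "\<delta>2 (\<epsilon>1 x) \<Zcomp> flip X (Tob X G) = \<delta>1 (\<epsilon>1 x)" "\<delta>1 (lift2 w) \<Zcomp> flip X (Tob X G) = \<delta>2 (lift2 w)"
    using xH wH by (simp_all add: T_tzero_flip tzero_flip)
  ultimately show "lift3 (unit_bracket x w) = group_commutator \<Gamma>3 (\<delta>1 (\<epsilon>1 x)) (\<delta>2 (lift2 w))"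
    unfolding flip_\<delta>(3)[OF bH(1)] by (simp only:)
  have e3: "\<epsilon>1 w \<Zcomp> vlift X (Tob X G) = \<delta>3 (lift2 w)"
    using wH natural_eq[OF vlift_natural, of "tzero X G"] by simp
  have e4: "\<epsilon>2 x \<Zcomp> vlift X (Tob X G) = \<delta>1 (\<epsilon>2 x)"
    using xH tzero_vlift[of "Tob X G"] \<delta>\<epsilon>(3)[OF xH] by simp
  show "lift3 (unit_bracket w x) = group_commutator \<Gamma>3 (\<delta>3 (lift2 w)) (\<delta>1 (\<epsilon>2 x))"
    unfolding vlift_unit_bracket[OF w x]
    using hom_commutator[OF group_Gam_One group_Gam_One h2 \<epsilon>_proj(1)[OF w] \<epsilon>_proj(2)[OF x]]
    unfolding e3 e4 .
qed

lemma lift3_hom: "lift3 \<in> hom \<Gamma>1 \<Gamma>3"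
  using hom_compose[OF vlift_hom[of 0 "One X"] vlift_hom[of "Suc 0" "One X"]] by (simp add: comp_def)

lemma lift3_inj:
  assumes "v \<in> unit_tangent" "w \<in> unit_tangent" "lift3 v = lift3 w"
  shows "v = w"
proof -
  have "lift2 v = lift2 w"
    using assms vlift_mono[of "Tob X G" "lift2 v" "One X" "lift2 w"] unit_tangent_Hom by simp
  then show ?thesis using assms vlift_inj by blast
qed

lemma unit_bracket_inv_right:
  assumes x: "x \<in> unit_tangent" and y: "y \<in> unit_tangent"
  shows "unit_bracket x (inv\<^bsub>\<Gamma>1\<^esub> y) = inv\<^bsub>\<Gamma>1\<^esub> (unit_bracket x y)"
proof -
  interpret \<Gamma>1: group \<Gamma>1 by (rule group_Gam_One)
  note inv = subgroup.m_inv_closed[OF unit_tangent_subgroup]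
  have y': "inv\<^bsub>\<Gamma>1\<^esub> y \<in> unit_tangent" by (rule inv[OF y])
  have one: "\<one>\<^bsub>\<Gamma>1\<^esub> \<in> unit_tangent" by (rule subgroup.one_closed[OF unit_tangent_subgroup])
  have "unit_bracket \<one>\<^bsub>\<Gamma>1\<^esub> x = unit_bracket \<one>\<^bsub>\<Gamma>1\<^esub> x \<otimes>\<^bsub>\<Gamma>1\<^esub> unit_bracket \<one>\<^bsub>\<Gamma>1\<^esub> x"
    using unit_bracket_add_left[OF one one x] by (simp only: \<Gamma>1.l_one \<Gamma>1.one_closed)
  then have "unit_bracket \<one>\<^bsub>\<Gamma>1\<^esub> x = \<one>\<^bsub>\<Gamma>1\<^esub>"
    using unit_tangent_carrier[OF unit_bracket_in[OF one x]] by (metis \<Gamma>1.r_cancel_one)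
  then have "unit_bracket (inv\<^bsub>\<Gamma>1\<^esub> y) x \<otimes>\<^bsub>\<Gamma>1\<^esub> unit_bracket y x = \<one>\<^bsub>\<Gamma>1\<^esub>"
    using unit_bracket_add_left[OF y' y x] unit_tangent_carrier[OF y] by simp
  then have "unit_bracket (inv\<^bsub>\<Gamma>1\<^esub> y) x = inv\<^bsub>\<Gamma>1\<^esub> (unit_bracket y x)"
    using unit_tangent_carrier unit_bracket_in x y y' by (metis \<Gamma>1.inv_equality)
  then show ?thesis
    using unit_bracket_antisym[OF x y'] unit_bracket_antisym[OF x y] by simp
qed

text \<open>The commutator identity gives \<open>[x,[y,z]] + [z,[x,y]] = [y,[x,z]]\<close>, all terms being read off from the
same iterated lift.\<close>
lemma unit_bracket_jacobi:
  assumes x: "x \<in> unit_tangent" and y: "y \<in> unit_tangent" and z: "z \<in> unit_tangent"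
  shows "unit_bracket x (unit_bracket y z) \<otimes>\<^bsub>\<Gamma>1\<^esub> unit_bracket y (unit_bracket z x)
    \<otimes>\<^bsub>\<Gamma>1\<^esub> unit_bracket z (unit_bracket x y) = \<one>\<^bsub>\<Gamma>1\<^esub>"
proof -
  interpret \<Gamma>1: group \<Gamma>1 by (rule group_Gam_One)
  interpret \<Gamma>3: group \<Gamma>3 by (rule group_Gam_One)
  note closed = subgroup.m_closed[OF unit_tangent_subgroup]
  let ?a = "\<delta>2 (\<epsilon>1 x)" and ?b = "\<delta>1 (\<epsilon>1 y)" and ?c = "\<delta>1 (\<epsilon>2 z)"
  let ?P = "\<delta>3 (lift2 (unit_bracket x y))" and ?Q = "\<delta>2 (lift2 (unit_bracket x z))"
    and ?R = "\<delta>1 (lift2 (unit_bracket y z))"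
  note xy = unit_bracket_in[OF x y] and xz = unit_bracket_in[OF x z] and yz = unit_bracket_in[OF y z]
  have abc: "?a \<in> carrier \<Gamma>3" "?b \<in> carrier \<Gamma>3" "?c \<in> carrier \<Gamma>3"
    using unit_tangent_Hom x y z by simp_all
  have D1: "group_commutator \<Gamma>3 ?a ?R = lift3 (unit_bracket x (unit_bracket y z))"
    by (rule iterated_bracket(1)[OF x yz, symmetric])
  have D2: "group_commutator \<Gamma>3 ?b ?Q = lift3 (unit_bracket y (unit_bracket x z))"
    by (rule iterated_bracket(2)[OF y xz, symmetric])
  have "group_commutator \<Gamma>3 ?c ?P = inv\<^bsub>\<Gamma>3\<^esub> (lift3 (unit_bracket (unit_bracket x y) z))"
    unfolding iterated_bracket(3)[OF z xy]
    by (rule \<Gamma>3.inv_commutator[symmetric]) (fact abc \<delta>_kernel(1)[OF xy])+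
  also have "\<dots> = lift3 (inv\<^bsub>\<Gamma>1\<^esub> (unit_bracket (unit_bracket x y) z))"
    by (rule Gam_hom_inv[OF lift3_hom, symmetric])
      (use unit_tangent_carrier[OF unit_bracket_in[OF xy z]] in simp_all)
  also have "\<dots> = lift3 (unit_bracket z (unit_bracket x y))"
    unfolding unit_bracket_antisym[OF z xy] ..
  finally have D3: "group_commutator \<Gamma>3 ?c ?P = lift3 (unit_bracket z (unit_bracket x y))" .
  note D1' = unit_bracket_in[OF x yz] and D2' = unit_bracket_in[OF y xz] and D3' = unit_bracket_in[OF z xy]
  have "group_commutator \<Gamma>3 ?a ?R \<otimes>\<^bsub>\<Gamma>3\<^esub> group_commutator \<Gamma>3 ?c ?P = group_commutator \<Gamma>3 ?b ?Q"
  proof (rule \<Gamma>3.commutator_jacobi[OF abc \<delta>_bracket(1)[OF x y] \<delta>_bracket(2)[OF x z] \<delta>_bracket(3)[OF y z]])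
    show "?P \<otimes>\<^bsub>\<Gamma>3\<^esub> ?Q = ?Q \<otimes>\<^bsub>\<Gamma>3\<^esub> ?P" by (rule \<delta>_commute(1)[OF xy xz])
    show "?P \<otimes>\<^bsub>\<Gamma>3\<^esub> ?R = ?R \<otimes>\<^bsub>\<Gamma>3\<^esub> ?P" by (rule \<delta>_commute(2)[OF xy yz])
    show "?Q \<otimes>\<^bsub>\<Gamma>3\<^esub> ?R = ?R \<otimes>\<^bsub>\<Gamma>3\<^esub> ?Q" by (rule \<delta>_commute(3)[OF xz yz])
    show "group_commutator \<Gamma>3 ?b ?Q \<otimes>\<^bsub>\<Gamma>3\<^esub> ?P = ?P \<otimes>\<^bsub>\<Gamma>3\<^esub> group_commutator \<Gamma>3 ?b ?Q"
      unfolding D2 by (rule \<delta>_commute(4)[OF D2' xy])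
    show "group_commutator \<Gamma>3 ?c ?P \<otimes>\<^bsub>\<Gamma>3\<^esub> ?Q = ?Q \<otimes>\<^bsub>\<Gamma>3\<^esub> group_commutator \<Gamma>3 ?c ?P"
      unfolding D3 by (rule \<delta>_commute(5)[OF D3' xz])
    show "group_commutator \<Gamma>3 ?c ?P \<otimes>\<^bsub>\<Gamma>3\<^esub> ?R = ?R \<otimes>\<^bsub>\<Gamma>3\<^esub> group_commutator \<Gamma>3 ?c ?P"
      unfolding D3 by (rule \<delta>_commute(6)[OF D3' yz])
  qed
  then have "lift3 (unit_bracket x (unit_bracket y z) \<otimes>\<^bsub>\<Gamma>1\<^esub> unit_bracket z (unit_bracket x y))
      = lift3 (unit_bracket y (unit_bracket x z))"
    unfolding D1 D2 D3
    using hom_mult[OF lift3_hom unit_tangent_carrier[OF D1'] unit_tangent_carrier[OF D3']] by simp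
  then have eq: "unit_bracket x (unit_bracket y z) \<otimes>\<^bsub>\<Gamma>1\<^esub> unit_bracket z (unit_bracket x y)
      = unit_bracket y (unit_bracket x z)"
    using lift3_inj[OF closed[OF D1' D3'] D2'] by blast
  have zx: "unit_bracket z x \<in> unit_tangent" by (rule unit_bracket_in[OF z x])
  have D4: "unit_bracket y (unit_bracket z x) \<in> unit_tangent" by (rule unit_bracket_in[OF y zx])
  have "unit_bracket y (unit_bracket x z) = inv\<^bsub>\<Gamma>1\<^esub> (unit_bracket y (unit_bracket z x))"
    unfolding unit_bracket_antisym[OF x z] by (rule unit_bracket_inv_right[OF y zx])
  then have "unit_bracket x (unit_bracket y z) \<otimes>\<^bsub>\<Gamma>1\<^esub> unit_bracket z (unit_bracket x y)
      \<otimes>\<^bsub>\<Gamma>1\<^esub> unit_bracket y (unit_bracket z x) = \<one>\<^bsub>\<Gamma>1\<^esub>"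
    using eq unit_tangent_carrier[OF D4] by simp
  then show ?thesis
    using unit_tangent_commute[OF D3' D4] unit_tangent_carrier[OF D4] unit_tangent_carrier[OF D1']
      unit_tangent_carrier[OF D3'] by (simp only: \<Gamma>1.m_assoc)
qed

end

section \<open>Lie algebras over the integers from abelian groups\<close>

text \<open>The given negation is used for negative multiples, so scalar multiplication corresponds to integer
powers in \<open>K\<close>, and every law can be checked in \<open>K\<close>. Additivity of the bracket in the second
argument and compatibility with scalars follow from additivity in the first and antisymmetry.\<close>
lemma lie_algebra_transport:
  fixes K :: "'b monoid" and A :: "(int, 'a, 'm) lie_alg_scheme"
    and \<phi> :: "'a \<Rightarrow> 'b" and ng :: "'a \<Rightarrow> 'a" and br :: "'b \<Rightarrow> 'b \<Rightarrow> 'b"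
  assumes K: "comm_group K"
    and br: "\<And>x y. \<lbrakk>x \<in> carrier K; y \<in> carrier K\<rbrakk> \<Longrightarrow> br x y \<in> carrier K"
    and br_left: "\<And>x y z. \<lbrakk>x \<in> carrier K; y \<in> carrier K; z \<in> carrier K\<rbrakk>
      \<Longrightarrow> br (x \<otimes>\<^bsub>K\<^esub> y) z = br x z \<otimes>\<^bsub>K\<^esub> br y z"
    and br_antisym: "\<And>x y. \<lbrakk>x \<in> carrier K; y \<in> carrier K\<rbrakk> \<Longrightarrow> br x y = inv\<^bsub>K\<^esub> (br y x)"
    and br_jacobi: "\<And>x y z. \<lbrakk>x \<in> carrier K; y \<in> carrier K; z \<in> carrier K\<rbrakk>
      \<Longrightarrow> br x (br y z) \<otimes>\<^bsub>K\<^esub> br y (br z x) \<otimes>\<^bsub>K\<^esub> br z (br x y) = \<one>\<^bsub>K\<^esub>"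
    and \<phi>: "bij_betw \<phi> (carrier A) (carrier K)"
    and add: "\<And>a b. \<lbrakk>a \<in> carrier A; b \<in> carrier A\<rbrakk>
      \<Longrightarrow> a \<oplus>\<^bsub>A\<^esub> b \<in> carrier A \<and> \<phi> (a \<oplus>\<^bsub>A\<^esub> b) = \<phi> a \<otimes>\<^bsub>K\<^esub> \<phi> b"
    and zero: "\<zero>\<^bsub>A\<^esub> \<in> carrier A" "\<phi> \<zero>\<^bsub>A\<^esub> = \<one>\<^bsub>K\<^esub>"
    and ng: "\<And>a. a \<in> carrier A \<Longrightarrow> ng a \<in> carrier A \<and> \<phi> (ng a) = inv\<^bsub>K\<^esub> (\<phi> a)"
    and smult: "smult A = int_multiple (add A) \<zero>\<^bsub>A\<^esub> ng"
    and lie: "\<And>a b. \<lbrakk>a \<in> carrier A; b \<in> carrier A\<rbrakk>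
      \<Longrightarrow> lie A a b \<in> carrier A \<and> \<phi> (lie A a b) = br (\<phi> a) (\<phi> b)"
  shows "lie_algebra \<Z> A"
proof -
  interpret K: comm_group K by (rule K)
  have \<phi>_in [simp]: "\<phi> a \<in> carrier K" if "a \<in> carrier A" for a
    using \<phi> that by (auto simp: bij_betw_def)
  have \<phi>_eq: "a = b" if "\<phi> a = \<phi> b" "a \<in> carrier A" "b \<in> carrier A" for a b
    using \<phi> that by (auto simp: bij_betw_def dest: inj_onD)
  note [simp] = add zero ng lie br

  have nat_mult: "((add A a) ^^ n) \<zero>\<^bsub>A\<^esub> \<in> carrier A
      \<and> \<phi> (((add A a) ^^ n) \<zero>\<^bsub>A\<^esub>) = \<phi> a [^]\<^bsub>K\<^esub> n" if a: "a \<in> carrier A" for a n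
  proof (induction n)
    case (Suc n)
    then show ?case using a by (simp add: K.m_comm)
  qed simp
  have smult_\<phi> [simp]: "k \<odot>\<^bsub>A\<^esub> a \<in> carrier A \<and> \<phi> (k \<odot>\<^bsub>A\<^esub> a) = \<phi> a [^]\<^bsub>K\<^esub> k"
    if a: "a \<in> carrier A" for a and k :: int
  proof -
    define s where "s n = ((add A a) ^^ n) \<zero>\<^bsub>A\<^esub>" for n
    have s: "s n \<in> carrier A" "\<phi> (s n) = \<phi> a [^]\<^bsub>K\<^esub> n" for n
      using nat_mult[OF a] by (simp_all only: s_def)
    have k: "k \<odot>\<^bsub>A\<^esub> a = (if 0 \<le> k then s (nat k) else ng (s (nat (- k))))"
      by (simp only: smult int_multiple_def s_def)
    show ?thesis
      by (cases "0 \<le> k")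
        (simp_all only: k s ng int_pow_def2 not_less[symmetric] not_le if_True if_False simp_thms)
  qed

  have ab: "abelian_group A"
  proof (rule abelian_groupI)
    fix a assume a: "a \<in> carrier A"
    show "\<exists>b\<in>carrier A. b \<oplus>\<^bsub>A\<^esub> a = \<zero>\<^bsub>A\<^esub>"
      using a by (intro bexI[of _ "ng a"]) (auto intro!: \<phi>_eq)
  qed (auto intro!: \<phi>_eq simp: K.m_ac)
  interpret A: abelian_group A by (rule ab)
  have minus [simp]: "\<phi> (\<ominus>\<^bsub>A\<^esub> a) = inv\<^bsub>K\<^esub> (\<phi> a)" if a: "a \<in> carrier A" for a
  proof -
    have "\<phi> (\<ominus>\<^bsub>A\<^esub> a) \<otimes>\<^bsub>K\<^esub> \<phi> a = \<phi> (\<ominus>\<^bsub>A\<^esub> a \<oplus>\<^bsub>A\<^esub> a)" using a by simp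
    also have "\<dots> = \<one>\<^bsub>K\<^esub>" using a by (simp only: A.l_neg zero)
    finally show ?thesis using a K.inv_equality[of "\<phi> (\<ominus>\<^bsub>A\<^esub> a)" "\<phi> a"] by simp
  qed

  have br_right: "br x (y \<otimes>\<^bsub>K\<^esub> z) = br x y \<otimes>\<^bsub>K\<^esub> br x z"
    if "x \<in> carrier K" "y \<in> carrier K" "z \<in> carrier K" for x y z
    using that br_antisym[of x "y \<otimes>\<^bsub>K\<^esub> z"] br_antisym[of x y] br_antisym[of x z]
    by (simp add: br_left K.inv_mult)
  have pow_left: "br (x [^]\<^bsub>K\<^esub> k) y = br x y [^]\<^bsub>K\<^esub> k"
    if "x \<in> carrier K" "y \<in> carrier K" for x y and k :: int
  proof -
    have "(\<lambda>x. br x y) \<in> hom K K" using that by (auto simp: hom_def br_left)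
    from hom_int_pow[OF this] that show ?thesis by simp
  qed
  have pow_right: "br x (y [^]\<^bsub>K\<^esub> k) = br x y [^]\<^bsub>K\<^esub> k"
    if "x \<in> carrier K" "y \<in> carrier K" for x y and k :: int
  proof -
    have "(\<lambda>y. br x y) \<in> hom K K" using that by (auto simp: hom_def br_right)
    from hom_int_pow[OF this] that show ?thesis by simp
  qed

  have mod: "module \<Z> A"
  proof (rule moduleI[OF int_is_cring ab])
    show "k \<odot>\<^bsub>A\<^esub> a \<in> carrier A" if "a \<in> carrier A" for k a using that by simp
    show "(k \<oplus>\<^bsub>\<Z>\<^esub> l) \<odot>\<^bsub>A\<^esub> a = k \<odot>\<^bsub>A\<^esub> a \<oplus>\<^bsub>A\<^esub> l \<odot>\<^bsub>A\<^esub> a" if "a \<in> carrier A" for k l a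
      using that by (intro \<phi>_eq) (simp_all add: K.int_pow_mult)
    show "k \<odot>\<^bsub>A\<^esub> (a \<oplus>\<^bsub>A\<^esub> b) = k \<odot>\<^bsub>A\<^esub> a \<oplus>\<^bsub>A\<^esub> k \<odot>\<^bsub>A\<^esub> b" if "a \<in> carrier A" "b \<in> carrier A" for k a b
      using that by (intro \<phi>_eq) (simp_all add: K.int_pow_distrib)
    show "(k \<otimes>\<^bsub>\<Z>\<^esub> l) \<odot>\<^bsub>A\<^esub> a = k \<odot>\<^bsub>A\<^esub> (l \<odot>\<^bsub>A\<^esub> a)" if "a \<in> carrier A" for k l a
      using that by (intro \<phi>_eq) (simp_all add: K.int_pow_pow mult.commute)
    show "\<one>\<^bsub>\<Z>\<^esub> \<odot>\<^bsub>A\<^esub> a = a" if "a \<in> carrier A" for a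
      using that by (intro \<phi>_eq) simp_all
  qed
  show ?thesis
  proof (rule lie_algebra.intro[OF mod], unfold_locales)
    fix x y z assume xyz: "x \<in> carrier A" "y \<in> carrier A" "z \<in> carrier A"
    show "lie A (x \<oplus>\<^bsub>A\<^esub> y) z = lie A x z \<oplus>\<^bsub>A\<^esub> lie A y z"
      using xyz by (intro \<phi>_eq) (simp_all add: br_left)
    show "lie A x (y \<oplus>\<^bsub>A\<^esub> z) = lie A x y \<oplus>\<^bsub>A\<^esub> lie A x z"
      using xyz by (intro \<phi>_eq) (simp_all add: br_right)
    show "lie A x (lie A y z) \<oplus>\<^bsub>A\<^esub> lie A y (lie A z x) \<oplus>\<^bsub>A\<^esub> lie A z (lie A x y) = \<zero>\<^bsub>A\<^esub>"
      using xyz by (intro \<phi>_eq) (simp_all add: br_jacobi)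
  next
    fix x y assume xy: "x \<in> carrier A" "y \<in> carrier A"
    show "lie A x y \<in> carrier A" using xy by simp
    show "lie A x y = \<ominus>\<^bsub>A\<^esub> lie A y x"
      using xy br_antisym[of "\<phi> x" "\<phi> y"] by (intro \<phi>_eq) simp_all
    show "lie A (k \<odot>\<^bsub>A\<^esub> x) y = k \<odot>\<^bsub>A\<^esub> lie A x y" for k
      using xy by (intro \<phi>_eq) (simp_all add: pow_left)
    show "lie A x (k \<odot>\<^bsub>A\<^esub> y) = k \<odot>\<^bsub>A\<^esub> lie A x y" for k
      using xy by (intro \<phi>_eq) (simp_all add: pow_right)
  qed
qed


section \<open>The Lie algebra of a group object\<close>

context tangent_group
begin

definition unit_group :: "'a monoid"
  where "unit_group = \<Gamma>1\<lparr>carrier := unit_tangent\<rparr>"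

lemma unit_group_simps:
  "carrier unit_group = unit_tangent"
  "x \<otimes>\<^bsub>unit_group\<^esub> y = x \<otimes>\<^bsub>\<Gamma>1\<^esub> y"
  "\<one>\<^bsub>unit_group\<^esub> = \<one>\<^bsub>\<Gamma>1\<^esub>"
  by (simp_all add: unit_group_def)

lemma unit_group_inv: "x \<in> unit_tangent \<Longrightarrow> inv\<^bsub>unit_group\<^esub> x = inv\<^bsub>\<Gamma>1\<^esub> x"
  unfolding unit_group_def by (rule group.m_inv_consistent[OF group_Gam_One unit_tangent_subgroup])

lemma unit_group_comm: "comm_group unit_group"
proof -
  have "group unit_group"
    unfolding unit_group_def by (rule group.subgroup_imp_group[OF group_Gam_One unit_tangent_subgroup])
  then show ?thesis
    by (rule group.group_comm_groupI) (simp add: unit_group_simps unit_tangent_commute)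
qed

context
  fixes e j :: 'a
  assumes pb: "is_pullback X u (proj X G) e j"
begin

lemma pb_typing: "e \<in> Arr X" "Cod X e = One X" "Dom X e = Dom X j" "j \<in> Arr X" "Cod X j = Tob X G"
    "e \<Zcomp> u = j \<Zcomp> proj X G"
  using pullback_typing[OF pb] by simp_all

text \<open>Points of \<open>T(G)\<^sub>u\<close> are the same as tangent vectors at the unit, since their other component is the
only map \<open>1 \<rightarrow> 1\<close>.\<close>
lemma point_unit_tangent:
  assumes k: "k \<in> Hom X (One X) (Dom X j)"
  shows "k \<Zcomp> j \<in> unit_tangent"
proof -
  have "k \<Zcomp> e = Id X (One X)"
    by (rule terminal_eq[OF One_terminal, of _ "One X"]) (use k pb_typing in simp_all)
  moreover have "(k \<Zcomp> j) \<Zcomp> proj X G = (k \<Zcomp> e) \<Zcomp> u" using k pb_typing by simp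
  ultimately show ?thesis using k pb_typing by (simp add: unit_tangent_iff)
qed

lemma at_unit_point:
  assumes "u \<Zcomp> f \<in> unit_tangent"
  shows "at_unit X u e j f \<in> Hom X (One X) (Dom X j)" "at_unit X u e j f \<Zcomp> j = u \<Zcomp> f"
  using pair_pullback[OF pb, of "bang X (One X)" "One X" "u \<Zcomp> f"] assms pb_typing(3)
  by (simp_all add: at_unit_def unit_tangent_iff bang_One)

lemma point_eqI:
  assumes "k \<in> Hom X (One X) (Dom X j)" "l \<in> Hom X (One X) (Dom X j)" "k \<Zcomp> j = l \<Zcomp> j"
  shows "k = l"
proof (rule pullback_ext[OF pb, of _ "One X"])
  show "k \<Zcomp> e = l \<Zcomp> e"
    by (rule terminal_eq[OF One_terminal, of _ "One X"]) (use assms pb_typing in simp_all)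
qed (use assms pb_typing in simp_all)

lemma bij_point: "bij_betw (\<lambda>k. k \<Zcomp> j) (Hom X (One X) (Dom X j)) unit_tangent"
proof (rule bij_betw_imageI)
  show "inj_on (\<lambda>k. k \<Zcomp> j) (Hom X (One X) (Dom X j))"
    using point_eqI by (auto intro: inj_onI)
  have "x \<in> (\<lambda>k. k \<Zcomp> j) ` Hom X (One X) (Dom X j)" if x: "x \<in> unit_tangent" for x
  proof -
    have ux: "u \<Zcomp> translate x = x" using unit_translate unit_tangent_Hom[OF x] .
    have "u \<Zcomp> translate x \<in> unit_tangent" unfolding ux by (rule x)
    note at_unit_point[OF this, unfolded ux]
    then show ?thesis by (metis imageI)
  qed
  then show "(\<lambda>k. k \<Zcomp> j) ` Hom X (One X) (Dom X j) = unit_tangent"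
    using point_unit_tangent by blast
qed

text \<open>This is the bijectivity of \<open>\<xi> \<mapsto> \<langle>!, u \<xi>\<rangle>\<close> on left-invariant fields: its inverse is translation.\<close>
lemma extend_vf_eq_translate:
  assumes k: "k \<in> Hom X (One X) (Dom X j)"
  shows "extend_vf X G m u e j k = translate (k \<Zcomp> j)"
  unfolding extend_vf_def
proof (rule the_inv_into_f_eq)
  note kj = point_unit_tangent[OF k]
  have ux: "u \<Zcomp> translate (k \<Zcomp> j) = k \<Zcomp> j" using unit_translate unit_tangent_Hom[OF kj] .
  show "inj_on (at_unit X u e j) (left_invariant_vfs X G m)"
  proof (rule inj_onI)
    fix \<xi> \<zeta> assume \<xi>: "\<xi> \<in> left_invariant_vfs X G m" and \<zeta>: "\<zeta> \<in> left_invariant_vfs X G m"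
      and eq: "at_unit X u e j \<xi> = at_unit X u e j \<zeta>"
    have "u \<Zcomp> \<xi> = u \<Zcomp> \<zeta>"
      using at_unit_point(2)[OF left_invariant_eq_translate(1)[OF \<xi>]]
        at_unit_point(2)[OF left_invariant_eq_translate(1)[OF \<zeta>]] eq by simp
    then show "\<xi> = \<zeta>"
      using left_invariant_eq_translate(2)[OF \<xi>] left_invariant_eq_translate(2)[OF \<zeta>] by metis
  qed
  show "translate (k \<Zcomp> j) \<in> left_invariant_vfs X G m" by (rule translate_left_invariant[OF kj])
  have "u \<Zcomp> translate (k \<Zcomp> j) \<in> unit_tangent" unfolding ux by (rule kj)
  note p = at_unit_point[OF this, unfolded ux]
  show "at_unit X u e j (translate (k \<Zcomp> j)) = k" by (rule point_eqI[OF p(1) k p(2)])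
qed

lemma group_lie_algebra_is_lie_algebra: "lie_algebra \<Z> (group_lie_algebra X G m u e j)"
proof (rule lie_algebra_transport[where br = unit_bracket and \<phi> = "\<lambda>k. k \<Zcomp> j"
        and ng = "group_lie_neg X G m u e j", OF unit_group_comm],
    unfold unit_group_simps)
  let ?A = "group_lie_algebra X G m u e j"
  have cA: "carrier ?A = Hom X (One X) (Dom X j)" by (simp add: group_lie_algebra_def)
  note sub = subgroup.one_closed[OF unit_tangent_subgroup] subgroup.m_closed[OF unit_tangent_subgroup]
    subgroup.m_inv_closed[OF unit_tangent_subgroup]
  have ext: "extend_vf X G m u e j k = translate (k \<Zcomp> j)" "k \<Zcomp> j \<in> unit_tangent"
    "translate (k \<Zcomp> j) \<in> Hom X G (Tob X G)" "translate (k \<Zcomp> j) \<Zcomp> proj X G = Id X G"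
    "u \<Zcomp> translate (k \<Zcomp> j) = k \<Zcomp> j"
    if "k \<in> carrier ?A" for k
  proof -
    have k: "k \<in> Hom X (One X) (Dom X j)" using that unfolding cA .
    note kj = point_unit_tangent[OF k]
    show "extend_vf X G m u e j k = translate (k \<Zcomp> j)" by (rule extend_vf_eq_translate[OF k])
    show "k \<Zcomp> j \<in> unit_tangent" by (rule kj)
    show "translate (k \<Zcomp> j) \<in> Hom X G (Tob X G)" "translate (k \<Zcomp> j) \<Zcomp> proj X G = Id X G"
      using translate_vector_field[OF kj] by (simp_all add: vector_fields_def)
    show "u \<Zcomp> translate (k \<Zcomp> j) = k \<Zcomp> j" using unit_translate unit_tangent_Hom[OF kj] .
  qed
  have u0: "u \<Zcomp> tzero X G = \<one>\<^bsub>\<Gamma>1\<^esub>"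
    using Gam_hom_one[OF tzero_hom[of 0 "One X"]] by (simp add: one_unit)
  show "unit_bracket x y \<in> unit_tangent" if "x \<in> unit_tangent" "y \<in> unit_tangent" for x y
    using that by (rule unit_bracket_in)
  show "unit_bracket (x \<otimes>\<^bsub>\<Gamma>1\<^esub> y) z = unit_bracket x z \<otimes>\<^bsub>\<Gamma>1\<^esub> unit_bracket y z"
    if "x \<in> unit_tangent" "y \<in> unit_tangent" "z \<in> unit_tangent" for x y z
    using that by (rule unit_bracket_add_left)
  show "unit_bracket x y = inv\<^bsub>unit_group\<^esub> unit_bracket y x" if "x \<in> unit_tangent" "y \<in> unit_tangent" for x y
    using unit_bracket_antisym[OF that] unit_group_inv[OF unit_bracket_in] that by metis
  show "unit_bracket x (unit_bracket y z) \<otimes>\<^bsub>\<Gamma>1\<^esub> unit_bracket y (unit_bracket z x) \<otimes>\<^bsub>\<Gamma>1\<^esub>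
       unit_bracket z (unit_bracket x y) = \<one>\<^bsub>\<Gamma>1\<^esub>"
    if "x \<in> unit_tangent" "y \<in> unit_tangent" "z \<in> unit_tangent" for x y z
    using that by (rule unit_bracket_jacobi)
  show "bij_betw (\<lambda>k. k \<Zcomp> j) (carrier ?A) unit_tangent" unfolding cA by (rule bij_point)
  show "k \<oplus>\<^bsub>?A\<^esub> l \<in> carrier ?A \<and> (k \<oplus>\<^bsub>?A\<^esub> l) \<Zcomp> j = (k \<Zcomp> j) \<otimes>\<^bsub>\<Gamma>1\<^esub> (l \<Zcomp> j)"
    if kl: "k \<in> carrier ?A" "l \<in> carrier ?A" for k l
  proof -
    note k = ext[OF kl(1)] and l = ext[OF kl(2)]
    let ?s = "tangent_sum X G (translate (k \<Zcomp> j)) (translate (l \<Zcomp> j))"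
    have "u \<Zcomp> ?s = tangent_sum X G (k \<Zcomp> j) (l \<Zcomp> j)"
      using tangent_sum_precomp[OF G_Obj k(3) l(3), of u "One X"] k(4,5) l(4,5) by simp
    also have "\<dots> = (k \<Zcomp> j) \<otimes>\<^bsub>\<Gamma>1\<^esub> (l \<Zcomp> j)"
      using sum_on_kernel[of "One X" "k \<Zcomp> j" 0 "l \<Zcomp> j"] k(2) l(2)
      by (simp only: unit_tangent_iff one_unit funpow.simps id_apply comp_apply One_Obj)
    finally have us: "u \<Zcomp> ?s = (k \<Zcomp> j) \<otimes>\<^bsub>\<Gamma>1\<^esub> (l \<Zcomp> j)" .
    have "k \<oplus>\<^bsub>?A\<^esub> l = at_unit X u e j ?s"
      by (simp add: group_lie_algebra_def group_lie_plus_def tangent_sum_def k(1) l(1))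
    then show ?thesis
      using at_unit_point[of ?s, unfolded us] sub(2)[OF k(2) l(2)] unfolding cA by metis
  qed
  have zero: "\<zero>\<^bsub>?A\<^esub> = at_unit X u e j (tzero X G)"
    by (simp add: group_lie_algebra_def group_lie_zero_def)
  show "\<zero>\<^bsub>?A\<^esub> \<in> carrier ?A" "\<zero>\<^bsub>?A\<^esub> \<Zcomp> j = \<one>\<^bsub>\<Gamma>1\<^esub>"
    using at_unit_point[of "tzero X G", unfolded u0] sub(1) unfolding cA zero by metis+
  show "group_lie_neg X G m u e j k \<in> carrier ?A \<and>
      group_lie_neg X G m u e j k \<Zcomp> j = inv\<^bsub>unit_group\<^esub> (k \<Zcomp> j)"
    if k: "k \<in> carrier ?A" for k
  proof -
    interpret \<Gamma>1: group \<Gamma>1 by (rule group_Gam_One)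
    note k = ext[OF k]
    have kj: "k \<Zcomp> j \<in> Hom X (One X) (Tob X G)" "(k \<Zcomp> j) \<Zcomp> proj X G = u"
      using k(2) by (simp_all add: unit_tangent_iff del: Comp_assoc_right Hom_iff)
    have "u \<Zcomp> (translate (k \<Zcomp> j) \<Zcomp> neg X G) = (u \<Zcomp> translate (k \<Zcomp> j)) \<Zcomp> neg X G"
      using k(3) neg_formula(2)[of "One X" "k \<Zcomp> j" 0] kj(1) by simp
    also have "\<dots> = \<one>\<^bsub>\<Gamma>1\<^esub> \<otimes>\<^bsub>\<Gamma>1\<^esub> inv\<^bsub>\<Gamma>1\<^esub> (k \<Zcomp> j) \<otimes>\<^bsub>\<Gamma>1\<^esub> \<one>\<^bsub>\<Gamma>1\<^esub>"
      using neg_formula(1)[of "One X" "k \<Zcomp> j" 0] kj u0 unfolding k(5)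
      by (simp only: funpow.simps id_apply comp_apply One_Obj)
    also have "\<dots> = inv\<^bsub>\<Gamma>1\<^esub> (k \<Zcomp> j)"
      using unit_tangent_carrier[OF k(2)] by (simp only: \<Gamma>1.l_one \<Gamma>1.r_one \<Gamma>1.inv_closed)
    finally have un: "u \<Zcomp> (translate (k \<Zcomp> j) \<Zcomp> neg X G) = inv\<^bsub>\<Gamma>1\<^esub> (k \<Zcomp> j)" .
    have "group_lie_neg X G m u e j k = at_unit X u e j (translate (k \<Zcomp> j) \<Zcomp> neg X G)"
      by (simp add: group_lie_neg_def k(1))
    then show ?thesis
      using at_unit_point[of "translate (k \<Zcomp> j) \<Zcomp> neg X G", unfolded un] sub(3)[OF k(2)]
        unit_group_inv[OF k(2)] unfolding cA by metis
  qed
  show "(\<odot>\<^bsub>?A\<^esub>) = int_multiple (add ?A) \<zero>\<^bsub>?A\<^esub> (group_lie_neg X G m u e j)"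
    by (simp add: group_lie_algebra_def)
  show "lie ?A k l \<in> carrier ?A \<and> lie ?A k l \<Zcomp> j = unit_bracket (k \<Zcomp> j) (l \<Zcomp> j)"
    if kl: "k \<in> carrier ?A" "l \<in> carrier ?A" for k l
  proof -
    note k = ext[OF kl(1)] and l = ext[OF kl(2)]
    let ?b = "vf_bracket X G (translate (k \<Zcomp> j)) (translate (l \<Zcomp> j))"
    have "lie ?A k l = at_unit X u e j ?b"
      by (simp add: group_lie_algebra_def group_lie_bracket_def k(1) l(1))
    then show ?thesis
      using at_unit_point[of ?b] unit_bracket_in[OF k(2) l(2)] unfolding unit_bracket_def cA by metis
  qed
qed

end

end

theorem theorem4:
  fixes X :: "('o, 'a, 'm) cartesian_tangent_cat_scheme"
    and G :: 'o
    and m u i e j :: 'a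
  assumes "cartesian_tangent_category X"
    and "group_object X G m u i"
    and "is_pullback X u (proj X G) e j"
  shows "lie_algebra \<Z> (group_lie_algebra X G m u e j)"
proof -
  interpret cartesian_tangent_category X by fact
  interpret tangent_group X G m u i by unfold_locales fact
  show ?thesis by (rule group_lie_algebra_is_lie_algebra) fact
qed

end
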